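(* Let $\mathcal{A}$ be a semi-abelian category with enough projectives and $\mathcal{B}$ a Birkhoff subcategory of $\mathcal{A}$, with reflector $\mathsf{b}$, that contains $\mathsf{Ab}(\mathcal{A})$. Suppose that for every $\mathsf{b}$-central extension $u\colon U\to A$ the following five conditions are all equivalent: (1) $U$ is $\mathsf{b}$-perfect and every $\mathsf{b}$-central extension of $U$ splits; (2) $U$ is $\mathsf{b}$-perfect and projective with respect to all $\mathsf{b}$-central extensions; (3) for every $\mathsf{b}$-central extension $f\colon X\to Y$ in $\mathcal{A}$, the map $\mathrm{Hom}(U,f)\colon\mathrm{Hom}(U,X)\to\mathrm{Hom}(U,Y)$ is a bijection; (4) $U$ is $\mathsf{b}$-perfect and $u$ is a weakly universal $\mathsf{b}$-central extension; (5) $u$ is a universal $\mathsf{b}$-central extension. Then the following holds: if $B$ is a $\mathsf{b}$-perfect object and $f\colon B\to A$ and $g\colon C\to B$ are $\mathsf{b}$-central extensions, then the extension $f\circ g$ is $\mathsf{b}$-central. In particular, if this hypothesis holds for $\mathcal{B}=\mathsf{Ab}(\mathcal{A})$, then the category $\mathcal{A}$ satisfies condition (UCE).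
   Context: A category is semi-abelian when it is pointed (terminal object $=$ initial object $=0$), Barr exact, Bourn protomodular (the regular Short Five Lemma holds), and has binary coproducts. It has enough projectives when every object is a regular quotient of a (regular) projective object. A Birkhoff subcategory $\mathcal{B}$ of $\mathcal{A}$ is a full and reflective subcategory closed under subobjects and regular quotients; its reflector is $\mathsf{b}\colon\mathcal{A}\to\mathcal{B}$, with unit $\eta\colon 1_{\mathcal{A}}\Rightarrow\mathsf{b}$. An extension is a regular epimorphism. An extension $f\colon B\to A$ is $\mathsf{b}$-trivial if the naturality square $\mathsf{b}(f)\circ\eta_B=\eta_A\circ f$ is a pullback, and $\mathsf{b}$-central if its pullback along some extension $g\colon C\to A$ is $\mathsf{b}$-trivial. An object $P$ is $\mathsf{b}$-perfect when $\mathsf{b}(P)=0$. A (weakly) universal $\mathsf{b}$-central extension of $A$ is a (weakly) initial object of the full subcategory $\mathsf{Centr}_{\mathsf{b}}(A)$ of $(\mathcal{A}\downarrow A)$ determined by the $\mathsf{b}$-central extensions of $A$. An object $U$ is projective with respect to all $\mathsf{b}$-central extensions when for every $\mathsf{b}$-central extension $f\colon X\to Y$ every morphism $U\to Y$ factors through $f$. An extension splits when it admits a section. $\mathsf{Ab}(\mathcal{A})$ is the Birkhoff subcategory of $\mathcal{A}$ of all objects admitting an internal abelian group structure, with reflector $\mathsf{ab}\colon\mathcal{A}\to\mathsf{Ab}(\mathcal{A})$; $\mathsf{ab}$-perfect and $\mathsf{ab}$-central are the notions above for this Birkhoff subcategory. A semi-abelian category $\mathcal{A}$ with enough projectives satisfies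 condition (UCE) when: if $B$ is an $\mathsf{ab}$-perfect object and $f\colon B\to A$ and $g\colon C\to B$ are $\mathsf{ab}$-central extensions, then the extension $f\circ g$ is $\mathsf{ab}$-central. *)

theory Defs
  imports Main
begin

section \<open>Categories, limits and colimits\<close>

record ('o, 'm) cat =
  Obj :: "'o set"
  Arr :: "'m set"
  Dom :: "'m \<Rightarrow> 'o"
  Cod :: "'m \<Rightarrow> 'o"
  Idn :: "'o \<Rightarrow> 'm"
  Comp :: "'m \<Rightarrow> 'm \<Rightarrow> 'm"  (infixr \<open>\<cdot>\<index>\<close> 75)

definition hom :: "('o, 'm) cat \<Rightarrow> 'o \<Rightarrow> 'o \<Rightarrow> 'm set" where
  "hom C X Y = {f \<in> Arr C. Dom C f = X \<and> Cod C f = Y}"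

locale category =
  fixes C :: "('o, 'm) cat" (structure)
  assumes dom_obj: "f \<in> Arr C \<Longrightarrow> Dom C f \<in> Obj C"
    and cod_obj: "f \<in> Arr C \<Longrightarrow> Cod C f \<in> Obj C"
    and idn_hom: "X \<in> Obj C \<Longrightarrow> Idn C X \<in> hom C X X"
    and comp_hom: "f \<in> hom C X Y \<Longrightarrow> g \<in> hom C Y Z \<Longrightarrow> g \<cdot> f \<in> hom C X Z"
    and comp_idn: "f \<in> hom C X Y \<Longrightarrow> f \<cdot> Idn C X = f"
    and idn_comp: "f \<in> hom C X Y \<Longrightarrow> Idn C Y \<cdot> f = f"
    and comp_assoc: "f \<in> hom C W X \<Longrightarrow> g \<in> hom C X Y \<Longrightarrow> h \<in> hom C Y Z
      \<Longrightarrow> (h \<cdot> g) \<cdot> f = h \<cdot> (g \<cdot> f)"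

definition full_subcat :: "('o, 'm) cat \<Rightarrow> 'o set \<Rightarrow> ('o, 'm) cat" where
  "full_subcat C S = C\<lparr> Obj := Obj C \<inter> S,
     Arr := {f \<in> Arr C. Dom C f \<in> S \<and> Cod C f \<in> S} \<rparr>"

text \<open>In the slice over \<open>A\<close> a morphism from \<open>f\<close> to \<open>g\<close> is recorded as a triple \<open>(f, h, g)\<close>
  with \<open>g \<cdot> h = f\<close>, so that it determines its domain and codomain.\<close>

definition slice :: "('o, 'm) cat \<Rightarrow> 'o \<Rightarrow> ('m, 'm \<times> 'm \<times> 'm) cat" where
  "slice C A = \<lparr>
     Obj = {f \<in> Arr C. Cod C f = A},
     Arr = {(f, h, g). f \<in> Arr C \<and> Cod C f = A \<and> g \<in> Arr C \<and> Cod C g = A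
              \<and> h \<in> hom C (Dom C f) (Dom C g) \<and> g \<cdot>\<^bsub>C\<^esub> h = f},
     Dom = (\<lambda>(f, h, g). f),
     Cod = (\<lambda>(f, h, g). g),
     Idn = (\<lambda>f. (f, Idn C (Dom C f), f)),
     Comp = (\<lambda>(g', k, l) (f, h, g). (f, k \<cdot>\<^bsub>C\<^esub> h, l)) \<rparr>"

definition monic :: "('o, 'm) cat \<Rightarrow> 'm \<Rightarrow> bool" where
  "monic C f \<longleftrightarrow> f \<in> Arr C \<and>
     (\<forall>T. \<forall>g \<in> hom C T (Dom C f). \<forall>h \<in> hom C T (Dom C f).
        f \<cdot>\<^bsub>C\<^esub> g = f \<cdot>\<^bsub>C\<^esub> h \<longrightarrow> g = h)"

definition is_iso :: "('o, 'm) cat \<Rightarrow> 'm \<Rightarrow> bool" where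
  "is_iso C f \<longleftrightarrow> f \<in> Arr C \<and>
     (\<exists>g \<in> hom C (Cod C f) (Dom C f).
        g \<cdot>\<^bsub>C\<^esub> f = Idn C (Dom C f) \<and> f \<cdot>\<^bsub>C\<^esub> g = Idn C (Cod C f))"

definition is_terminal :: "('o, 'm) cat \<Rightarrow> 'o \<Rightarrow> bool" where
  "is_terminal C Z \<longleftrightarrow> Z \<in> Obj C \<and> (\<forall>X \<in> Obj C. \<exists>!f. f \<in> hom C X Z)"

definition is_initial :: "('o, 'm) cat \<Rightarrow> 'o \<Rightarrow> bool" where
  "is_initial C Z \<longleftrightarrow> Z \<in> Obj C \<and> (\<forall>X \<in> Obj C. \<exists>!f. f \<in> hom C Z X)"

definition is_weakly_initial :: "('o, 'm) cat \<Rightarrow> 'o \<Rightarrow> bool" where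
  "is_weakly_initial C Z \<longleftrightarrow> Z \<in> Obj C \<and> (\<forall>X \<in> Obj C. \<exists>f. f \<in> hom C Z X)"

definition is_zero :: "('o, 'm) cat \<Rightarrow> 'o \<Rightarrow> bool" where
  "is_zero C Z \<longleftrightarrow> is_terminal C Z \<and> is_initial C Z"

definition zero_arr :: "('o, 'm) cat \<Rightarrow> 'm \<Rightarrow> bool" where
  "zero_arr C f \<longleftrightarrow> f \<in> Arr C \<and>
     (\<exists>Z. is_zero C Z \<and> (\<exists>g \<in> hom C (Dom C f) Z. \<exists>h \<in> hom C Z (Cod C f). f = h \<cdot>\<^bsub>C\<^esub> g))"

definition is_product :: "('o, 'm) cat \<Rightarrow> 'o \<Rightarrow> 'o \<Rightarrow> 'o \<Rightarrow> 'm \<Rightarrow> 'm \<Rightarrow> bool" where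
  "is_product C X Y P p q \<longleftrightarrow> p \<in> hom C P X \<and> q \<in> hom C P Y \<and>
     (\<forall>T. \<forall>x \<in> hom C T X. \<forall>y \<in> hom C T Y.
        \<exists>!h. h \<in> hom C T P \<and> p \<cdot>\<^bsub>C\<^esub> h = x \<and> q \<cdot>\<^bsub>C\<^esub> h = y)"

definition is_coproduct :: "('o, 'm) cat \<Rightarrow> 'o \<Rightarrow> 'o \<Rightarrow> 'o \<Rightarrow> 'm \<Rightarrow> 'm \<Rightarrow> bool" where
  "is_coproduct C X Y Q i j \<longleftrightarrow> i \<in> hom C X Q \<and> j \<in> hom C Y Q \<and>
     (\<forall>T. \<forall>x \<in> hom C X T. \<forall>y \<in> hom C Y T.
        \<exists>!h. h \<in> hom C Q T \<and> h \<cdot>\<^bsub>C\<^esub> i = x \<and> h \<cdot>\<^bsub>C\<^esub> j = y)"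

text \<open>\<open>is_pullback C f g p q\<close>: the square \<open>f \<cdot> p = g \<cdot> q\<close> is a pullback; thus \<open>q\<close> is the
  pullback of \<open>f\<close> along \<open>g\<close>.\<close>

definition is_pullback :: "('o, 'm) cat \<Rightarrow> 'm \<Rightarrow> 'm \<Rightarrow> 'm \<Rightarrow> 'm \<Rightarrow> bool" where
  "is_pullback C f g p q \<longleftrightarrow>
     f \<in> Arr C \<and> g \<in> Arr C \<and> p \<in> Arr C \<and> q \<in> Arr C \<and>
     Cod C f = Cod C g \<and> Cod C p = Dom C f \<and> Cod C q = Dom C g \<and> Dom C p = Dom C q \<and>
     f \<cdot>\<^bsub>C\<^esub> p = g \<cdot>\<^bsub>C\<^esub> q \<and>
     (\<forall>T. \<forall>x \<in> hom C T (Dom C f). \<forall>y \<in> hom C T (Dom C g).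
        f \<cdot>\<^bsub>C\<^esub> x = g \<cdot>\<^bsub>C\<^esub> y \<longrightarrow>
        (\<exists>!h. h \<in> hom C T (Dom C p) \<and> p \<cdot>\<^bsub>C\<^esub> h = x \<and> q \<cdot>\<^bsub>C\<^esub> h = y))"

definition is_kernel_pair :: "('o, 'm) cat \<Rightarrow> 'm \<Rightarrow> 'm \<Rightarrow> 'm \<Rightarrow> bool" where
  "is_kernel_pair C f r s \<longleftrightarrow> is_pullback C f f r s"

definition is_coequaliser :: "('o, 'm) cat \<Rightarrow> 'm \<Rightarrow> 'm \<Rightarrow> 'm \<Rightarrow> bool" where
  "is_coequaliser C r s f \<longleftrightarrow>
     r \<in> Arr C \<and> s \<in> Arr C \<and> f \<in> Arr C \<and>
     Dom C r = Dom C s \<and> Cod C r = Dom C f \<and> Cod C s = Dom C f \<and>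
     f \<cdot>\<^bsub>C\<^esub> r = f \<cdot>\<^bsub>C\<^esub> s \<and>
     (\<forall>T. \<forall>x \<in> hom C (Dom C f) T. x \<cdot>\<^bsub>C\<^esub> r = x \<cdot>\<^bsub>C\<^esub> s \<longrightarrow>
        (\<exists>!h. h \<in> hom C (Cod C f) T \<and> h \<cdot>\<^bsub>C\<^esub> f = x))"

definition regular_epi :: "('o, 'm) cat \<Rightarrow> 'm \<Rightarrow> bool" where
  "regular_epi C f \<longleftrightarrow> (\<exists>r s. is_coequaliser C r s f)"

definition is_kernel :: "('o, 'm) cat \<Rightarrow> 'm \<Rightarrow> 'm \<Rightarrow> bool" where
  "is_kernel C k f \<longleftrightarrow>
     k \<in> Arr C \<and> f \<in> Arr C \<and> Cod C k = Dom C f \<and> zero_arr C (f \<cdot>\<^bsub>C\<^esub> k) \<and>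
     (\<forall>T. \<forall>x \<in> hom C T (Dom C f). zero_arr C (f \<cdot>\<^bsub>C\<^esub> x) \<longrightarrow>
        (\<exists>!h. h \<in> hom C T (Dom C k) \<and> k \<cdot>\<^bsub>C\<^esub> h = x))"


section \<open>Semi-abelian categories\<close>

definition pointed :: "('o, 'm) cat \<Rightarrow> bool" where
  "pointed C \<longleftrightarrow> (\<exists>Z. is_zero C Z)"

definition finitely_complete :: "('o, 'm) cat \<Rightarrow> bool" where
  "finitely_complete C \<longleftrightarrow> (\<exists>Z. is_terminal C Z) \<and>
     (\<forall>f \<in> Arr C. \<forall>g \<in> Arr C. Cod C f = Cod C g \<longrightarrow> (\<exists>p q. is_pullback C f g p q))"

definition has_binary_coproducts :: "('o, 'm) cat \<Rightarrow> bool" where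
  "has_binary_coproducts C \<longleftrightarrow>
     (\<forall>X \<in> Obj C. \<forall>Y \<in> Obj C. \<exists>Q i j. is_coproduct C X Y Q i j)"

definition regular_category :: "('o, 'm) cat \<Rightarrow> bool" where
  "regular_category C \<longleftrightarrow> category C \<and> finitely_complete C \<and>
     (\<forall>f r s. is_kernel_pair C f r s \<longrightarrow> (\<exists>q. is_coequaliser C r s q)) \<and>
     (\<forall>f g p q. is_pullback C f g p q \<and> regular_epi C f \<longrightarrow> regular_epi C q)"

text \<open>An internal equivalence relation on \<open>X = Cod r = Cod s\<close>: a jointly monic pair
  \<open>r, s : R \<rightarrow> X\<close> with reflexivity, symmetry and transitivity witnessed by arrows, the last one
  being defined on the object of composable pairs \<open>R \<times>\<^sub>X R\<close>.\<close>

definition equivalence_relation :: "('o, 'm) cat \<Rightarrow> 'm \<Rightarrow> 'm \<Rightarrow> bool" where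
  "equivalence_relation C r s \<longleftrightarrow>
     r \<in> Arr C \<and> s \<in> Arr C \<and> Dom C r = Dom C s \<and> Cod C r = Cod C s \<and>
     (\<forall>T. \<forall>x \<in> hom C T (Dom C r). \<forall>y \<in> hom C T (Dom C r).
        r \<cdot>\<^bsub>C\<^esub> x = r \<cdot>\<^bsub>C\<^esub> y \<and> s \<cdot>\<^bsub>C\<^esub> x = s \<cdot>\<^bsub>C\<^esub> y \<longrightarrow> x = y) \<and>
     (\<exists>d \<in> hom C (Cod C r) (Dom C r).
        r \<cdot>\<^bsub>C\<^esub> d = Idn C (Cod C r) \<and> s \<cdot>\<^bsub>C\<^esub> d = Idn C (Cod C r)) \<and>
     (\<exists>t \<in> hom C (Dom C r) (Dom C r). r \<cdot>\<^bsub>C\<^esub> t = s \<and> s \<cdot>\<^bsub>C\<^esub> t = r) \<and>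
     (\<forall>p q. is_pullback C s r p q \<longrightarrow>
        (\<exists>t \<in> hom C (Dom C p) (Dom C r).
           r \<cdot>\<^bsub>C\<^esub> t = r \<cdot>\<^bsub>C\<^esub> p \<and> s \<cdot>\<^bsub>C\<^esub> t = s \<cdot>\<^bsub>C\<^esub> q))"

definition barr_exact :: "('o, 'm) cat \<Rightarrow> bool" where
  "barr_exact C \<longleftrightarrow> regular_category C \<and>
     (\<forall>r s. equivalence_relation C r s \<longrightarrow> (\<exists>f. is_kernel_pair C f r s))"

text \<open>The regular Short Five Lemma, for a morphism \<open>(u, v, w)\<close> of short exact sequences
  from \<open>(k, f)\<close> to \<open>(k', f')\<close>.\<close>

definition regular_short_five_lemma :: "('o, 'm) cat \<Rightarrow> bool" where
  "regular_short_five_lemma C \<longleftrightarrow>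
     (\<forall>f f' k k' u v w.
        regular_epi C f \<and> regular_epi C f' \<and> is_kernel C k f \<and> is_kernel C k' f' \<and>
        u \<in> hom C (Dom C k) (Dom C k') \<and> v \<in> hom C (Dom C f) (Dom C f') \<and>
        w \<in> hom C (Cod C f) (Cod C f') \<and>
        v \<cdot>\<^bsub>C\<^esub> k = k' \<cdot>\<^bsub>C\<^esub> u \<and> w \<cdot>\<^bsub>C\<^esub> f = f' \<cdot>\<^bsub>C\<^esub> v \<and>
        is_iso C u \<and> is_iso C w \<longrightarrow> is_iso C v)"

definition semi_abelian :: "('o, 'm) cat \<Rightarrow> bool" where
  "semi_abelian C \<longleftrightarrow> category C \<and> pointed C \<and> barr_exact C \<and>
     regular_short_five_lemma C \<and> has_binary_coproducts C"

definition projective :: "('o, 'm) cat \<Rightarrow> 'o \<Rightarrow> bool" where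
  "projective C P \<longleftrightarrow> P \<in> Obj C \<and>
     (\<forall>f. regular_epi C f \<longrightarrow>
        (\<forall>h \<in> hom C P (Cod C f). \<exists>k \<in> hom C P (Dom C f). f \<cdot>\<^bsub>C\<^esub> k = h))"

definition enough_projectives :: "('o, 'm) cat \<Rightarrow> bool" where
  "enough_projectives C \<longleftrightarrow>
     (\<forall>X \<in> Obj C. \<exists>P p. projective C P \<and> p \<in> hom C P X \<and> regular_epi C p)"


section \<open>Birkhoff subcategories and central extensions\<close>

text \<open>A full subcategory is given by its set \<open>B\<close> of objects.\<close>

definition is_reflection :: "('o, 'm) cat \<Rightarrow> 'o set \<Rightarrow> 'o \<Rightarrow> 'm \<Rightarrow> bool" where
  "is_reflection C B X e \<longleftrightarrow> e \<in> Arr C \<and> Dom C e = X \<and> Cod C e \<in> B \<and>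
     (\<forall>Y \<in> B. \<forall>f \<in> hom C X Y. \<exists>!g. g \<in> hom C (Cod C e) Y \<and> g \<cdot>\<^bsub>C\<^esub> e = f)"

definition reflective :: "('o, 'm) cat \<Rightarrow> 'o set \<Rightarrow> bool" where
  "reflective C B \<longleftrightarrow> B \<subseteq> Obj C \<and> (\<forall>X \<in> Obj C. \<exists>e. is_reflection C B X e)"

definition birkhoff :: "('o, 'm) cat \<Rightarrow> 'o set \<Rightarrow> bool" where
  "birkhoff C B \<longleftrightarrow> reflective C B \<and>
     (\<forall>m. monic C m \<and> Cod C m \<in> B \<longrightarrow> Dom C m \<in> B) \<and>
     (\<forall>q. regular_epi C q \<and> Dom C q \<in> B \<longrightarrow> Cod C q \<in> B)"

text \<open>The reflector is determined by \<open>B\<close> up to natural isomorphism; one unit component is chosen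
  for each object, and the action on arrows is then forced by naturality.\<close>

definition unit :: "('o, 'm) cat \<Rightarrow> 'o set \<Rightarrow> 'o \<Rightarrow> 'm" where
  "unit C B X = (SOME e. is_reflection C B X e)"

definition refl_obj :: "('o, 'm) cat \<Rightarrow> 'o set \<Rightarrow> 'o \<Rightarrow> 'o" where
  "refl_obj C B X = Cod C (unit C B X)"

definition refl_arr :: "('o, 'm) cat \<Rightarrow> 'o set \<Rightarrow> 'm \<Rightarrow> 'm" where
  "refl_arr C B f =
     (THE h. h \<in> hom C (refl_obj C B (Dom C f)) (refl_obj C B (Cod C f)) \<and>
        h \<cdot>\<^bsub>C\<^esub> unit C B (Dom C f) = unit C B (Cod C f) \<cdot>\<^bsub>C\<^esub> f)"

abbreviation extension :: "('o, 'm) cat \<Rightarrow> 'm \<Rightarrow> bool" where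
  "extension C f \<equiv> regular_epi C f"

definition trivial_ext :: "('o, 'm) cat \<Rightarrow> 'o set \<Rightarrow> 'm \<Rightarrow> bool" where
  "trivial_ext C B f \<longleftrightarrow> extension C f \<and>
     is_pullback C (refl_arr C B f) (unit C B (Cod C f)) (unit C B (Dom C f)) f"

definition central_ext :: "('o, 'm) cat \<Rightarrow> 'o set \<Rightarrow> 'm \<Rightarrow> bool" where
  "central_ext C B f \<longleftrightarrow> extension C f \<and>
     (\<exists>g p q. extension C g \<and> is_pullback C f g p q \<and> trivial_ext C B q)"

definition perfect :: "('o, 'm) cat \<Rightarrow> 'o set \<Rightarrow> 'o \<Rightarrow> bool" where
  "perfect C B P \<longleftrightarrow> P \<in> Obj C \<and> is_zero C (refl_obj C B P)"

definition Centr :: "('o, 'm) cat \<Rightarrow> 'o set \<Rightarrow> 'o \<Rightarrow> ('m, 'm \<times> 'm \<times> 'm) cat" where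
  "Centr C B A = full_subcat (slice C A) {f. central_ext C B f}"

definition universal_central_ext :: "('o, 'm) cat \<Rightarrow> 'o set \<Rightarrow> 'o \<Rightarrow> 'm \<Rightarrow> bool" where
  "universal_central_ext C B A u \<longleftrightarrow> is_initial (Centr C B A) u"

definition weakly_universal_central_ext :: "('o, 'm) cat \<Rightarrow> 'o set \<Rightarrow> 'o \<Rightarrow> 'm \<Rightarrow> bool" where
  "weakly_universal_central_ext C B A u \<longleftrightarrow> is_weakly_initial (Centr C B A) u"

definition projective_wrt_central :: "('o, 'm) cat \<Rightarrow> 'o set \<Rightarrow> 'o \<Rightarrow> bool" where
  "projective_wrt_central C B U \<longleftrightarrow>
     (\<forall>f. central_ext C B f \<longrightarrow>
        (\<forall>h \<in> hom C U (Cod C f). \<exists>k \<in> hom C U (Dom C f). f \<cdot>\<^bsub>C\<^esub> k = h))"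

definition splits :: "('o, 'm) cat \<Rightarrow> 'm \<Rightarrow> bool" where
  "splits C f \<longleftrightarrow>
     (\<exists>s \<in> hom C (Cod C f) (Dom C f). f \<cdot>\<^bsub>C\<^esub> s = Idn C (Cod C f))"

definition recognition_conditions_equivalent :: "('o, 'm) cat \<Rightarrow> 'o set \<Rightarrow> bool" where
  "recognition_conditions_equivalent C B \<longleftrightarrow>
     (\<forall>u U A. u \<in> hom C U A \<and> central_ext C B u \<longrightarrow>
        (let c1 = perfect C B U \<and> (\<forall>f. central_ext C B f \<and> Cod C f = U \<longrightarrow> splits C f);
             c2 = perfect C B U \<and> projective_wrt_central C B U;
             c3 = (\<forall>f X Y. f \<in> hom C X Y \<and> central_ext C B f \<longrightarrow>
                     bij_betw (\<lambda>h. f \<cdot>\<^bsub>C\<^esub> h) (hom C U X) (hom C U Y));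
             c4 = perfect C B U \<and> weakly_universal_central_ext C B A u;
             c5 = universal_central_ext C B A u
         in (c1 \<longleftrightarrow> c2) \<and> (c2 \<longleftrightarrow> c3) \<and> (c3 \<longleftrightarrow> c4) \<and> (c4 \<longleftrightarrow> c5)))"


section \<open>Internal abelian groups and condition (UCE)\<close>

definition pairing :: "('o, 'm) cat \<Rightarrow> 'm \<Rightarrow> 'm \<Rightarrow> 'm \<Rightarrow> 'm \<Rightarrow> 'm" where
  "pairing C p q x y =
     (THE h. h \<in> hom C (Dom C x) (Dom C p) \<and> p \<cdot>\<^bsub>C\<^esub> h = x \<and> q \<cdot>\<^bsub>C\<^esub> h = y)"

text \<open>An internal abelian group on \<open>X\<close>: multiplication \<open>m : X \<times> X \<rightarrow> X\<close>, neutral element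
  \<open>e : 1 \<rightarrow> X\<close> and inversion \<open>i : X \<rightarrow> X\<close>, where \<open>(P, p, q)\<close> is the product \<open>X \<times> X\<close> and \<open>Z\<close> is
  terminal. The clauses are commutativity, associativity on \<open>(X \<times> X) \<times> X\<close>, right unit and right
  inverse; the left-hand laws follow by commutativity.\<close>

definition internal_abelian_group ::
  "('o, 'm) cat \<Rightarrow> 'o \<Rightarrow> 'o \<Rightarrow> 'm \<Rightarrow> 'm \<Rightarrow> 'o \<Rightarrow> 'm \<Rightarrow> 'm \<Rightarrow> 'm \<Rightarrow> bool" where
  "internal_abelian_group C X P p q Z m e i \<longleftrightarrow>
     is_product C X X P p q \<and> is_terminal C Z \<and>
     m \<in> hom C P X \<and> e \<in> hom C Z X \<and> i \<in> hom C X X \<and>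
     m \<cdot>\<^bsub>C\<^esub> pairing C p q q p = m \<and>
     (\<forall>Q a z. is_product C P X Q a z \<longrightarrow>
        m \<cdot>\<^bsub>C\<^esub> pairing C p q (m \<cdot>\<^bsub>C\<^esub> a) z =
        m \<cdot>\<^bsub>C\<^esub> pairing C p q (p \<cdot>\<^bsub>C\<^esub> a)
                              (m \<cdot>\<^bsub>C\<^esub> pairing C p q (q \<cdot>\<^bsub>C\<^esub> a) z)) \<and>
     (\<forall>t \<in> hom C X Z.
        m \<cdot>\<^bsub>C\<^esub> pairing C p q (Idn C X) (e \<cdot>\<^bsub>C\<^esub> t) = Idn C X \<and>
        m \<cdot>\<^bsub>C\<^esub> pairing C p q (Idn C X) i = e \<cdot>\<^bsub>C\<^esub> t)"

definition Ab :: "('o, 'm) cat \<Rightarrow> 'o set" where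
  "Ab C = {X \<in> Obj C. \<exists>P p q Z m e i. internal_abelian_group C X P p q Z m e i}"

definition UCE :: "('o, 'm) cat \<Rightarrow> bool" where
  "UCE C \<longleftrightarrow>
     (\<forall>X A Y f g. perfect C (Ab C) X \<and> f \<in> hom C X A \<and> g \<in> hom C Y X \<and>
        central_ext C (Ab C) f \<and> central_ext C (Ab C) g \<longrightarrow>
        central_ext C (Ab C) (f \<cdot>\<^bsub>C\<^esub> g))"

end

theory Submission
  imports Defs
begin

text \<open>
Why the result holds. Write \<open>\<eta>\<close> for the unit of the reflection onto \<open>B\<close>. The object \<open>A\<close> is a regular
quotient of the perfect object \<open>X\<close>, so it is perfect, and a perfect object in a semi-abelian category with
enough projectives admits a weakly universal central extension \<open>u : U \<rightarrow> A\<close> with \<open>U\<close> perfect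
(\<open>weakly_universal_exists\<close>). The hypothesis on the five conditions upgrades this: \<open>U\<close> is projective with
respect to all central extensions, not only those of \<open>A\<close>. Hence \<open>u\<close> lifts along \<open>f\<close> to \<open>b : U \<rightarrow> X\<close>,
and \<open>b\<close> lifts along \<open>g\<close>. As \<open>X\<close> and \<open>U\<close> are perfect, \<open>b\<close> is a regular epimorphism
(\<open>comparison_cover\<close>). The pullback \<open>T \<rightarrow> U\<close> of \<open>g\<close> along \<open>b\<close> is a split central extension, hence trivial,
and \<open>T \<rightarrow> Y\<close> is a regular epimorphism that identifies \<open>f \<cdot> g\<close> restricted to \<open>T\<close> with the composite
\<open>T \<rightarrow> U \<rightarrow> A\<close> of a trivial extension and \<open>u\<close>. Pulled back along \<open>u\<close>, the latter is a composite of two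
trivial extensions, and this property descends to the pullback of \<open>f \<cdot> g\<close> along \<open>u\<close>; therefore
\<open>f \<cdot> g\<close> is central (\<open>central_composite\<close>).

The proofs reason with generalised elements: an element of \<open>X\<close> at stage \<open>T\<close> is an arrow \<open>T \<rightarrow> X\<close>. Elements lift
along a regular epimorphism after a change of stage along another regular epimorphism, here called a cover,
and equations between elements, or membership in a subobject, may be checked after such a change.
The short five lemma enters through a single consequence, the Maltsev property that spans are locally
difunctional (\<open>difunctional\<close>): from elements \<open>a\<close>, \<open>b\<close>, \<open>c\<close> that agree pairwise in the appropriate
coordinates one obtains a fourth element, which plays the role of \<open>a - b + c\<close>. Barr exactness enters through
\<open>quotient_by_image_relation\<close>: the image of a kernel pair along a regular epimorphism is again a kernel pair.
From these two facts one gets the elementwise form of the theory of Birkhoff subcategories: a pair of elements of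
\<open>Y\<close> identified by \<open>\<eta> Y\<close> lifts along any regular epimorphism \<open>X \<rightarrow> Y\<close> to a pair identified by \<open>\<eta> X\<close>
(\<open>lift_unit_congruence\<close>); an extension \<open>q\<close> is trivial precisely when \<open>q\<close> and \<open>\<eta>\<close> are jointly monic
(\<open>trivial_separated\<close>, \<open>separated_trivial\<close>); and a split central extension is trivial
(\<open>split_central_separated\<close>).

The weakly universal extension is constructed from a cover \<open>p : P \<rightarrow> A\<close> by a projective object. The quotient \<open>W\<close> of \<open>P\<close> by
the relative commutator of \<open>P\<close> and the kernel of \<open>p\<close> is central over \<open>A\<close>, and projectivity makes it weakly
initial. The kernel \<open>F\<close> of \<open>\<eta> W\<close> still covers \<open>A\<close>, because \<open>A\<close> is perfect, and it is itself perfect.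

For condition (UCE) it remains to see that the abelian objects form a Birkhoff subcategory (\<open>Ab_birkhoff\<close>). An
object is abelian as soon as it carries a multiplication for which zero is neutral on both sides, since two maps
out of a product agree once they agree on the two axes (\<open>axes_epic\<close>). In this form closure
under subobjects and quotients is direct, and the reflection of \<open>X\<close> is the pushout of \<open>X + X \<rightarrow> X \<times> X\<close> along
the codiagonal \<open>X + X \<rightarrow> X\<close>.
\<close>

section \<open>Covers and images in regular categories\<close>

context category
begin

lemma hom_iff [simp]: "f \<in> hom C X Y \<longleftrightarrow> f \<in> Arr C \<and> Dom C f = X \<and> Cod C f = Y"
  by (auto simp: hom_def)

lemma dom_cod_obj [simp]: "f \<in> Arr C \<Longrightarrow> Dom C f \<in> Obj C" "f \<in> Arr C \<Longrightarrow> Cod C f \<in> Obj C"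
  by (simp_all add: dom_obj cod_obj)

lemma comp_typing [simp]:
  assumes "f \<in> Arr C" "g \<in> Arr C" "Dom C g = Cod C f"
  shows "g \<cdot> f \<in> Arr C" "Dom C (g \<cdot> f) = Dom C f" "Cod C (g \<cdot> f) = Cod C g"
  using comp_hom[of f "Dom C f" "Cod C f" g "Cod C g"] assms by simp_all

lemma comp_assoc' [simp]:
  assumes "f \<in> Arr C" "g \<in> Arr C" "h \<in> Arr C" "Dom C g = Cod C f" "Dom C h = Cod C g"
  shows "(h \<cdot> g) \<cdot> f = h \<cdot> (g \<cdot> f)"
  using comp_assoc[of f "Dom C f" "Cod C f" g "Cod C g" h "Cod C h"] assms by simp

lemma idn_typing [simp]:
  assumes "X \<in> Obj C"
  shows "Idn C X \<in> Arr C" "Dom C (Idn C X) = X" "Cod C (Idn C X) = X"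
  using idn_hom[OF assms] by simp_all

lemma idn_laws [simp]:
  "f \<in> Arr C \<Longrightarrow> Dom C f = X \<Longrightarrow> f \<cdot> Idn C X = f"
  "f \<in> Arr C \<Longrightarrow> Cod C f = X \<Longrightarrow> Idn C X \<cdot> f = f"
  using comp_idn[of f X "Cod C f"] idn_comp[of f "Dom C f" X] by simp_all

lemma hom_objs: "f \<in> hom C X Y \<Longrightarrow> X \<in> Obj C \<and> Y \<in> Obj C"
  by auto

text \<open>Rewriting with associativity moves all brackets to the right, where an equation between composites no
  longer matches; this lemma and the next one apply such an equation to a further factor.\<close>

lemma square_comp:
  assumes "g \<cdot> f = k \<cdot> h" "f \<in> Arr C" "g \<in> Arr C" "Dom C g = Cod C f"
    "h \<in> Arr C" "k \<in> Arr C" "Dom C k = Cod C h"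
    "t \<in> Arr C" "Cod C t = Dom C f" "Cod C t = Dom C h"
  shows "g \<cdot> (f \<cdot> t) = k \<cdot> (h \<cdot> t)"
  using assms comp_assoc'[of t f g] comp_assoc'[of t h k] by simp

lemma triangle_comp:
  assumes "g \<cdot> f = h" "f \<in> Arr C" "g \<in> Arr C" "Dom C g = Cod C f" 
    "t \<in> Arr C" "Cod C t = Dom C f" 
  shows "g \<cdot> (f \<cdot> t) = h \<cdot> t"
  using assms comp_assoc'[of t f g] by simp

abbreviation cover :: "'m \<Rightarrow> 'o \<Rightarrow> 'o \<Rightarrow> bool" where
  "cover t T X \<equiv> t \<in> hom C T X \<and> regular_epi C t"

lemma regular_epi_arr: "regular_epi C f \<Longrightarrow> f \<in> Arr C"
  by (auto simp: regular_epi_def is_coequaliser_def)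

lemma coverE:
  assumes "cover t T X"
  obtains S r s where "r \<in> hom C S T" "s \<in> hom C S T" "t \<cdot> r = t \<cdot> s"
    "\<And>Y x. x \<in> hom C T Y \<Longrightarrow> x \<cdot> r = x \<cdot> s \<Longrightarrow> \<exists>k. k \<in> hom C X Y \<and> k \<cdot> t = x"
    "\<And>Y h k. h \<in> hom C X Y \<Longrightarrow> k \<in> hom C X Y \<Longrightarrow> h \<cdot> t = k \<cdot> t \<Longrightarrow> h = k"
proof -
  obtain r s where rs: "is_coequaliser C r s t"
    using assms by (auto simp: regular_epi_def)
  have t: "Dom C t = T" "Cod C t = X" "t \<in> Arr C" using assms by auto
  have R: "r \<in> hom C (Dom C r) T" "s \<in> hom C (Dom C r) T" "t \<cdot> r = t \<cdot> s"
    using rs t by (auto simp: is_coequaliser_def)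
  have U: "\<exists>!h. h \<in> hom C X Y \<and> h \<cdot> t = x" if "x \<in> hom C T Y" "x \<cdot> r = x \<cdot> s" for Y x
    using rs that unfolding is_coequaliser_def t by blast
  show thesis
  proof (rule that[OF R])
    fix Y h k assume h: "h \<in> hom C X Y" and k: "k \<in> hom C X Y" and hk: "h \<cdot> t = k \<cdot> t"
    have "(h \<cdot> t) \<cdot> r = (h \<cdot> t) \<cdot> s" using h R t by simp
    then have "\<exists>!l. l \<in> hom C X Y \<and> l \<cdot> t = h \<cdot> t" using U[of "h \<cdot> t" Y] h t by simp
    then show "h = k" using h k hk by metis
  qed (use U in blast)
qed

lemma coverI:
  assumes t: "t \<in> hom C T X" and r: "r \<in> hom C S T" and s: "s \<in> hom C S T" and "t \<cdot> r = t \<cdot> s"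
    and U: "\<And>Y x. x \<in> hom C T Y \<Longrightarrow> x \<cdot> r = x \<cdot> s \<Longrightarrow> \<exists>k. k \<in> hom C X Y \<and> k \<cdot> t = x"
    and E: "\<And>Y h k. h \<in> hom C X Y \<Longrightarrow> k \<in> hom C X Y \<Longrightarrow> h \<cdot> t = k \<cdot> t \<Longrightarrow> h = k"
  shows "cover t T X"
proof -
  have t': "Dom C t = T" "Cod C t = X" "t \<in> Arr C" using t by auto
  have "is_coequaliser C r s t"
    unfolding is_coequaliser_def t'
  proof (intro conjI allI ballI impI)
    fix Y x assume "x \<in> hom C T Y" "x \<cdot> r = x \<cdot> s"
    then show "\<exists>!h. h \<in> hom C X Y \<and> h \<cdot> t = x" using U E by metis
  qed (use assms(1-4) in simp_all)
  then show ?thesis using t by (auto simp: regular_epi_def)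
qed

lemma cover_epi:
  assumes "cover t T X" "x \<in> hom C X Y" "y \<in> hom C X Y" "x \<cdot> t = y \<cdot> t"
  shows "x = y"
proof -
  obtain S r s where "\<And>Y h k. h \<in> hom C X Y \<Longrightarrow> k \<in> hom C X Y \<Longrightarrow> h \<cdot> t = k \<cdot> t \<Longrightarrow> h = k"
    by (rule coverE[OF assms(1)], rule that)
  then show ?thesis using assms(2-4) by blast
qed

text \<open>The pair presenting \<open>t\<close> as a coequaliser is not at hand in applications. Agreement on all pairs
  identified by \<open>t\<close> includes agreement on that pair, so the universal property can be used without naming it.\<close>

lemma cover_factor:
  assumes t: "cover t T X" and x: "x \<in> hom C T Y"
    and eq: "\<And>S a b. a \<in> hom C S T \<Longrightarrow> b \<in> hom C S T \<Longrightarrow> t \<cdot> a = t \<cdot> b \<Longrightarrow> x \<cdot> a = x \<cdot> b"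
  obtains k where "k \<in> hom C X Y" "k \<cdot> t = x"
proof -
  obtain S r s where R: "r \<in> hom C S T" "s \<in> hom C S T" "t \<cdot> r = t \<cdot> s"
    and U: "\<And>Y x. x \<in> hom C T Y \<Longrightarrow> x \<cdot> r = x \<cdot> s \<Longrightarrow> \<exists>k. k \<in> hom C X Y \<and> k \<cdot> t = x"
    by (rule coverE[OF t], rule that)
  show ?thesis using U[OF x eq[OF R]] that by blast
qed

lemma split_epi_cover:
  assumes "f \<in> hom C X Y" "s \<in> hom C Y X" "f \<cdot> s = Idn C Y"
  shows "cover f X Y"
proof -
  have o: "X \<in> Obj C" "Y \<in> Obj C" using assms(1) by auto
  have i: "s \<cdot> f \<in> hom C X X" "Idn C X \<in> hom C X X" using assms(1,2) o by simp_all
  show ?thesis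
  proof (rule coverI[OF assms(1) i])
    show "f \<cdot> (s \<cdot> f) = f \<cdot> Idn C X" using assms o triangle_comp[OF assms(3), of f] by simp
  next
    fix T x assume x: "x \<in> hom C X T" "x \<cdot> (s \<cdot> f) = x \<cdot> Idn C X"
    then show "\<exists>k. k \<in> hom C Y T \<and> k \<cdot> f = x"
      using assms(1,2) by (intro exI[of _ "x \<cdot> s"]) simp
  next
    fix T h k assume hk: "h \<in> hom C Y T" "k \<in> hom C Y T" "h \<cdot> f = k \<cdot> f"
    have "h \<cdot> (f \<cdot> s) = k \<cdot> (f \<cdot> s)" using square_comp[OF hk(3), of s] hk assms(1,2) by simp
    then show "h = k" using hk assms(3) by simp
  qed
qed

text \<open>A coequaliser followed by an isomorphism coequalises the same pair. Together with the image
  factorisation this shows that covers are exactly the maps whose image is the whole codomain.\<close>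

lemma cover_then_iso_cover:
  assumes "cover e X I" "m \<in> hom C I Y" "n \<in> hom C Y I" "m \<cdot> n = Idn C Y" "n \<cdot> m = Idn C I"
  shows "cover (m \<cdot> e) X Y"
proof -
  obtain S r s where R: "r \<in> hom C S X" "s \<in> hom C S X" "e \<cdot> r = e \<cdot> s"
    and U: "\<And>T x. x \<in> hom C X T \<Longrightarrow> x \<cdot> r = x \<cdot> s \<Longrightarrow> \<exists>k. k \<in> hom C I T \<and> k \<cdot> e = x"
    by (rule coverE[OF assms(1)], rule that)
  have me: "m \<cdot> e \<in> hom C X Y" using assms(1,2) by simp
  have "cover (m \<cdot> e) X Y"
  proof (rule coverI[OF me R(1,2)])
    show "(m \<cdot> e) \<cdot> r = (m \<cdot> e) \<cdot> s" using R assms(1,2) by simp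
  next
    fix T x assume x: "x \<in> hom C X T" "x \<cdot> r = x \<cdot> s"
    obtain h where h: "h \<in> hom C I T" "h \<cdot> e = x" using U[OF x] by blast
    have "(h \<cdot> n) \<cdot> (m \<cdot> e) = h \<cdot> ((n \<cdot> m) \<cdot> e)" using h assms(1-3) by simp
    also have "\<dots> = x" using h assms(1) assms(5) by simp
    finally show "\<exists>k. k \<in> hom C Y T \<and> k \<cdot> (m \<cdot> e) = x"
      using h assms(2,3) by (intro exI[of _ "h \<cdot> n"]) simp
  next
    fix T h k assume hk: "h \<in> hom C Y T" "k \<in> hom C Y T" "h \<cdot> (m \<cdot> e) = k \<cdot> (m \<cdot> e)"
    have "h \<cdot> m = k \<cdot> m"
      using cover_epi[OF assms(1), of "h \<cdot> m" T "k \<cdot> m"] hk assms(1,2) by simp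
    then have "h \<cdot> (m \<cdot> n) = k \<cdot> (m \<cdot> n)"
      using square_comp[of h m k m n] hk assms(2,3) by simp
    then show "h = k" using hk assms(4) by simp
  qed
  then show ?thesis .
qed

lemma mono_cancel:
  assumes "monic C m" "m \<in> hom C X Y" "x \<in> hom C T X" "y \<in> hom C T X" "m \<cdot> x = m \<cdot> y"
  shows "x = y"
proof -
  have "Dom C m = X" using assms(2) by simp
  then show ?thesis using assms(1,3-5) unfolding monic_def by blast
qed

lemma pullback_facts:
  assumes "is_pullback C f g p q" "f \<in> hom C X Z"
  shows "Dom C q = Dom C p" "p \<in> hom C (Dom C p) X" "q \<in> hom C (Dom C p) (Dom C g)" "g \<in> hom C (Dom C g) Z"
    "f \<cdot> p = g \<cdot> q" 
  using assms unfolding is_pullback_def by auto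

lemma pullback_lift:
  assumes "is_pullback C f g p q" "f \<in> hom C X Z" "g \<in> hom C Y Z"
    "x \<in> hom C T X" "y \<in> hom C T Y" "f \<cdot> x = g \<cdot> y"
  obtains h where "h \<in> hom C T (Dom C p)" "p \<cdot> h = x" "q \<cdot> h = y"
proof -
  have "f \<in> Arr C" "Dom C f = X" "Dom C g = Y" using assms(2,3) by auto
  then have "\<exists>!h. h \<in> hom C T (Dom C p) \<and> p \<cdot> h = x \<and> q \<cdot> h = y"
    using assms(1,4-6) unfolding is_pullback_def by blast
  then show ?thesis using that by blast
qed

lemma pullback_mono:
  assumes "is_pullback C f g p q" 
    "h \<in> hom C T (Dom C p)" "k \<in> hom C T (Dom C p)" "p \<cdot> h = p \<cdot> k" "q \<cdot> h = q \<cdot> k"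
  shows "h = k"
proof -
  have P: "f \<in> Arr C" "g \<in> Arr C" "p \<in> Arr C" "q \<in> Arr C"
     "Cod C f = Cod C g" "Cod C p = Dom C f" "Cod C q = Dom C g" "Dom C p = Dom C q"
     "f \<cdot> p = g \<cdot> q"
    using assms(1) unfolding is_pullback_def by auto
  have "p \<cdot> h \<in> hom C T (Dom C f)" "q \<cdot> h \<in> hom C T (Dom C g)" "f \<cdot> (p \<cdot> h) = g \<cdot> (q \<cdot> h)"
    using P assms square_comp[of f p g q h] by auto
  then have "\<exists>!l. l \<in> hom C T (Dom C p) \<and> p \<cdot> l = p \<cdot> h \<and> q \<cdot> l = q \<cdot> h"
    using assms(1) unfolding is_pullback_def by blast
  then show ?thesis using assms(2-5) by metis
qed

end

locale regular_cat = category C for C :: "('o, 'm) cat" (structure) +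
  assumes reg: "regular_category C"
begin

lemma pullback_exists:
  assumes "f \<in> hom C X Z" "g \<in> hom C Y Z"
  obtains P p q where "is_pullback C f g p q" "p \<in> hom C P X" "q \<in> hom C P Y" "f \<cdot> p = g \<cdot> q"
proof -
  have "f \<in> Arr C" "g \<in> Arr C" "Cod C f = Cod C g" using assms by auto
  then obtain p q where pq: "is_pullback C f g p q"
    using reg unfolding regular_category_def finitely_complete_def by blast
  then show ?thesis using that[of p q "Dom C p"] assms unfolding is_pullback_def by auto
qed

lemma pullback_cover:
  assumes "is_pullback C f g p q" "regular_epi C f"
  shows "regular_epi C q"
  using reg assms unfolding regular_category_def by blast

lemma pullback_swap:
  assumes "is_pullback C f g p q"
  shows "is_pullback C g f q p"
proof -
  note P = assms[unfolded is_pullback_def]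
  have U: "\<exists>!h. h \<in> hom C T (Dom C q) \<and> q \<cdot> h = x \<and> p \<cdot> h = y"
    if "x \<in> hom C T (Dom C g)" "y \<in> hom C T (Dom C f)" "g \<cdot> x = f \<cdot> y" for T x y
  proof -
    have "\<exists>!h. h \<in> hom C T (Dom C p) \<and> p \<cdot> h = y \<and> q \<cdot> h = x"
      using P that(1,2) that(3)[symmetric] by blast
    moreover have "Dom C q = Dom C p" using P by argo
    ultimately show ?thesis by (simp only: conj_commute)
  qed
  show ?thesis
    unfolding is_pullback_def
    by (intro conjI allI ballI impI U) (use P in argo)+
qed

text \<open>The regular axiom in terms of elements: the stage change \<open>t\<close> is the pullback of \<open>f\<close> along \<open>y\<close>.\<close>

lemma local_lift:
  assumes "cover f X Y" "y \<in> hom C T Y"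
  obtains S t x where "cover t S T" "x \<in> hom C S X" "f \<cdot> x = y \<cdot> t"
proof -
  obtain P p q where P: "is_pullback C f y p q" "p \<in> hom C P X" "q \<in> hom C P T" "f \<cdot> p = y \<cdot> q"
    using pullback_exists[of f X Y y T] assms by blast
  show ?thesis using that[of q P p] P pullback_cover[OF P(1)] assms by blast
qed

text \<open>The image is the coequaliser \<open>e\<close> of the kernel pair of \<open>f\<close>. The induced map \<open>m\<close> is monic because two elements
  of the image with equal values lift locally to elements of \<open>X\<close> on which \<open>f\<close> agrees, that is, to
  an element of the kernel pair, which \<open>e\<close> coequalises.\<close>

lemma image_exists:
  assumes "f \<in> hom C X Y"
  obtains I e m where "cover e X I" "m \<in> hom C I Y" "monic C m" "m \<cdot> e = f"
proof -
  obtain K r s where K: "is_pullback C f f r s" "r \<in> hom C K X" "s \<in> hom C K X" "f \<cdot> r = f \<cdot> s"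
    using pullback_exists[of f X Y f X] assms by blast
  obtain e where e: "is_coequaliser C r s e"
    using reg K(1) unfolding regular_category_def is_kernel_pair_def by blast
  define I where "I = Cod C e"
  have eI: "cover e X I" "e \<cdot> r = e \<cdot> s"
    using e K I_def by (auto simp: is_coequaliser_def regular_epi_def)
  have "\<exists>!h. h \<in> hom C I Y \<and> h \<cdot> e = f"
    using e K assms unfolding is_coequaliser_def I_def by auto
  then obtain m where m: "m \<in> hom C I Y" "m \<cdot> e = f" by blast
  have "monic C m"
    unfolding monic_def
  proof (intro conjI allI ballI impI)
    fix T a b assume a: "a \<in> hom C T (Dom C m)" and b: "b \<in> hom C T (Dom C m)"
      and ab: "m \<cdot> a = m \<cdot> b"
    have a': "a \<in> hom C T I" and b': "b \<in> hom C T I" using a b m by auto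
    obtain S t x where t: "cover t S T" "x \<in> hom C S X" "e \<cdot> x = a \<cdot> t"
      by (rule local_lift[OF eI(1) a'], rule that)
    have bt: "b \<cdot> t \<in> hom C S I" using b' t by simp
    obtain S' t' y where t': "cover t' S' S" "y \<in> hom C S' X" "e \<cdot> y = (b \<cdot> t) \<cdot> t'"
      by (rule local_lift[OF eI(1) bt], rule that)
    have 1: "e \<cdot> (x \<cdot> t') = a \<cdot> (t \<cdot> t')" using t t' a' eI square_comp[OF t(3), of t'] by simp
    have "f \<cdot> (x \<cdot> t') = m \<cdot> (e \<cdot> (x \<cdot> t'))" using t t' m eI comp_assoc'[of "x \<cdot> t'" e m] by simp
    also have "\<dots> = m \<cdot> (a \<cdot> (t \<cdot> t'))" using 1 by simp
    also have "\<dots> = m \<cdot> (b \<cdot> (t \<cdot> t'))" using square_comp[OF ab, of "t \<cdot> t'"] m a' b' t t' by simp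
    also have "\<dots> = m \<cdot> (e \<cdot> y)" using t' t b' by simp
    also have "\<dots> = f \<cdot> y" using m t' eI comp_assoc'[of y e m] by simp
    finally obtain h where h: "h \<in> hom C S' K" "r \<cdot> h = x \<cdot> t'" "s \<cdot> h = y"
      using pullback_lift[OF K(1) assms assms, of "x \<cdot> t'" S' y] t t' K by auto
    have "e \<cdot> (x \<cdot> t') = e \<cdot> y" 
      using square_comp[OF eI(2), of h] h K eI by simp
    then have "(a \<cdot> t) \<cdot> t' = (b \<cdot> t) \<cdot> t'" using 1 t' t a' b' by simp
    then have "a \<cdot> t = b \<cdot> t" using cover_epi[OF t'(1), of "a \<cdot> t" I "b \<cdot> t"] t a' b' by simp
    then show "a = b" using cover_epi[OF t(1) a' b'] by simp
  qed (use m in auto)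
  then show ?thesis using that eI m by blast
qed

text \<open>Membership in a subobject is a local property: a local witness is unique because \<open>m\<close> is monic, so it is
  compatible with the kernel pair of the cover and descends.\<close>

lemma cover_descent:
  assumes t: "cover t S T" and m: "monic C m" "m \<in> hom C I Y" and y: "y \<in> hom C T Y"
    and z: "z \<in> hom C S I" "m \<cdot> z = y \<cdot> t"
  obtains w where "w \<in> hom C T I" "m \<cdot> w = y"
proof -
  have za: "z \<cdot> a = z \<cdot> b" if "a \<in> hom C R S" "b \<in> hom C R S" "t \<cdot> a = t \<cdot> b" for R a b
  proof (rule mono_cancel[OF m])
    show "m \<cdot> z \<cdot> a = m \<cdot> z \<cdot> b"
      using square_comp[OF z(2), of a] square_comp[OF z(2), of b] that m z y t by simp
  qed (use that z in auto)
  obtain k where k: "k \<in> hom C T I" "k \<cdot> t = z"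
    by (rule cover_factor[OF t z(1)]) (use za that in \<open>blast+\<close>)
  have "m \<cdot> k = y"
    using cover_epi[OF t, of "m \<cdot> k" Y y] k m y z t by auto
  then show ?thesis using that k by blast
qed

lemma mono_cover_inverse:
  assumes "monic C m" "cover m X Y"
  obtains n where "n \<in> hom C Y X" "m \<cdot> n = Idn C Y" "n \<cdot> m = Idn C X"
proof -
  have o: "X \<in> Obj C" "Y \<in> Obj C" using assms by auto
  obtain n where n: "n \<in> hom C Y X" "m \<cdot> n = Idn C Y"
    using cover_descent[of m X Y m X Y "Idn C Y" "Idn C X"] assms o by auto
  have "n \<cdot> m = Idn C X"
    using mono_cancel[OF assms(1), of X Y "n \<cdot> m" X "Idn C X"] n assms o triangle_comp[OF n(2), of m] by simp
  then show ?thesis using that n by blast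
qed

text \<open>To recognise a cover it is enough to solve \<open>f \<cdot> x = t\<close> for one cover \<open>t\<close>: then the generic element of the
  codomain lies locally in the image of \<open>f\<close>, hence globally, so the monic part of \<open>f\<close> is invertible.\<close>

lemma cover_cancel:
  assumes "cover (f \<cdot> x) T Y" "f \<in> hom C X Y" "x \<in> hom C T X"
  shows "cover f X Y"
proof -
  obtain I e m where I: "cover e X I" "m \<in> hom C I Y" "monic C m" "m \<cdot> e = f"
    by (rule image_exists[OF assms(2)], rule that)
  have o: "Y \<in> Obj C" "I \<in> Obj C" using I by auto
  obtain n where n: "n \<in> hom C Y I" "m \<cdot> n = Idn C Y"
    using cover_descent[OF assms(1) I(3,2), of "Idn C Y" "e \<cdot> x"] I assms o comp_assoc'[of x e m]
    by (metis comp_typing idn_laws(2) idn_typing hom_iff)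
  have "n \<cdot> m = Idn C I"
    using mono_cancel[OF I(3,2), of "n \<cdot> m" I "Idn C I"] n I o triangle_comp[OF n(2), of m] by simp
  then show ?thesis using cover_then_iso_cover[OF I(1,2) n(1)] n I by simp
qed

lemma cover_comp:
  assumes f: "cover f X Y" and g: "cover g Y Z"
  shows "cover (g \<cdot> f) X Z"
proof -
  have gf: "g \<cdot> f \<in> hom C X Z" using assms by simp
  obtain I e m where I: "cover e X I" "m \<in> hom C I Z" "monic C m" "m \<cdot> e = g \<cdot> f"
    by (rule image_exists[OF gf], rule that)
  have o: "Z \<in> Obj C" "I \<in> Obj C" using I by auto
  obtain d where d: "d \<in> hom C Y I" "m \<cdot> d = g"
    using cover_descent[OF f I(3,2), of g e] I g by auto
  have mc: "cover m I Z" using cover_cancel[of m d Y Z I] d g I by auto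
  obtain n where "n \<in> hom C Z I" "m \<cdot> n = Idn C Z" "n \<cdot> m = Idn C I"
    by (rule mono_cover_inverse[OF I(3) mc], rule that)
  then show ?thesis using cover_then_iso_cover[OF I(1,2)] I by auto
qed

lemma terminal_exists: obtains Z where "is_terminal C Z"
  using reg unfolding regular_category_def finitely_complete_def by blast

lemma product_exists:
  assumes "X \<in> Obj C" "Y \<in> Obj C"
  obtains P p q where "is_product C X Y P p q"
proof -
  obtain Z where Z: "is_terminal C Z" by (rule terminal_exists)
  obtain x y where xy: "x \<in> hom C X Z" "y \<in> hom C Y Z"
    using Z assms unfolding is_terminal_def by blast
  obtain P p q where P: "is_pullback C x y p q" "p \<in> hom C P X" "q \<in> hom C P Y"
    by (rule pullback_exists[OF xy], rule that)
  have "is_product C X Y P p q"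
    unfolding is_product_def
  proof (intro conjI allI ballI)
    fix T a b assume ab: "a \<in> hom C T X" "b \<in> hom C T Y"
    have "x \<cdot> a \<in> hom C T Z" "y \<cdot> b \<in> hom C T Z" "T \<in> Obj C" using ab xy by auto
    then have "x \<cdot> a = y \<cdot> b" using Z unfolding is_terminal_def by blast
    then obtain h where h: "h \<in> hom C T P" "p \<cdot> h = a" "q \<cdot> h = b"
      using pullback_lift[OF P(1) xy ab] P by auto
    show "\<exists>!h. h \<in> hom C T P \<and> p \<cdot> h = a \<and> q \<cdot> h = b"
    proof (rule ex1I[of _ h])
      fix k assume "k \<in> hom C T P \<and> p \<cdot> k = a \<and> q \<cdot> k = b"
      then show "k = h" using pullback_mono[OF P(1), of k T h] h P by simp
    qed (use h in auto)
  qed (use P in auto)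
  then show ?thesis using that by blast
qed

end

context category begin

lemma product_typing:
  assumes "is_product C X Y P p q"
  shows "p \<in> hom C P X" "q \<in> hom C P Y"
  using assms unfolding is_product_def by auto

lemma product_lift:
  assumes "is_product C X Y P p q" "x \<in> hom C T X" "y \<in> hom C T Y"
  obtains h where "h \<in> hom C T P" "p \<cdot> h = x" "q \<cdot> h = y"
  using assms unfolding is_product_def by blast

lemma product_mono:
  assumes "is_product C X Y P p q" "h \<in> hom C T P" "k \<in> hom C T P" "p \<cdot> h = p \<cdot> k" "q \<cdot> h = q \<cdot> k"
  shows "h = k"
proof -
  have "p \<cdot> h \<in> hom C T X" "q \<cdot> h \<in> hom C T Y"
    using assms(2) product_typing[OF assms(1)] by auto
  then have "\<exists>!l. l \<in> hom C T P \<and> p \<cdot> l = p \<cdot> h \<and> q \<cdot> l = q \<cdot> h"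
    using assms(1) unfolding is_product_def by blast
  then show ?thesis using assms(2-5) by metis
qed

end

section \<open>Zero maps and the Maltsev property\<close>

locale semi_abelian_cat = category C for C :: "('o, 'm) cat" (structure) +
  assumes sa: "semi_abelian C"
begin

sublocale regular_cat C
  by unfold_locales (use sa in \<open>simp add: semi_abelian_def barr_exact_def\<close>)

definition zero_obj :: 'o where "zero_obj = (SOME Z. is_zero C Z)"

lemma zero_obj: "is_zero C zero_obj"
  using sa unfolding zero_obj_def semi_abelian_def pointed_def by (metis someI_ex)

text \<open>Zero maps are composed from choices through one fixed zero object, which makes them a function of domain and
  codomain; \<open>zero_arr_iff\<close> shows that the choices do not matter.\<close>

definition zero_map :: "'o \<Rightarrow> 'o \<Rightarrow> 'm" where
  "zero_map X Y = (SOME h. h \<in> hom C zero_obj Y) \<cdot> (SOME g. g \<in> hom C X zero_obj)"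

lemma zero_obj_obj [simp]: "zero_obj \<in> Obj C"
  using zero_obj unfolding is_zero_def is_terminal_def by blast

lemma zero_obj_terminal: "g \<in> hom C X zero_obj \<Longrightarrow> h \<in> hom C X zero_obj \<Longrightarrow> g = h"
  using zero_obj hom_objs[of g X zero_obj] unfolding is_zero_def is_terminal_def by blast

lemma zero_obj_initial: "g \<in> hom C zero_obj X \<Longrightarrow> h \<in> hom C zero_obj X \<Longrightarrow> g = h"
  using zero_obj hom_objs[of g zero_obj X] unfolding is_zero_def is_initial_def by blast

lemma zero_map_factors:
  assumes "X \<in> Obj C" "Y \<in> Obj C"
  obtains g h where "g \<in> hom C X zero_obj" "h \<in> hom C zero_obj Y" "zero_map X Y = h \<cdot> g"
proof -
  have "\<exists>g. g \<in> hom C X zero_obj" "\<exists>h. h \<in> hom C zero_obj Y"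
    using zero_obj assms unfolding is_zero_def is_terminal_def is_initial_def by blast+
  then have "(SOME g. g \<in> hom C X zero_obj) \<in> hom C X zero_obj" "(SOME h. h \<in> hom C zero_obj Y) \<in> hom C zero_obj Y"
    by (metis someI_ex)+
  then show ?thesis using that unfolding zero_map_def by blast
qed

lemma zero_map_typing [simp]:
  assumes "X \<in> Obj C" "Y \<in> Obj C"
  shows "zero_map X Y \<in> Arr C" "Dom C (zero_map X Y) = X" "Cod C (zero_map X Y) = Y"
proof -
  obtain g h where "g \<in> hom C X zero_obj" "h \<in> hom C zero_obj Y" "zero_map X Y = h \<cdot> g"
    by (rule zero_map_factors[OF assms], rule that)
  then show "zero_map X Y \<in> Arr C" "Dom C (zero_map X Y) = X" "Cod C (zero_map X Y) = Y" by simp_all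
qed

lemma zero_map_left [simp]:
  assumes "f \<in> Arr C" "Dom C f = Y" "X \<in> Obj C"
  shows "f \<cdot> zero_map X Y = zero_map X (Cod C f)"
proof -
  have Y: "Y \<in> Obj C" "Cod C f \<in> Obj C" using assms by auto
  obtain g h where gh: "g \<in> hom C X zero_obj" "h \<in> hom C zero_obj Y" "zero_map X Y = h \<cdot> g"
    by (rule zero_map_factors[OF assms(3) Y(1)], rule that)
  obtain g' h' where gh': "g' \<in> hom C X zero_obj" "h' \<in> hom C zero_obj (Cod C f)" "zero_map X (Cod C f) = h' \<cdot> g'"
    by (rule zero_map_factors[OF assms(3) Y(2)], rule that)
  have "g' = g" using zero_obj_terminal[of g' X g] gh gh' by blast
  moreover have "h' = f \<cdot> h" using zero_obj_initial[of h' "Cod C f" "f \<cdot> h"] gh gh' assms by simp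
  ultimately show ?thesis using gh gh' assms by simp
qed

lemma zero_map_right [simp]:
  assumes "f \<in> Arr C" "Cod C f = X" "Y \<in> Obj C"
  shows "zero_map X Y \<cdot> f = zero_map (Dom C f) Y"
proof -
  have X: "X \<in> Obj C" "Dom C f \<in> Obj C" using assms by auto
  obtain g h where gh: "g \<in> hom C X zero_obj" "h \<in> hom C zero_obj Y" "zero_map X Y = h \<cdot> g"
    by (rule zero_map_factors[OF X(1) assms(3)], rule that)
  obtain g' h' where gh': "g' \<in> hom C (Dom C f) zero_obj" "h' \<in> hom C zero_obj Y" "zero_map (Dom C f) Y = h' \<cdot> g'"
    by (rule zero_map_factors[OF X(2) assms(3)], rule that)
  have "g' = g \<cdot> f" using zero_obj_terminal[of g' "Dom C f" "g \<cdot> f"] gh gh' assms by simp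
  moreover have "h' = h" using zero_obj_initial[of h' Y h] gh gh' assms by blast
  ultimately show ?thesis using gh gh' assms by simp
qed

lemma zero_object_idn:
  assumes "is_zero C Z"
  shows "Idn C Z = zero_map Z Z"
proof -
  have Z: "Z \<in> Obj C" using assms unfolding is_zero_def is_terminal_def by blast
  then have "\<exists>!f. f \<in> hom C Z Z" using assms unfolding is_zero_def is_terminal_def by blast
  moreover have "Idn C Z \<in> hom C Z Z" "zero_map Z Z \<in> hom C Z Z" using Z by simp_all
  ultimately show ?thesis by blast
qed

lemma is_zero_iff:
  assumes "Z \<in> Obj C"
  shows "is_zero C Z \<longleftrightarrow> Idn C Z = zero_map Z Z"
proof
  assume i: "Idn C Z = zero_map Z Z"
  have "\<exists>!f. f \<in> hom C X Z" if X: "X \<in> Obj C" for X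
  proof (rule ex1I[of _ "zero_map X Z"])
    fix f assume f: "f \<in> hom C X Z"
    then have "f = Idn C Z \<cdot> f" by simp
    then show "f = zero_map X Z" using i f assms by simp
  qed (use X assms in simp)
  moreover have "\<exists>!f. f \<in> hom C Z X" if X: "X \<in> Obj C" for X
  proof (rule ex1I[of _ "zero_map Z X"])
    fix f assume f: "f \<in> hom C Z X"
    then have "f = f \<cdot> Idn C Z" by simp
    then show "f = zero_map Z X" using i f assms by simp
  qed (use X assms in simp)
  ultimately show "is_zero C Z"
    using assms unfolding is_zero_def is_terminal_def is_initial_def by blast
qed (rule zero_object_idn)

lemma zero_arr_iff:
  assumes "f \<in> hom C X Y"
  shows "zero_arr C f \<longleftrightarrow> f = zero_map X Y"
proof
  have D: "f \<in> Arr C" "Dom C f = X" "Cod C f = Y" using assms by auto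
  assume "zero_arr C f"
  then obtain Z g h where Z: "is_zero C Z" "g \<in> hom C X Z" "h \<in> hom C Z Y" "f = h \<cdot> g"
    unfolding zero_arr_def D by blast
  have o: "X \<in> Obj C" "Y \<in> Obj C" "Z \<in> Obj C" using Z by auto
  have "h = h \<cdot> Idn C Z" using Z by simp
  also have "\<dots> = zero_map Z Y" using zero_object_idn[OF Z(1)] Z o by simp
  finally show "f = zero_map X Y" using Z o by simp
next
  have D: "f \<in> Arr C" "Dom C f = X" "Cod C f = Y" using assms by auto
  assume f: "f = zero_map X Y"
  have o: "X \<in> Obj C" "Y \<in> Obj C" using assms by auto
  obtain g h where gh: "g \<in> hom C X zero_obj" "h \<in> hom C zero_obj Y" "zero_map X Y = h \<cdot> g"
    by (rule zero_map_factors[OF o], rule that)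
  then show "zero_arr C f" using zero_obj f D(1) unfolding zero_arr_def D(2,3) by blast
qed

text \<open>The kernel is the pullback along the zero map out of the zero object.\<close>

lemma kernel_exists:
  assumes "f \<in> hom C X Y"
  obtains K k where "is_kernel C k f" "k \<in> hom C K X" "f \<cdot> k = zero_map K Y" "monic C k"
    "\<And>T x. x \<in> hom C T X \<Longrightarrow> f \<cdot> x = zero_map T Y \<Longrightarrow> \<exists>h. h \<in> hom C T K \<and> k \<cdot> h = x"
proof -
  have o: "X \<in> Obj C" "Y \<in> Obj C" using assms by auto
  have z: "zero_map zero_obj Y \<in> hom C zero_obj Y" using o by simp
  obtain K k l where K: "is_pullback C f (zero_map zero_obj Y) k l" "k \<in> hom C K X" "l \<in> hom C K zero_obj"
      "f \<cdot> k = zero_map zero_obj Y \<cdot> l"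
    by (rule pullback_exists[OF assms z], rule that)
  have K0: "K \<in> Obj C" using K by auto
  have fk: "f \<cdot> k = zero_map K Y" using K o by simp
  have lift: "\<exists>h. h \<in> hom C T K \<and> k \<cdot> h = x" if x: "x \<in> hom C T X" "f \<cdot> x = zero_map T Y" for T x
  proof -
    have T: "T \<in> Obj C" using x by auto
    have "zero_map T zero_obj \<in> hom C T zero_obj" "f \<cdot> x = zero_map zero_obj Y \<cdot> zero_map T zero_obj" using x o T by simp_all
    then obtain h where "h \<in> hom C T (Dom C k)" "k \<cdot> h = x"
      using pullback_lift[OF K(1) assms z x(1)] by blast
    then show ?thesis using K by auto
  qed
  have mono: "h = h'" if h: "h \<in> hom C T K" "h' \<in> hom C T K" "k \<cdot> h = k \<cdot> h'" for T h h'
  proof (rule pullback_mono[OF K(1)])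
    show "l \<cdot> h = l \<cdot> h'" using zero_obj_terminal[of "l \<cdot> h" T "l \<cdot> h'"] h K by simp
  qed (use h K in auto)
  have m: "monic C k" unfolding monic_def using mono K(2) by auto
  have "is_kernel C k f"
    unfolding is_kernel_def
  proof (intro conjI allI ballI impI)
    have Dk: "Dom C k = K" using K(2) by simp
    show "zero_arr C (f \<cdot> k)" using fk zero_arr_iff[of "f \<cdot> k" K Y] K assms o K0 by simp
    fix T x assume x: "x \<in> hom C T (Dom C f)" "zero_arr C (f \<cdot> x)"
    then have x': "x \<in> hom C T X" "f \<cdot> x = zero_map T Y" using zero_arr_iff[of "f \<cdot> x" T Y] assms by auto
    show "\<exists>!h. h \<in> hom C T (Dom C k) \<and> k \<cdot> h = x"
      using lift[OF x'] mono unfolding Dk by blast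
  qed (use K assms in auto)
  then show ?thesis using that K(2) fk m lift by blast
qed

text \<open>The only appeal to the short five lemma. The section makes both \<open>g\<close> and its restriction to the subobject
  regular epimorphisms onto \<open>Y\<close>, and the two have the same kernel, so the inclusion is an isomorphism. In group
  theoretic terms, \<open>S\<close> is generated by the kernel of \<open>g\<close> and the image of a section.\<close>

lemma subobject_with_kernel_and_section:
  assumes n: "monic C n" "n \<in> hom C N S" and g: "g \<in> hom C S Y"
    and s: "s \<in> hom C Y N" "g \<cdot> (n \<cdot> s) = Idn C Y"
    and ker: "\<And>T k. k \<in> hom C T S \<Longrightarrow> g \<cdot> k = zero_map T Y \<Longrightarrow> \<exists>h. h \<in> hom C T N \<and> n \<cdot> h = k"
    and x: "x \<in> hom C T S"
  shows "\<exists>h. h \<in> hom C T N \<and> n \<cdot> h = x"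
proof -
  have gn: "g \<cdot> n \<in> hom C N Y" using g n by simp
  obtain K k where K: "is_kernel C k g" "k \<in> hom C K S" "g \<cdot> k = zero_map K Y" "monic C k"
    and kl: "\<And>T x. x \<in> hom C T S \<Longrightarrow> g \<cdot> x = zero_map T Y \<Longrightarrow> \<exists>h. h \<in> hom C T K \<and> k \<cdot> h = x"
    by (rule kernel_exists[OF g], rule that)
  obtain k0 where k0: "k0 \<in> hom C K N" "n \<cdot> k0 = k" using ker[OF K(2,3)] by blast
  have o: "K \<in> Obj C" "Y \<in> Obj C" using K g by auto
  have "is_kernel C k0 (g \<cdot> n)"
    unfolding is_kernel_def
  proof (intro conjI allI ballI impI)
    have "(g \<cdot> n) \<cdot> k0 = zero_map K Y" using k0 K g n by simp
    then show "zero_arr C ((g \<cdot> n) \<cdot> k0)" using zero_arr_iff[of "(g \<cdot> n) \<cdot> k0" K Y] k0 gn g n o by simp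
    fix T x assume x: "x \<in> hom C T (Dom C (g \<cdot> n))" "zero_arr C ((g \<cdot> n) \<cdot> x)"
    then have x': "x \<in> hom C T N" "g \<cdot> (n \<cdot> x) = zero_map T Y"
      using zero_arr_iff[of "(g \<cdot> n) \<cdot> x" T Y] g n by auto
    have "n \<cdot> x \<in> hom C T S" using x' n by simp
    then obtain h where h: "h \<in> hom C T K" "k \<cdot> h = n \<cdot> x" using kl x' by blast
    show "\<exists>!h. h \<in> hom C T (Dom C k0) \<and> k0 \<cdot> h = x"
    proof (rule ex1I[of _ h])
      show "h \<in> hom C T (Dom C k0) \<and> k0 \<cdot> h = x"
        using mono_cancel[OF n, of "k0 \<cdot> h" T x] h k0 x' n triangle_comp[OF k0(2), of h] by simp
      fix h' assume h': "h' \<in> hom C T (Dom C k0) \<and> k0 \<cdot> h' = x"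
      then show "h' = h"
        using mono_cancel[OF K(4,2), of h' T h] h k0 n triangle_comp[OF k0(2), of h'] by auto
    qed
  qed (use k0 gn in auto)
  moreover have "regular_epi C (g \<cdot> n)"
    using split_epi_cover[OF gn s(1)] s n g by simp
  moreover have "regular_epi C g"
    using split_epi_cover[OF g, of "n \<cdot> s"] s n by simp
  moreover have "is_iso C (Idn C K)" "is_iso C (Idn C Y)"
    using o unfolding is_iso_def by auto
  moreover have "Idn C K \<in> hom C (Dom C k0) (Dom C k)" "n \<in> hom C (Dom C (g \<cdot> n)) (Dom C g)"
    "Idn C Y \<in> hom C (Cod C (g \<cdot> n)) (Cod C g)" "n \<cdot> k0 = k \<cdot> Idn C K"
    "Idn C Y \<cdot> (g \<cdot> n) = g \<cdot> n"
    using k0 K n g o gn by auto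
  ultimately have "is_iso C n"
    using sa K(1) unfolding semi_abelian_def regular_short_five_lemma_def by blast
  then obtain i where i: "i \<in> hom C S N" "n \<cdot> i = Idn C S"
    using n unfolding is_iso_def by auto
  have "n \<cdot> (i \<cdot> x) = x" using triangle_comp[OF i(2), of x] i n x by auto
  then show ?thesis using i x by (intro exI[of _ "i \<cdot> x"]) simp
qed

text \<open>The Maltsev property. Let \<open>Z\<close> consist of the triples of elements of \<open>R\<close> whose first two entries agree under
  \<open>y\<close> and whose last two agree under \<open>x\<close>, and consider the triples for which a fourth element with the required
  coordinates exists. These include the triples \<open>(a, b, b)\<close>, which form the image of a section of the projection
  to the first two entries, with \<open>a\<close> as fourth element; and they include the triples \<open>(0, 0, c)\<close>, which form its
  kernel, with \<open>c\<close> as fourth element. Hence they are all of \<open>Z\<close>.\<close>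

lemma difunctional:
  assumes x: "x \<in> hom C R X" and y: "y \<in> hom C R Y"
    and a: "a \<in> hom C T R" and b: "b \<in> hom C T R" and c: "c \<in> hom C T R"
    and ab: "y \<cdot> a = y \<cdot> b" and bc: "x \<cdot> b = x \<cdot> c"
  obtains S t d where "cover t S T" "d \<in> hom C S R" "x \<cdot> d = x \<cdot> (a \<cdot> t)" "y \<cdot> d = y \<cdot> (c \<cdot> t)"
proof -
  have o: "R \<in> Obj C" "X \<in> Obj C" "Y \<in> Obj C" using x y by auto
  obtain P p1 p2 where P: "is_pullback C y y p1 p2" "p1 \<in> hom C P R" "p2 \<in> hom C P R" "y \<cdot> p1 = y \<cdot> p2"
    by (rule pullback_exists[OF y y], rule that)
  obtain Q q1 q2 where Q: "is_pullback C x x q1 q2" "q1 \<in> hom C Q R" "q2 \<in> hom C Q R" "x \<cdot> q1 = x \<cdot> q2"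
    by (rule pullback_exists[OF x x], rule that)
  obtain Z u v where Z: "is_pullback C p2 q1 u v" "u \<in> hom C Z P" "v \<in> hom C Z Q" "p2 \<cdot> u = q1 \<cdot> v"
    by (rule pullback_exists[OF P(3) Q(2)], rule that)
  have o': "P \<in> Obj C" "Q \<in> Obj C" "Z \<in> Obj C" using P Q Z by auto
  obtain W l r where W: "is_product C X Y W l r" by (rule product_exists[OF o(2,3)], rule that)
  note lr = product_typing[OF W]
  obtain xy where xy: "xy \<in> hom C R W" "l \<cdot> xy = x" "r \<cdot> xy = y"
    by (rule product_lift[OF W x y], rule that)
  have s1: "x \<cdot> (p1 \<cdot> u) \<in> hom C Z X" "y \<cdot> (q2 \<cdot> v) \<in> hom C Z Y"
    using x y P Q Z by simp_all
  obtain st where st: "st \<in> hom C Z W" "l \<cdot> st = x \<cdot> (p1 \<cdot> u)" "r \<cdot> st = y \<cdot> (q2 \<cdot> v)"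
    by (rule product_lift[OF W s1], rule that)
  obtain M m k where M: "is_pullback C st xy m k" "m \<in> hom C M Z" "k \<in> hom C M R" "st \<cdot> m = xy \<cdot> k"
    by (rule pullback_exists[OF st(1) xy(1)], rule that)
  obtain N e n where N: "cover e M N" "n \<in> hom C N Z" "monic C n" "n \<cdot> e = m"
    by (rule image_exists[OF M(2)], rule that)
  \<comment> \<open>\<open>N\<close> is the subobject of \<open>Z\<close> of triples that locally admit a fourth element.\<close>
  have fac: "\<exists>h. h \<in> hom C V N \<and> n \<cdot> h = z"
    if z: "z \<in> hom C V Z" and w: "w \<in> hom C V R" "x \<cdot> w = x \<cdot> (p1 \<cdot> (u \<cdot> z))" "y \<cdot> w = y \<cdot> (q2 \<cdot> (v \<cdot> z))" for V z w
  proof -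
    have stz: "st \<cdot> z = xy \<cdot> w"
    proof (rule product_mono[OF W, of _ V])
      show "l \<cdot> st \<cdot> z = l \<cdot> xy \<cdot> w"
        using triangle_comp[OF st(2), of z] triangle_comp[OF xy(2), of w] lr st xy z w P Z x by simp
      show "r \<cdot> st \<cdot> z = r \<cdot> xy \<cdot> w"
        using triangle_comp[OF st(3), of z] triangle_comp[OF xy(3), of w] lr st xy z w Q Z y by simp
    qed (use st xy z w in auto)
    obtain j where j: "j \<in> hom C V (Dom C m)" "m \<cdot> j = z"
      by (rule pullback_lift[OF M(1) st(1) xy(1) z w(1) stz], rule that)
    have "e \<cdot> j \<in> hom C V N" "n \<cdot> (e \<cdot> j) = z"
      using j N M triangle_comp[OF N(4), of j] by auto
    then show ?thesis by blast
  qed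
  have iR: "Idn C R \<in> hom C R R" "x \<cdot> Idn C R = x \<cdot> Idn C R" using o by simp_all
  obtain dl where dl: "dl \<in> hom C R (Dom C q1)" "q1 \<cdot> dl = Idn C R" "q2 \<cdot> dl = Idn C R"
    by (rule pullback_lift[OF Q(1) x x iR(1) iR(1) iR(2)], rule that)
  have sgE: "Idn C P \<in> hom C P P" "dl \<cdot> p2 \<in> hom C P Q" "p2 \<cdot> Idn C P = q1 \<cdot> (dl \<cdot> p2)"
    using o' dl P Q triangle_comp[OF dl(2), of p2] by auto
  obtain sg where sg: "sg \<in> hom C P (Dom C u)" "u \<cdot> sg = Idn C P" "v \<cdot> sg = dl \<cdot> p2"
    by (rule pullback_lift[OF Z(1) P(3) Q(2) sgE], rule that)
  have sgZ: "sg \<in> hom C P Z" using sg Z by simp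
  have "x \<cdot> p1 = x \<cdot> (p1 \<cdot> (u \<cdot> sg))" using sg P by auto
  moreover have "q2 \<cdot> (dl \<cdot> p2) = p2" using triangle_comp[OF dl(3), of p2] dl P Q by auto
  then have "y \<cdot> p1 = y \<cdot> (q2 \<cdot> (v \<cdot> sg))" using sg P by simp
  ultimately obtain sg' where sg': "sg' \<in> hom C P N" "n \<cdot> sg' = sg"
    using fac[OF sgZ P(2)] by blast
  have all: "\<exists>h. h \<in> hom C V N \<and> n \<cdot> h = z" if z: "z \<in> hom C V Z" for V z
  proof (rule subobject_with_kernel_and_section[OF N(3,2) Z(2) sg'(1) _ _ z])
    show "u \<cdot> (n \<cdot> sg') = Idn C P" using sg sg' by simp
    fix V' z' assume z': "z' \<in> hom C V' Z" "u \<cdot> z' = zero_map V' P"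
    have V': "V' \<in> Obj C" using z' by auto
    have "q2 \<cdot> (v \<cdot> z') \<in> hom C V' R" using z' Q Z by simp
    moreover have "x \<cdot> (q2 \<cdot> (v \<cdot> z')) = x \<cdot> (p1 \<cdot> (u \<cdot> z'))"
    proof -
      have "x \<cdot> (q2 \<cdot> (v \<cdot> z')) = x \<cdot> (q1 \<cdot> (v \<cdot> z'))"
        using square_comp[OF Q(4), of "v \<cdot> z'"] Q Z z' x by simp
      also have "q1 \<cdot> (v \<cdot> z') = p2 \<cdot> (u \<cdot> z')"
        using square_comp[OF Z(4), of z'] Q Z z' P by simp
      finally show ?thesis using z' P V' x o o' by simp
    qed
    ultimately show "\<exists>h. h \<in> hom C V' N \<and> n \<cdot> h = z'" using fac[OF z'(1)] by blast
  qed
  obtain ab' where ab': "ab' \<in> hom C T (Dom C p1)" "p1 \<cdot> ab' = a" "p2 \<cdot> ab' = b"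
    by (rule pullback_lift[OF P(1) y y a b ab], rule that)
  obtain bc' where bc': "bc' \<in> hom C T (Dom C q1)" "q1 \<cdot> bc' = b" "q2 \<cdot> bc' = c"
    by (rule pullback_lift[OF Q(1) x x b c bc], rule that)
  have zE: "ab' \<in> hom C T P" "bc' \<in> hom C T Q" "p2 \<cdot> ab' = q1 \<cdot> bc'" using ab' bc' P Q by simp_all
  obtain z where z: "z \<in> hom C T (Dom C u)" "u \<cdot> z = ab'" "v \<cdot> z = bc'"
    by (rule pullback_lift[OF Z(1) P(3) Q(2) zE], rule that)
  have zZ: "z \<in> hom C T Z" using z Z by simp
  obtain z' where z': "z' \<in> hom C T N" "n \<cdot> z' = z" using all[OF zZ] by blast
  obtain S t j where t: "cover t S T" "j \<in> hom C S M" "e \<cdot> j = z' \<cdot> t"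
    by (rule local_lift[OF N(1) z'(1)], rule that)
  have mj: "m \<cdot> j = z \<cdot> t"
  proof -
    have "m \<cdot> j = n \<cdot> (e \<cdot> j)" using triangle_comp[OF N(4), of j] N t by auto
    also have "\<dots> = z \<cdot> t" using t z' triangle_comp[OF z'(2), of t] N by simp
    finally show ?thesis .
  qed
  have *: "xy \<cdot> (k \<cdot> j) = st \<cdot> (z \<cdot> t)" using square_comp[OF M(4), of j] mj M st xy t by simp
  have kj: "k \<cdot> j \<in> hom C S R" using M t by simp
  have "x \<cdot> (k \<cdot> j) = l \<cdot> (xy \<cdot> (k \<cdot> j))" using triangle_comp[OF xy(2), of "k \<cdot> j"] kj xy lr by simp
  also have "\<dots> = x \<cdot> (p1 \<cdot> (u \<cdot> (z \<cdot> t)))" using * triangle_comp[OF st(2), of "z \<cdot> t"] st lr zZ t P Z x by simp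
  also have "u \<cdot> (z \<cdot> t) = ab' \<cdot> t" using triangle_comp[OF z(2), of t] zZ Z t by simp
  also have "p1 \<cdot> (ab' \<cdot> t) = a \<cdot> t" using triangle_comp[OF ab'(2), of t] ab' P t by simp
  finally have 1: "x \<cdot> (k \<cdot> j) = x \<cdot> (a \<cdot> t)" .
  have "y \<cdot> (k \<cdot> j) = r \<cdot> (xy \<cdot> (k \<cdot> j))" using triangle_comp[OF xy(3), of "k \<cdot> j"] kj xy lr by simp
  also have "\<dots> = y \<cdot> (q2 \<cdot> (v \<cdot> (z \<cdot> t)))" using * triangle_comp[OF st(3), of "z \<cdot> t"] st lr zZ t Q Z y by simp
  also have "v \<cdot> (z \<cdot> t) = bc' \<cdot> t" using triangle_comp[OF z(3), of t] zZ Z t by simp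
  also have "q2 \<cdot> (bc' \<cdot> t) = c \<cdot> t" using triangle_comp[OF bc'(3), of t] bc' Q t by simp
  finally have 2: "y \<cdot> (k \<cdot> j) = y \<cdot> (c \<cdot> t)" .
  show thesis using that[OF t(1) kj 1 2] .
qed

end

section \<open>Quotients by images of kernel pairs\<close>

context semi_abelian_cat begin

text \<open>This provides the pushout of a cover \<open>q\<close> and an arrow \<open>e\<close>, together with the fact that its kernel pair is
  computed locally from that of \<open>e\<close>. The image in \<open>Y \<times> Y\<close> of the kernel pair of \<open>e\<close> is reflexive and symmetric
  in any regular category; it is transitive by difunctionality. By exactness it is a kernel pair, and the regular
  part of an arrow with this kernel pair is the quotient wanted.\<close>

lemma quotient_by_image_relation:
  assumes q: "cover q X Y" and e: "e \<in> hom C X Z"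
  obtains W r where "cover r Y W"
    "\<And>T x1 x2. x1 \<in> hom C T X \<Longrightarrow> x2 \<in> hom C T X \<Longrightarrow> e \<cdot> x1 = e \<cdot> x2 \<Longrightarrow> r \<cdot> (q \<cdot> x1) = r \<cdot> (q \<cdot> x2)"
    "\<And>T y1 y2. y1 \<in> hom C T Y \<Longrightarrow> y2 \<in> hom C T Y \<Longrightarrow> r \<cdot> y1 = r \<cdot> y2 \<Longrightarrow>
       \<exists>S t x1 x2. cover t S T \<and> x1 \<in> hom C S X \<and> x2 \<in> hom C S X \<and> e \<cdot> x1 = e \<cdot> x2 \<and>
         q \<cdot> x1 = y1 \<cdot> t \<and> q \<cdot> x2 = y2 \<cdot> t"
proof -
  have o: "X \<in> Obj C" "Y \<in> Obj C" using q by auto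
  have qh: "q \<in> hom C X Y" using q by simp
  obtain E d1 d2 where E: "is_pullback C e e d1 d2" "d1 \<in> hom C E X" "d2 \<in> hom C E X" "e \<cdot> d1 = e \<cdot> d2"
    by (rule pullback_exists[OF e e], rule that)
  obtain YY l r where W: "is_product C Y Y YY l r" by (rule product_exists[OF o(2,2)], rule that)
  note lr = product_typing[OF W]
  have qd: "q \<cdot> d1 \<in> hom C E Y" "q \<cdot> d2 \<in> hom C E Y" using E q by simp_all
  obtain f where f: "f \<in> hom C E YY" "l \<cdot> f = q \<cdot> d1" "r \<cdot> f = q \<cdot> d2"
    by (rule product_lift[OF W qd], rule that)
  obtain I c m where I: "cover c E I" "m \<in> hom C I YY" "monic C m" "m \<cdot> c = f"
    by (rule image_exists[OF f(1)], rule that)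
  define \<rho> \<sigma> where "\<rho> = l \<cdot> m" and "\<sigma> = r \<cdot> m"
  have rs: "\<rho> \<in> hom C I Y" "\<sigma> \<in> hom C I Y" using I lr unfolding \<rho>_def \<sigma>_def by simp_all
  define rel where "rel T y1 y2 \<longleftrightarrow> (\<exists>i. i \<in> hom C T I \<and> \<rho> \<cdot> i = y1 \<and> \<sigma> \<cdot> i = y2)" for T y1 y2
  \<comment> \<open>\<open>rel\<close> is membership in the image \<open>I\<close> of the kernel pair of \<open>e\<close> in \<open>Y \<times> Y\<close>.\<close>
  have rs_c: "\<rho> \<cdot> c = q \<cdot> d1" "\<sigma> \<cdot> c = q \<cdot> d2"
    using triangle_comp[OF I(4)] I lr f unfolding \<rho>_def \<sigma>_def by simp_all
  have relI: "rel T (q \<cdot> x1) (q \<cdot> x2)"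
    if x: "x1 \<in> hom C T X" "x2 \<in> hom C T X" "e \<cdot> x1 = e \<cdot> x2" for T x1 x2
  proof -
    obtain h where h: "h \<in> hom C T (Dom C d1)" "d1 \<cdot> h = x1" "d2 \<cdot> h = x2"
      by (rule pullback_lift[OF E(1) e e x], rule that)
    have "\<rho> \<cdot> (c \<cdot> h) = q \<cdot> x1" "\<sigma> \<cdot> (c \<cdot> h) = q \<cdot> x2"
      using square_comp[OF rs_c(1), of h] square_comp[OF rs_c(2), of h] h rs I E q by simp_all
    moreover have "c \<cdot> h \<in> hom C T I" using h I E by simp
    ultimately show ?thesis unfolding rel_def by blast
  qed
  have relE: "\<exists>S t x1 x2. cover t S T \<and> x1 \<in> hom C S X \<and> x2 \<in> hom C S X \<and> e \<cdot> x1 = e \<cdot> x2 \<and>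
         q \<cdot> x1 = y1 \<cdot> t \<and> q \<cdot> x2 = y2 \<cdot> t" if y: "rel T y1 y2" for T y1 y2
  proof -
    obtain i where i: "i \<in> hom C T I" "\<rho> \<cdot> i = y1" "\<sigma> \<cdot> i = y2" using y unfolding rel_def by blast
    obtain S t h where t: "cover t S T" "h \<in> hom C S E" "c \<cdot> h = i \<cdot> t"
      by (rule local_lift[OF I(1) i(1)], rule that)
    have "\<rho> \<cdot> (c \<cdot> h) = q \<cdot> (d1 \<cdot> h)" "\<sigma> \<cdot> (c \<cdot> h) = q \<cdot> (d2 \<cdot> h)"
      using square_comp[OF rs_c(1), of h] square_comp[OF rs_c(2), of h] t rs I E q by simp_all
    moreover have "\<rho> \<cdot> (c \<cdot> h) = y1 \<cdot> t" "\<sigma> \<cdot> (c \<cdot> h) = y2 \<cdot> t"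
      using triangle_comp[OF i(2), of t] triangle_comp[OF i(3), of t] t i rs by simp_all
    moreover have "e \<cdot> (d1 \<cdot> h) = e \<cdot> (d2 \<cdot> h)" using square_comp[OF E(4), of h] E t e by simp
    moreover have "d1 \<cdot> h \<in> hom C S X" "d2 \<cdot> h \<in> hom C S X" using E t by simp_all
    ultimately show ?thesis using t(1) by metis
  qed
  have rel_local: "rel T y1 y2"
    if t: "cover t S T" and y: "y1 \<in> hom C T Y" "y2 \<in> hom C T Y" and st: "rel S (y1 \<cdot> t) (y2 \<cdot> t)" for S T t y1 y2
  proof -
    obtain y where y': "y \<in> hom C T YY" "l \<cdot> y = y1" "r \<cdot> y = y2" by (rule product_lift[OF W y], rule that)
    obtain i where i: "i \<in> hom C S I" "\<rho> \<cdot> i = y1 \<cdot> t" "\<sigma> \<cdot> i = y2 \<cdot> t" using st unfolding rel_def by blast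
    have mi: "m \<cdot> i = y \<cdot> t"
    proof (rule product_mono[OF W, of _ S])
      show "l \<cdot> m \<cdot> i = l \<cdot> y \<cdot> t" "r \<cdot> m \<cdot> i = r \<cdot> y \<cdot> t"
        using i y' I lr t triangle_comp[OF y'(2), of t] triangle_comp[OF y'(3), of t]
        unfolding \<rho>_def \<sigma>_def by simp_all
    qed (use i I y' t in simp_all)
    obtain w where w: "w \<in> hom C T I" "m \<cdot> w = y"
      by (rule cover_descent[OF t I(3,2) y'(1) i(1) mi], rule that)
    then have "\<rho> \<cdot> w = y1" "\<sigma> \<cdot> w = y2" using y' I lr unfolding \<rho>_def \<sigma>_def by simp_all
    then show ?thesis using w unfolding rel_def by blast
  qed
  have rrefl: "rel Y (Idn C Y) (Idn C Y)"
    using rel_local[OF q, of "Idn C Y" "Idn C Y"] relI[of "Idn C X" X "Idn C X"] q o by simp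
  have sym: "rel I \<sigma> \<rho>"
  proof -
    have "rel I \<rho> \<sigma>" unfolding rel_def using rs by (intro exI[of _ "Idn C I"]) auto
    then obtain S t x1 x2 where t: "cover t S I" "x1 \<in> hom C S X" "x2 \<in> hom C S X"
       "e \<cdot> x1 = e \<cdot> x2" "q \<cdot> x1 = \<rho> \<cdot> t" "q \<cdot> x2 = \<sigma> \<cdot> t" using relE by blast
    then have "rel S (\<sigma> \<cdot> t) (\<rho> \<cdot> t)" using relI[of x2 S x1] by simp
    then show ?thesis using rel_local[OF t(1) rs(2,1)] by blast
  qed
  have trans: "rel T y1 y3"
    if y: "y1 \<in> hom C T Y" "y2 \<in> hom C T Y" "y3 \<in> hom C T Y" and r: "rel T y1 y2" "rel T y2 y3" for T y1 y2 y3
  proof -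
    obtain S t x1 x2 where t: "cover t S T" "x1 \<in> hom C S X" "x2 \<in> hom C S X"
       "e \<cdot> x1 = e \<cdot> x2" "q \<cdot> x1 = y1 \<cdot> t" "q \<cdot> x2 = y2 \<cdot> t" using relE[OF r(1)] by blast
    obtain i where i: "i \<in> hom C T I" "\<rho> \<cdot> i = y2" "\<sigma> \<cdot> i = y3" using r(2) unfolding rel_def by blast
    have "rel S (y2 \<cdot> t) (y3 \<cdot> t)" unfolding rel_def
      using i t(1) rs triangle_comp[OF i(2), of t] triangle_comp[OF i(3), of t]
      by (intro exI[of _ "i \<cdot> t"]) simp
    then obtain S' t' x3 x4 where t': "cover t' S' S" "x3 \<in> hom C S' X" "x4 \<in> hom C S' X"
       "e \<cdot> x3 = e \<cdot> x4" "q \<cdot> x3 = (y2 \<cdot> t) \<cdot> t'" "q \<cdot> x4 = (y3 \<cdot> t) \<cdot> t'" using relE by blast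
    have h: "x1 \<cdot> t' \<in> hom C S' X" "x2 \<cdot> t' \<in> hom C S' X" "e \<cdot> (x1 \<cdot> t') = e \<cdot> (x2 \<cdot> t')"
      using square_comp[OF t(4), of t'] t t' e by simp_all
    obtain a where a: "a \<in> hom C S' (Dom C d1)" "d1 \<cdot> a = x1 \<cdot> t'" "d2 \<cdot> a = x2 \<cdot> t'"
      by (rule pullback_lift[OF E(1) e e h], rule that)
    obtain b where b: "b \<in> hom C S' (Dom C d1)" "d1 \<cdot> b = x2 \<cdot> t'" "d2 \<cdot> b = x2 \<cdot> t'"
      by (rule pullback_lift[OF E(1) e e h(2) h(2) refl], rule that)
    obtain c where c: "c \<in> hom C S' (Dom C d1)" "d1 \<cdot> c = x3" "d2 \<cdot> c = x4"
      by (rule pullback_lift[OF E(1) e e t'(2,3,4)], rule that)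
    have abc: "a \<in> hom C S' E" "b \<in> hom C S' E" "c \<in> hom C S' E" using a b c E by simp_all
    have 1: "(q \<cdot> d2) \<cdot> a = (q \<cdot> d2) \<cdot> b" using a b q E by simp
    have 2: "(q \<cdot> d1) \<cdot> b = (q \<cdot> d1) \<cdot> c"
      using b c q E t' square_comp[OF t(6), of t'] t y by simp
    obtain S'' t'' d where d: "cover t'' S'' S'" "d \<in> hom C S'' E" "(q \<cdot> d1) \<cdot> d = (q \<cdot> d1) \<cdot> (a \<cdot> t'')"
      "(q \<cdot> d2) \<cdot> d = (q \<cdot> d2) \<cdot> (c \<cdot> t'')"
      by (rule difunctional[OF qd abc 1 2], rule that)
    define tt where "tt = t \<cdot> (t' \<cdot> t'')"
    have tt: "cover tt S'' T" unfolding tt_def using cover_comp[OF cover_comp[OF d(1) t'(1)] t(1)] by simp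
    have ed: "d1 \<cdot> d \<in> hom C S'' X" "d2 \<cdot> d \<in> hom C S'' X" "e \<cdot> (d1 \<cdot> d) = e \<cdot> (d2 \<cdot> d)"
      using square_comp[OF E(4), of d] E d e by simp_all
    have "d1 \<cdot> (a \<cdot> t'') = x1 \<cdot> (t' \<cdot> t'')" "d2 \<cdot> (c \<cdot> t'') = x4 \<cdot> t''"
      using square_comp[OF a(2), of t''] triangle_comp[OF c(3), of t''] a c E d t t' by simp_all
    then have "q \<cdot> (d1 \<cdot> d) = q \<cdot> (x1 \<cdot> (t' \<cdot> t''))" "q \<cdot> (d2 \<cdot> d) = q \<cdot> (x4 \<cdot> t'')"
      using d abc E q by simp_all
    moreover have "q \<cdot> (x1 \<cdot> (t' \<cdot> t'')) = y1 \<cdot> tt" "q \<cdot> (x4 \<cdot> t'') = y3 \<cdot> tt"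
      using square_comp[OF t(5), of "t' \<cdot> t''"] square_comp[OF t'(6), of t''] t t' y q d
      unfolding tt_def by simp_all
    ultimately have "rel S'' (y1 \<cdot> tt) (y3 \<cdot> tt)" using relI[OF ed] by simp
    then show ?thesis using rel_local[OF tt y(1,3)] by blast
  qed
  have D: "Dom C \<rho> = I" "Cod C \<rho> = Y" "Dom C \<sigma> = I" "Cod C \<sigma> = Y" using rs by auto
  have "equivalence_relation C \<rho> \<sigma>"
    unfolding equivalence_relation_def D
  proof (intro conjI allI ballI impI)
    fix T x y assume x: "x \<in> hom C T I" and y: "y \<in> hom C T I" and xy: "\<rho> \<cdot> x = \<rho> \<cdot> y \<and> \<sigma> \<cdot> x = \<sigma> \<cdot> y"
    have "m \<cdot> x = m \<cdot> y"
      by (rule product_mono[OF W, of _ T]) (use x y xy I lr in \<open>simp_all add: \<rho>_def \<sigma>_def\<close>)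
    then show "x = y" using mono_cancel[OF I(3,2) x y] by blast
  next
    show "\<exists>d\<in>hom C Y I. \<rho> \<cdot> d = Idn C Y \<and> \<sigma> \<cdot> d = Idn C Y" using rrefl unfolding rel_def by blast
    show "\<exists>t\<in>hom C I I. \<rho> \<cdot> t = \<sigma> \<and> \<sigma> \<cdot> t = \<rho>" using sym unfolding rel_def by blast
  next
    fix p p' assume "is_pullback C \<sigma> \<rho> p p'"
    note P = pullback_facts[OF this rs(2)]
    define T where "T = Dom C p"
    have p: "p \<in> hom C T I" "p' \<in> hom C T I" using P D unfolding T_def by auto
    have 1: "\<rho> \<cdot> p \<in> hom C T Y" "\<sigma> \<cdot> p \<in> hom C T Y" "\<sigma> \<cdot> p' \<in> hom C T Y" using p rs by simp_all
    have 2: "rel T (\<rho> \<cdot> p) (\<sigma> \<cdot> p)" "rel T (\<sigma> \<cdot> p) (\<sigma> \<cdot> p')"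
      unfolding rel_def
      by (intro exI[of _ p] conjI p(1) HOL.refl, intro exI[of _ p'] conjI p(2) HOL.refl P(5)[symmetric])
    show "\<exists>t\<in>hom C (Dom C p) I. \<rho> \<cdot> t = \<rho> \<cdot> p \<and> \<sigma> \<cdot> t = \<sigma> \<cdot> p'"
      using trans[OF 1 2] unfolding rel_def T_def by blast
  qed (use rs in simp_all)
  then obtain g where "is_kernel_pair C g \<rho> \<sigma>"
    using sa unfolding semi_abelian_def barr_exact_def by blast
  then have g: "is_pullback C g g \<rho> \<sigma>" unfolding is_kernel_pair_def .
  define V where "V = Cod C g"
  have gh: "g \<in> hom C Y V" and grs: "g \<cdot> \<rho> = g \<cdot> \<sigma>" using g D unfolding is_pullback_def V_def by simp_all
  obtain J c' m' where J: "cover c' Y J" "m' \<in> hom C J V" "monic C m'" "m' \<cdot> c' = g"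
    by (rule image_exists[OF gh], rule that)
  show thesis
  proof (rule that[OF J(1)])
    fix T x1 x2 assume x: "x1 \<in> hom C T X" "x2 \<in> hom C T X" "e \<cdot> x1 = e \<cdot> x2"
    obtain i where i: "i \<in> hom C T I" "\<rho> \<cdot> i = q \<cdot> x1" "\<sigma> \<cdot> i = q \<cdot> x2"
      using relI[OF x] unfolding rel_def by blast
    have "m' \<cdot> (c' \<cdot> (q \<cdot> x1)) = g \<cdot> (\<rho> \<cdot> i)"
      using triangle_comp[OF J(4), of "q \<cdot> x1"] i J x q by simp
    also have "\<dots> = g \<cdot> (\<sigma> \<cdot> i)" using square_comp[OF grs, of i] i rs gh by simp
    also have "\<dots> = m' \<cdot> (c' \<cdot> (q \<cdot> x2))"
      using triangle_comp[OF J(4), of "q \<cdot> x2"] i J x q by simp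
    finally show "c' \<cdot> (q \<cdot> x1) = c' \<cdot> (q \<cdot> x2)"
      using mono_cancel[OF J(3,2), of "c' \<cdot> (q \<cdot> x1)" T "c' \<cdot> (q \<cdot> x2)"] J x q by simp
  next
    fix T y1 y2 assume y: "y1 \<in> hom C T Y" "y2 \<in> hom C T Y" and "c' \<cdot> y1 = c' \<cdot> y2"
    then have "g \<cdot> y1 = g \<cdot> y2" using triangle_comp[OF J(4), of y1] triangle_comp[OF J(4), of y2] J by simp
    then obtain i where "i \<in> hom C T (Dom C \<rho>)" "\<rho> \<cdot> i = y1" "\<sigma> \<cdot> i = y2"
      using pullback_lift[OF g gh gh y] by blast
    then have "rel T y1 y2" unfolding rel_def using D by auto
    then show "\<exists>S t x1 x2. cover t S T \<and> x1 \<in> hom C S X \<and> x2 \<in> hom C S X \<and> e \<cdot> x1 = e \<cdot> x2 \<and>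
         q \<cdot> x1 = y1 \<cdot> t \<and> q \<cdot> x2 = y2 \<cdot> t" by (rule relE)
  qed
qed

end

section \<open>Reflections onto a Birkhoff subcategory\<close>

locale birkhoff_cat = semi_abelian_cat C for C :: "('o, 'm) cat" (structure) +
  fixes B :: "'o set"
  assumes birkhoff: "birkhoff C B"
begin

abbreviation \<eta> :: "'o \<Rightarrow> 'm" where "\<eta> X \<equiv> unit C B X"
abbreviation \<beta> :: "'o \<Rightarrow> 'o" where "\<beta> X \<equiv> refl_obj C B X"

lemma B_obj: "X \<in> B \<Longrightarrow> X \<in> Obj C"
  using birkhoff unfolding birkhoff_def reflective_def by blast

lemma unit_reflection:
  assumes "X \<in> Obj C"
  shows "is_reflection C B X (\<eta> X)"
  using birkhoff assms unfolding birkhoff_def reflective_def unit_def by (metis someI_ex)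

lemma unit_typing [simp]:
  assumes "X \<in> Obj C"
  shows "\<eta> X \<in> Arr C" "Dom C (\<eta> X) = X" "Cod C (\<eta> X) = \<beta> X" "\<beta> X \<in> B" "\<beta> X \<in> Obj C"
  using unit_reflection[OF assms] B_obj unfolding is_reflection_def refl_obj_def by auto

lemma unit_universal:
  assumes "f \<in> hom C X Y" "Y \<in> B"
  obtains g where "g \<in> hom C (\<beta> X) Y" "g \<cdot> \<eta> X = f"
proof -
  have "X \<in> Obj C" using assms by auto
  then show ?thesis
    using unit_reflection assms that unfolding is_reflection_def refl_obj_def by blast
qed

lemma unit_cancel:
  assumes "g \<in> hom C (\<beta> X) Y" "h \<in> hom C (\<beta> X) Y" "Y \<in> B" "X \<in> Obj C" "g \<cdot> \<eta> X = h \<cdot> \<eta> X"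
  shows "g = h"
proof -
  have "h \<cdot> \<eta> X \<in> hom C X Y" using assms by simp
  then have "\<exists>!k. k \<in> hom C (\<beta> X) Y \<and> k \<cdot> \<eta> X = h \<cdot> \<eta> X"
    using unit_reflection[OF assms(4)] assms(3) unfolding is_reflection_def refl_obj_def by blast
  then show ?thesis using assms(1,2,5) by metis
qed

text \<open>The image of the unit is a subobject of an object of \<open>B\<close>, so it lies in \<open>B\<close> and the universal
  property of the unit provides an inverse to its inclusion.\<close>

lemma unit_cover:
  assumes X: "X \<in> Obj C"
  shows "cover (\<eta> X) X (\<beta> X)"
proof -
  have e: "\<eta> X \<in> hom C X (\<beta> X)" using X by simp
  obtain I c m where I: "cover c X I" "m \<in> hom C I (\<beta> X)" "monic C m" "m \<cdot> c = \<eta> X"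
    by (rule image_exists[OF e], rule that)
  have D: "Dom C m = I" "Cod C m = \<beta> X" using I by auto
  have "I \<in> B" using birkhoff I(3) D X unfolding birkhoff_def by (metis unit_typing(4))
  moreover have cI: "c \<in> hom C X I" using I by simp
  ultimately obtain n where n: "n \<in> hom C (\<beta> X) I" "n \<cdot> \<eta> X = c"
    using unit_universal by blast
  have mn: "m \<cdot> n = Idn C (\<beta> X)"
    using unit_cancel[of "m \<cdot> n" X "\<beta> X" "Idn C (\<beta> X)"] X n I by simp
  have I0: "I \<in> Obj C" using cI by auto
  have "n \<cdot> m = Idn C I"
    using mono_cancel[OF I(3,2), of "n \<cdot> m" I "Idn C I"] n I X I0 triangle_comp[OF mn, of m] by simp
  then show ?thesis using cover_then_iso_cover[OF I(1,2) n(1) mn] I by simp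
qed

lemma B_quotient:
  assumes "cover f X Y" "X \<in> B"
  shows "Y \<in> B"
proof -
  have "Dom C f = X" "Cod C f = Y" "regular_epi C f" using assms by auto
  then show ?thesis using birkhoff assms(2) unfolding birkhoff_def by blast
qed

lemma refl_arr:
  assumes f: "f \<in> hom C X Y"
  shows "refl_arr C B f \<in> hom C (\<beta> X) (\<beta> Y)" "refl_arr C B f \<cdot> \<eta> X = \<eta> Y \<cdot> f"
proof -
  have o: "X \<in> Obj C" "Y \<in> Obj C" and D: "Dom C f = X" "Cod C f = Y" using f by auto
  have ef: "\<eta> Y \<cdot> f \<in> hom C X (\<beta> Y)" using f o by simp
  obtain g where g: "g \<in> hom C (\<beta> X) (\<beta> Y)" "g \<cdot> \<eta> X = \<eta> Y \<cdot> f"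
    by (rule unit_universal[OF ef unit_typing(4)[OF o(2)]], rule that)
  have "refl_arr C B f = g"
    unfolding refl_arr_def D
  proof (rule the_equality)
    fix k assume "k \<in> hom C (\<beta> X) (\<beta> Y) \<and> k \<cdot> \<eta> X = \<eta> Y \<cdot> f"
    then show "k = g" using unit_cancel[of k X "\<beta> Y" g] g o by simp
  qed (use g in blast)
  then show "refl_arr C B f \<in> hom C (\<beta> X) (\<beta> Y)" "refl_arr C B f \<cdot> \<eta> X = \<eta> Y \<cdot> f"
    using g by simp_all
qed

lemma unit_natural:
  assumes f: "f \<in> hom C X Y" and x: "x \<in> hom C T X"
  shows "\<eta> Y \<cdot> (f \<cdot> x) = refl_arr C B f \<cdot> (\<eta> X \<cdot> x)"
proof -
  have o: "X \<in> Obj C" "Y \<in> Obj C" using f by auto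
  show ?thesis using refl_arr[OF f] square_comp[OF refl_arr(2)[OF f], of x] f x o by simp
qed

lemma unit_natural_eq:
  assumes "f \<in> hom C X Y" "x1 \<in> hom C T X" "x2 \<in> hom C T X" "\<eta> X \<cdot> x1 = \<eta> X \<cdot> x2"
  shows "\<eta> Y \<cdot> (f \<cdot> x1) = \<eta> Y \<cdot> (f \<cdot> x2)"
  using unit_natural[OF assms(1,2)] unit_natural[OF assms(1,3)] assms(4) by simp

lemma unit_natural_zero:
  assumes "f \<in> hom C X Y" "x \<in> hom C T X" "\<eta> X \<cdot> x = zero_map T (\<beta> X)"
  shows "\<eta> Y \<cdot> (f \<cdot> x) = zero_map T (\<beta> Y)"
proof -
  have "T \<in> Obj C" using assms(2) by auto
  then show ?thesis using unit_natural[OF assms(1,2)] refl_arr[OF assms(1)] assms(3) by simp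
qed

text \<open>The main use of closure under quotients. Divide \<open>Y\<close> by the image of the kernel pair of \<open>\<eta> X\<close>. The result is
  also a quotient of the reflection of \<open>X\<close>, hence belongs to \<open>B\<close>, so the quotient map factors through \<open>\<eta> Y\<close> and
  identifies whatever \<open>\<eta> Y\<close> identifies.\<close>

lemma lift_unit_congruence:
  assumes q: "cover q X Y" and y: "y1 \<in> hom C T Y" "y2 \<in> hom C T Y" "\<eta> Y \<cdot> y1 = \<eta> Y \<cdot> y2"
  obtains S t x1 x2 where "cover t S T" "x1 \<in> hom C S X" "x2 \<in> hom C S X"
    "\<eta> X \<cdot> x1 = \<eta> X \<cdot> x2" "q \<cdot> x1 = y1 \<cdot> t" "q \<cdot> x2 = y2 \<cdot> t"
proof -
  have o: "X \<in> Obj C" "Y \<in> Obj C" using q by auto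
  have eX: "\<eta> X \<in> hom C X (\<beta> X)" using o by simp
  obtain W r where r: "cover r Y W"
    "\<And>T x1 x2. x1 \<in> hom C T X \<Longrightarrow> x2 \<in> hom C T X \<Longrightarrow> \<eta> X \<cdot> x1 = \<eta> X \<cdot> x2 \<Longrightarrow> r \<cdot> (q \<cdot> x1) = r \<cdot> (q \<cdot> x2)"
    "\<And>T y1 y2. y1 \<in> hom C T Y \<Longrightarrow> y2 \<in> hom C T Y \<Longrightarrow> r \<cdot> y1 = r \<cdot> y2 \<Longrightarrow>
       \<exists>S t x1 x2. cover t S T \<and> x1 \<in> hom C S X \<and> x2 \<in> hom C S X \<and> \<eta> X \<cdot> x1 = \<eta> X \<cdot> x2 \<and>
         q \<cdot> x1 = y1 \<cdot> t \<and> q \<cdot> x2 = y2 \<cdot> t"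
    by (rule quotient_by_image_relation[OF q eX], rule that)
  have rq: "r \<cdot> q \<in> hom C X W" using r(1) q by simp
  have eq: "(r \<cdot> q) \<cdot> a = (r \<cdot> q) \<cdot> b" if "a \<in> hom C S X" "b \<in> hom C S X" "\<eta> X \<cdot> a = \<eta> X \<cdot> b" for S a b
    using r(2)[OF that] that r(1) q by simp
  obtain w where w: "w \<in> hom C (\<beta> X) W" "w \<cdot> \<eta> X = r \<cdot> q"
    by (rule cover_factor[OF unit_cover[OF o(1)] rq]) (use eq that in \<open>blast+\<close>)
  have "cover w (\<beta> X) W"
    using cover_cancel[of w "\<eta> X" X W "\<beta> X"] cover_comp[OF q r(1)] w o by simp
  then have "W \<in> B" using B_quotient o by (metis unit_typing(4))
  then obtain g where g: "g \<in> hom C (\<beta> Y) W" "g \<cdot> \<eta> Y = r"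
    using unit_universal[of r Y W] r(1) by blast
  have "r \<cdot> y1 = r \<cdot> y2"
    using triangle_comp[OF g(2), of y1] triangle_comp[OF g(2), of y2] g y o by simp
  then show thesis using r(3)[OF y(1,2)] that by blast
qed

text \<open>The kernel of the unit preserves covers. Lifting the pair \<open>(y, 0)\<close> gives \<open>x1\<close> and \<open>x2\<close> with \<open>q \<cdot> x2 = 0\<close>;
  difunctionality produces the element \<open>x1 - x2\<close>, which lies over \<open>y\<close> and is killed by \<open>\<eta> X\<close>.\<close>

lemma lift_unit_kernel:
  assumes q: "cover q X Y" and y: "y \<in> hom C T Y" "\<eta> Y \<cdot> y = zero_map T (\<beta> Y)"
  obtains S t x where "cover t S T" "x \<in> hom C S X" "q \<cdot> x = y \<cdot> t" "\<eta> X \<cdot> x = zero_map S (\<beta> X)"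
proof -
  have o: "X \<in> Obj C" "Y \<in> Obj C" "T \<in> Obj C" using q y by auto
  have qh: "q \<in> hom C X Y" and eX: "\<eta> X \<in> hom C X (\<beta> X)" using q o by simp_all
  have z: "zero_map T Y \<in> hom C T Y" "\<eta> Y \<cdot> y = \<eta> Y \<cdot> zero_map T Y" using o y by simp_all
  obtain S t x1 x2 where t: "cover t S T" "x1 \<in> hom C S X" "x2 \<in> hom C S X"
    "\<eta> X \<cdot> x1 = \<eta> X \<cdot> x2" "q \<cdot> x1 = y \<cdot> t" "q \<cdot> x2 = zero_map T Y \<cdot> t"
    by (rule lift_unit_congruence[OF q y(1) z], rule that)
  have S: "S \<in> Obj C" using t by auto
  have 0: "zero_map S X \<in> hom C S X" "q \<cdot> x2 = q \<cdot> zero_map S X" using S o q t by simp_all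
  obtain S' t' d where d: "cover t' S' S" "d \<in> hom C S' X" "q \<cdot> d = q \<cdot> (x1 \<cdot> t')"
     "\<eta> X \<cdot> d = \<eta> X \<cdot> (zero_map S X \<cdot> t')"
    by (rule difunctional[OF qh eX t(2,3) 0(1) t(4) 0(2)], rule that)
  show thesis
  proof (rule that[OF cover_comp[OF d(1) t(1)] d(2)])
    show "q \<cdot> d = y \<cdot> (t \<cdot> t')" using d square_comp[OF t(5), of t'] t q y by simp
    have "S' \<in> Obj C" using d by auto
    then show "\<eta> X \<cdot> d = zero_map S' (\<beta> X)" using d S o by simp
  qed
qed

text \<open>In the language of kernels: no nonzero element of the kernel of \<open>q\<close> is killed by the unit.\<close>

definition separated :: "'m \<Rightarrow> bool" where
  "separated q \<longleftrightarrow> (\<forall>T x1 x2. x1 \<in> hom C T (Dom C q) \<and> x2 \<in> hom C T (Dom C q) \<and>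
     q \<cdot> x1 = q \<cdot> x2 \<and> \<eta> (Dom C q) \<cdot> x1 = \<eta> (Dom C q) \<cdot> x2 \<longrightarrow> x1 = x2)"

lemma separatedD:
  assumes "separated q" "q \<in> hom C X Y" "x1 \<in> hom C T X" "x2 \<in> hom C T X" "q \<cdot> x1 = q \<cdot> x2"
    "\<eta> X \<cdot> x1 = \<eta> X \<cdot> x2"
  shows "x1 = x2"
proof -
  have "Dom C q = X" using assms(2) by simp
  then show ?thesis using assms(1,3-6) unfolding separated_def by blast
qed

lemma separatedI:
  assumes "q \<in> hom C X Y" "\<And>T x1 x2. x1 \<in> hom C T X \<Longrightarrow> x2 \<in> hom C T X \<Longrightarrow> q \<cdot> x1 = q \<cdot> x2 \<Longrightarrow>
    \<eta> X \<cdot> x1 = \<eta> X \<cdot> x2 \<Longrightarrow> x1 = x2"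
  shows "separated q"
proof -
  have "Dom C q = X" using assms(1) by simp
  then show ?thesis using assms(2) unfolding separated_def by blast
qed

lemma trivial_separated:
  assumes "trivial_ext C B q" shows "separated q"
proof -
  define X Y where "X = Dom C q" and "Y = Cod C q"
  have q: "q \<in> hom C X Y" and o: "X \<in> Obj C"
    using assms regular_epi_arr unfolding trivial_ext_def X_def Y_def by auto
  have P: "is_pullback C (refl_arr C B q) (\<eta> Y) (\<eta> X) q"
    using assms unfolding trivial_ext_def X_def Y_def by blast
  show ?thesis
  proof (rule separatedI[OF q])
    fix T x1 x2 assume "x1 \<in> hom C T X" "x2 \<in> hom C T X" "q \<cdot> x1 = q \<cdot> x2" "\<eta> X \<cdot> x1 = \<eta> X \<cdot> x2"
    then show "x1 = x2" using pullback_mono[OF P, of x1 T x2] o by simp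
  qed
qed

text \<open>Uniqueness in the pullback property is the hypothesis. For existence, let \<open>a\<close> and \<open>y\<close> be compatible and choose
  locally \<open>x0\<close> above \<open>a\<close>. Then \<open>q \<cdot> x0\<close> and \<open>y\<close> have the same reflection, so they lift to a pair \<open>x1\<close>, \<open>x2\<close>
  identified by the unit, and \<open>x2 - x1 + x0\<close> lies above both \<open>y\<close> and \<open>a\<close>. By uniqueness the local solutions
  glue.\<close>

lemma separated_trivial:
  assumes q: "cover q X Y" and s: "separated q"
  shows "trivial_ext C B q"
proof -
  have o: "X \<in> Obj C" "Y \<in> Obj C" using q by auto
  have qh: "q \<in> hom C X Y" and eX: "\<eta> X \<in> hom C X (\<beta> X)" using q o by simp_all
  note ra = refl_arr[OF qh]
  have D: "Dom C q = X" "Cod C q = Y" "Dom C (refl_arr C B q) = \<beta> X" "Dom C (\<eta> Y) = Y" "Dom C (\<eta> X) = X"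
    using qh ra o by auto
  have uniq: "x1 = x2" if "x1 \<in> hom C T X" "x2 \<in> hom C T X" "\<eta> X \<cdot> x1 = \<eta> X \<cdot> x2" "q \<cdot> x1 = q \<cdot> x2" for T x1 x2
    using separatedD[OF s qh that(1,2,4,3)] .
  have ex: "\<exists>h. h \<in> hom C T X \<and> \<eta> X \<cdot> h = a \<and> q \<cdot> h = y"
    if a: "a \<in> hom C T (\<beta> X)" and y: "y \<in> hom C T Y" and ay: "refl_arr C B q \<cdot> a = \<eta> Y \<cdot> y" for T a y
  proof -
    obtain S t x0 where t: "cover t S T" "x0 \<in> hom C S X" "\<eta> X \<cdot> x0 = a \<cdot> t"
      by (rule local_lift[OF unit_cover[OF o(1)] a], rule that)
    have 1: "q \<cdot> x0 \<in> hom C S Y" "y \<cdot> t \<in> hom C S Y" using t q y by simp_all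
    have "\<eta> Y \<cdot> (q \<cdot> x0) = refl_arr C B q \<cdot> (a \<cdot> t)" using unit_natural[OF qh t(2)] t by simp
    also have "\<dots> = \<eta> Y \<cdot> (y \<cdot> t)" using square_comp[OF ay, of t] ra a y t o by simp
    finally have 2: "\<eta> Y \<cdot> (q \<cdot> x0) = \<eta> Y \<cdot> (y \<cdot> t)" .
    obtain S' t' x1 x2 where t': "cover t' S' S" "x1 \<in> hom C S' X" "x2 \<in> hom C S' X"
      "\<eta> X \<cdot> x1 = \<eta> X \<cdot> x2" "q \<cdot> x1 = (q \<cdot> x0) \<cdot> t'" "q \<cdot> x2 = (y \<cdot> t) \<cdot> t'"
      by (rule lift_unit_congruence[OF q 1 2], rule that)
    have 3: "x0 \<cdot> t' \<in> hom C S' X" "\<eta> X \<cdot> x2 = \<eta> X \<cdot> x1" "q \<cdot> x1 = q \<cdot> (x0 \<cdot> t')"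
      using t t' q by simp_all
    obtain S'' t'' d where d: "cover t'' S'' S'" "d \<in> hom C S'' X" "q \<cdot> d = q \<cdot> (x2 \<cdot> t'')"
       "\<eta> X \<cdot> d = \<eta> X \<cdot> ((x0 \<cdot> t') \<cdot> t'')"
      by (rule difunctional[OF qh eX t'(3,2) 3(1,2,3)], rule that)
    define tt where "tt = t \<cdot> (t' \<cdot> t'')"
    have tt: "cover tt S'' T" unfolding tt_def using cover_comp[OF cover_comp[OF d(1) t'(1)] t(1)] by simp
    have d1: "\<eta> X \<cdot> d = a \<cdot> tt" "q \<cdot> d = y \<cdot> tt"
      using d square_comp[OF t(3), of "t' \<cdot> t''"] square_comp[OF t'(6), of t''] t t' a y q o unfolding tt_def by simp_all
    obtain W l r where W: "is_product C (\<beta> X) Y W l r"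
      by (rule product_exists[OF unit_typing(5)[OF o(1)] o(2)], rule that)
    note lr = product_typing[OF W]
    obtain m where m: "m \<in> hom C X W" "l \<cdot> m = \<eta> X" "r \<cdot> m = q" by (rule product_lift[OF W eX qh], rule that)
    obtain w where w: "w \<in> hom C T W" "l \<cdot> w = a" "r \<cdot> w = y" by (rule product_lift[OF W a y], rule that)
    have proj: "l \<cdot> (m \<cdot> x) = \<eta> X \<cdot> x" "r \<cdot> (m \<cdot> x) = q \<cdot> x" if "x \<in> hom C T' X" for x T'
      using triangle_comp[OF m(2), of x] triangle_comp[OF m(3), of x] that m lr by simp_all
    have mono: "monic C m"
      unfolding monic_def
    proof (intro conjI allI ballI impI)
      fix T' g h assume gh: "g \<in> hom C T' (Dom C m)" "h \<in> hom C T' (Dom C m)" "m \<cdot> g = m \<cdot> h"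
      then have "g \<in> hom C T' X" "h \<in> hom C T' X" using m by auto
      then show "g = h" using uniq[of g T' h] proj[of g T'] proj[of h T'] gh(3) by simp
    qed (use m in simp)
    have md: "m \<cdot> d = w \<cdot> tt"
      by (rule product_mono[OF W, of _ S''])
        (use proj[OF d(2)] d1 d tt m w lr triangle_comp[OF w(2), of tt] triangle_comp[OF w(3), of tt] in simp_all)
    obtain h where h: "h \<in> hom C T X" "m \<cdot> h = w"
      by (rule cover_descent[OF tt mono m(1) w(1) d(2) md], rule that)
    then show ?thesis using proj[OF h(1)] w by auto
  qed
  have "is_pullback C (refl_arr C B q) (\<eta> Y) (\<eta> X) q"
    unfolding is_pullback_def D
  proof (intro conjI allI ballI impI)
    fix T a y assume "a \<in> hom C T (\<beta> X)" "y \<in> hom C T Y" "refl_arr C B q \<cdot> a = \<eta> Y \<cdot> y"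
    then show "\<exists>!h. h \<in> hom C T X \<and> \<eta> X \<cdot> h = a \<and> q \<cdot> h = y"
      using ex[of a T y] uniq[of _ T] by (intro ex_ex1I) (blast, metis)
  qed (use ra(1) o qh in simp_all, rule ra(2))
  then show ?thesis unfolding trivial_ext_def using q D by simp
qed

end

section \<open>Central extensions and perfect objects\<close>

context birkhoff_cat begin

lemma centralE:
  assumes "central_ext C B f" "f \<in> hom C X Y"
  obtains G g P p q where "cover f X Y" "cover g G Y" "is_pullback C f g p q" "cover p P X" "cover q P G"
    "f \<cdot> p = g \<cdot> q" "separated q"
proof -
  obtain g p q where g: "regular_epi C f" "regular_epi C g" "is_pullback C f g p q" "trivial_ext C B q"
    using assms(1) unfolding central_ext_def by blast
  note F = pullback_facts[OF g(3) assms(2)]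
  have "regular_epi C q" using g(4) unfolding trivial_ext_def by blast
  moreover have "regular_epi C p" using pullback_cover[OF pullback_swap[OF g(3)] g(2)] .
  ultimately show ?thesis
    using that[of g "Dom C g" p q "Dom C p"] g F assms(2) trivial_separated[OF g(4)] by simp
qed

lemma centralI:
  assumes "cover f X Y" "cover g G Y" "is_pullback C f g p q" "separated q"
  shows "central_ext C B f"
proof -
  have f: "f \<in> hom C X Y" using assms by simp
  note F = pullback_facts[OF assms(3) f]
  have "Dom C g = G" using assms(2) by simp
  then have "cover q (Dom C p) G" using F pullback_cover[OF assms(3)] assms(1) by simp
  then have "trivial_ext C B q" using separated_trivial assms(4) by blast
  then show ?thesis using assms unfolding central_ext_def by blast
qed

lemma central_cover: "central_ext C B f \<Longrightarrow> f \<in> hom C X Y \<Longrightarrow> cover f X Y"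
  unfolding central_ext_def by simp

text \<open>If \<open>f\<close> becomes trivial along \<open>g\<close>, then its pullback along \<open>h\<close> becomes trivial along the pullback of
  \<open>g\<close> along \<open>h\<close>: two elements identified there have images in the trivial extension that are identified as well.\<close>

lemma central_pullback:
  assumes c: "central_ext C B f" and f: "f \<in> hom C X Y" and P: "is_pullback C f h p q"
  shows "central_ext C B q"
proof -
  define P0 Z where "P0 = Dom C p" and "Z = Dom C h"
  note F = pullback_facts[OF P f]
  have p: "p \<in> hom C P0 X" and q: "q \<in> hom C P0 Z" and h: "h \<in> hom C Z Y"
    using F unfolding P0_def Z_def by simp_all
  obtain G g P1 p1 q1 where g: "cover f X Y" "cover g G Y" "is_pullback C f g p1 q1" "cover p1 P1 X" "cover q1 P1 G"
    "f \<cdot> p1 = g \<cdot> q1" "separated q1"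
    by (rule centralE[OF c f], rule that)
  have gh: "g \<in> hom C G Y" and p1: "p1 \<in> hom C P1 X" "q1 \<in> hom C P1 G" using g by simp_all
  have cq: "cover q P0 Z" using pullback_cover[OF P] g(1) q by simp
  obtain H a g' where H: "is_pullback C g h a g'" "a \<in> hom C H G" "g' \<in> hom C H Z" "g \<cdot> a = h \<cdot> g'"
    by (rule pullback_exists[OF gh h], rule that)
  have cg': "cover g' H Z" using pullback_cover[OF H(1)] g(2) H by simp
  obtain P2 p2 q2 where P2: "is_pullback C q g' p2 q2" "p2 \<in> hom C P2 P0" "q2 \<in> hom C P2 H" "q \<cdot> p2 = g' \<cdot> q2"
    by (rule pullback_exists[OF q H(3)], rule that)
  have 1: "p \<cdot> p2 \<in> hom C P2 X" "a \<cdot> q2 \<in> hom C P2 G" using p P2 H by simp_all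
  have "f \<cdot> (p \<cdot> p2) = h \<cdot> (q \<cdot> p2)" using square_comp[OF F(5), of p2] p q f h P2 by simp
  also have "\<dots> = g \<cdot> (a \<cdot> q2)" using P2 square_comp[OF H(4), of q2] H gh h by simp
  finally have 2: "f \<cdot> (p \<cdot> p2) = g \<cdot> (a \<cdot> q2)" .
  obtain \<phi> where \<phi>: "\<phi> \<in> hom C P2 (Dom C p1)" "p1 \<cdot> \<phi> = p \<cdot> p2" "q1 \<cdot> \<phi> = a \<cdot> q2"
    by (rule pullback_lift[OF g(3) f gh 1 2], rule that)
  have \<phi>h: "\<phi> \<in> hom C P2 P1" using \<phi> p1 by simp
  have "separated q2"
  proof (rule separatedI[OF P2(3)])
    fix T z1 z2 assume z: "z1 \<in> hom C T P2" "z2 \<in> hom C T P2" "q2 \<cdot> z1 = q2 \<cdot> z2" "\<eta> P2 \<cdot> z1 = \<eta> P2 \<cdot> z2"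
    have e: "\<eta> P1 \<cdot> (\<phi> \<cdot> z1) = \<eta> P1 \<cdot> (\<phi> \<cdot> z2)" by (rule unit_natural_eq[OF \<phi>h z(1,2,4)])
    have s: "q1 \<cdot> (\<phi> \<cdot> z1) = q1 \<cdot> (\<phi> \<cdot> z2)"
      using square_comp[OF \<phi>(3), of z1] square_comp[OF \<phi>(3), of z2] \<phi>h z p1 P2 H by simp
    have t: "\<phi> \<cdot> z1 \<in> hom C T P1" "\<phi> \<cdot> z2 \<in> hom C T P1" using \<phi>h z by simp_all
    have "\<phi> \<cdot> z1 = \<phi> \<cdot> z2" by (rule separatedD[OF g(7) p1(2) t s e])
    then have pp: "p \<cdot> (p2 \<cdot> z1) = p \<cdot> (p2 \<cdot> z2)"
      using square_comp[OF \<phi>(2), of z1] square_comp[OF \<phi>(2), of z2] \<phi>h z p1 P2 p by simp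
    have qq: "q \<cdot> (p2 \<cdot> z1) = q \<cdot> (p2 \<cdot> z2)"
      using square_comp[OF P2(4), of z1] square_comp[OF P2(4), of z2] z P2 q H by simp
    have "p2 \<cdot> z1 = p2 \<cdot> z2"
      using pullback_mono[OF P, of "p2 \<cdot> z1" T "p2 \<cdot> z2"] pp qq p P2 z by simp
    then show "z1 = z2" using pullback_mono[OF P2(1), of z1 T z2] z P2 by simp
  qed
  then show ?thesis by (rule centralI[OF cq cg' P2(1)])
qed

text \<open>Let \<open>q : P \<rightarrow> G\<close> be a trivial pullback of \<open>f\<close>, with the section \<open>s'\<close> induced by \<open>s\<close>. Elements \<open>x1\<close>, \<open>x2\<close>
  identified by \<open>f\<close> and the unit lift to \<open>z1\<close>, \<open>z2\<close> identified by the unit of \<open>P\<close>, but \<open>q\<close> need not identify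
  them. The section corrects this inside the kernel pair of the unit: the pair
  \<open>(s' q z1, s' q z1) - (s' q z1, s' q z2) + (z1, z2)\<close> still lies over \<open>(x1, x2)\<close> and is identified by \<open>q\<close>, so
  its two entries are equal by triviality.\<close>

lemma split_central_separated:
  assumes c: "central_ext C B f" and f: "f \<in> hom C X Y" and s: "s \<in> hom C Y X" "f \<cdot> s = Idn C Y"
  shows "separated f"
proof (rule separatedI[OF f])
  fix T x1 x2 assume x: "x1 \<in> hom C T X" "x2 \<in> hom C T X" and fx: "f \<cdot> x1 = f \<cdot> x2"
    and ex: "\<eta> X \<cdot> x1 = \<eta> X \<cdot> x2"
  have o: "X \<in> Obj C" "Y \<in> Obj C" "T \<in> Obj C" using f x by auto
  obtain G g P p q where g: "cover f X Y" "cover g G Y" "is_pullback C f g p q" "cover p P X" "cover q P G"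
    "f \<cdot> p = g \<cdot> q" "separated q"
    by (rule centralE[OF c f], rule that)
  have gh: "g \<in> hom C G Y" and p: "p \<in> hom C P X" and q: "q \<in> hom C P G" using g by simp_all
  have oG: "G \<in> Obj C" "P \<in> Obj C" using q by auto
  have eP: "\<eta> P \<in> hom C P (\<beta> P)" using oG by simp
  have 1: "s \<cdot> g \<in> hom C G X" "Idn C G \<in> hom C G G" "f \<cdot> (s \<cdot> g) = g \<cdot> Idn C G"
    using triangle_comp[OF s(2), of g] s gh oG f by simp_all
  obtain s' where s': "s' \<in> hom C G (Dom C p)" "p \<cdot> s' = s \<cdot> g" "q \<cdot> s' = Idn C G"
    by (rule pullback_lift[OF g(3) f gh 1], rule that)
  have s'h: "s' \<in> hom C G P" using s' p by simp
  obtain S t z1 z2 where t: "cover t S T" "z1 \<in> hom C S P" "z2 \<in> hom C S P"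
    "\<eta> P \<cdot> z1 = \<eta> P \<cdot> z2" "p \<cdot> z1 = x1 \<cdot> t" "p \<cdot> z2 = x2 \<cdot> t"
    by (rule lift_unit_congruence[OF g(4) x ex], rule that)
  obtain E d1 d2 where E: "is_pullback C (\<eta> P) (\<eta> P) d1 d2" "d1 \<in> hom C E P" "d2 \<in> hom C E P"
      "\<eta> P \<cdot> d1 = \<eta> P \<cdot> d2"
    by (rule pullback_exists[OF eP eP], rule that)
  obtain GG l r where GG: "is_product C G G GG l r" by (rule product_exists[OF oG(1,1)], rule that)
  obtain XX l' r' where XX: "is_product C X X XX l' r'" by (rule product_exists[OF o(1,1)], rule that)
  note lr = product_typing[OF GG] note lr' = product_typing[OF XX]
  have qd: "q \<cdot> d1 \<in> hom C E G" "q \<cdot> d2 \<in> hom C E G" "p \<cdot> d1 \<in> hom C E X" "p \<cdot> d2 \<in> hom C E X"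
    using p q E by simp_all
  obtain u where u: "u \<in> hom C E GG" "l \<cdot> u = q \<cdot> d1" "r \<cdot> u = q \<cdot> d2" by (rule product_lift[OF GG qd(1,2)], rule that)
  obtain v where v: "v \<in> hom C E XX" "l' \<cdot> v = p \<cdot> d1" "r' \<cdot> v = p \<cdot> d2" by (rule product_lift[OF XX qd(3,4)], rule that)
  \<comment> \<open>The span to which difunctionality is applied: elements of \<open>E\<close> are pairs in \<open>P\<close> identified by the unit,
    sent to their images in \<open>G \<times> G\<close> and in \<open>X \<times> X\<close>.\<close>
  have u_eq: "u \<cdot> a = u \<cdot> b \<longleftrightarrow> q \<cdot> (d1 \<cdot> a) = q \<cdot> (d1 \<cdot> b) \<and> q \<cdot> (d2 \<cdot> a) = q \<cdot> (d2 \<cdot> b)"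
    if ab: "a \<in> hom C S' E" "b \<in> hom C S' E" for a b S'
  proof -
    have 3: "l \<cdot> (u \<cdot> a) = q \<cdot> (d1 \<cdot> a)" "r \<cdot> (u \<cdot> a) = q \<cdot> (d2 \<cdot> a)"
       "l \<cdot> (u \<cdot> b) = q \<cdot> (d1 \<cdot> b)" "r \<cdot> (u \<cdot> b) = q \<cdot> (d2 \<cdot> b)"
      using square_comp[OF u(2), of a] square_comp[OF u(3), of a] square_comp[OF u(2), of b] square_comp[OF u(3), of b]
        ab u lr q E by simp_all
    have "u \<cdot> a \<in> hom C S' GG" "u \<cdot> b \<in> hom C S' GG" using ab u by simp_all
    from product_mono[OF GG this] show ?thesis using 3 by metis
  qed
  have v_eq: "v \<cdot> a = v \<cdot> b \<longleftrightarrow> p \<cdot> (d1 \<cdot> a) = p \<cdot> (d1 \<cdot> b) \<and> p \<cdot> (d2 \<cdot> a) = p \<cdot> (d2 \<cdot> b)"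
    if ab: "a \<in> hom C S' E" "b \<in> hom C S' E" for a b S'
  proof -
    have 3: "l' \<cdot> (v \<cdot> a) = p \<cdot> (d1 \<cdot> a)" "r' \<cdot> (v \<cdot> a) = p \<cdot> (d2 \<cdot> a)"
       "l' \<cdot> (v \<cdot> b) = p \<cdot> (d1 \<cdot> b)" "r' \<cdot> (v \<cdot> b) = p \<cdot> (d2 \<cdot> b)"
      using square_comp[OF v(2), of a] square_comp[OF v(3), of a] square_comp[OF v(2), of b] square_comp[OF v(3), of b]
        ab v lr' p E by simp_all
    have "v \<cdot> a \<in> hom C S' XX" "v \<cdot> b \<in> hom C S' XX" using ab v by simp_all
    from product_mono[OF XX this] show ?thesis using 3 by metis
  qed
  have sq: "s' \<cdot> (q \<cdot> z1) \<in> hom C S P" "s' \<cdot> (q \<cdot> z2) \<in> hom C S P" using s'h q t by simp_all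
  have "s' \<cdot> q \<in> hom C P P" using s'h q by simp
  from unit_natural_eq[OF this t(2,3,4)]
  have sqe: "\<eta> P \<cdot> (s' \<cdot> (q \<cdot> z1)) = \<eta> P \<cdot> (s' \<cdot> (q \<cdot> z2))" using s'h q t by simp
  obtain e0 where e0: "e0 \<in> hom C S (Dom C d1)" "d1 \<cdot> e0 = z1" "d2 \<cdot> e0 = z2"
    by (rule pullback_lift[OF E(1) eP eP t(2,3,4)], rule that)
  obtain b where b: "b \<in> hom C S (Dom C d1)" "d1 \<cdot> b = s' \<cdot> (q \<cdot> z1)" "d2 \<cdot> b = s' \<cdot> (q \<cdot> z2)"
    by (rule pullback_lift[OF E(1) eP eP sq sqe], rule that)
  obtain c where c: "c \<in> hom C S (Dom C d1)" "d1 \<cdot> c = s' \<cdot> (q \<cdot> z1)" "d2 \<cdot> c = s' \<cdot> (q \<cdot> z1)"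
    by (rule pullback_lift[OF E(1) eP eP sq(1) sq(1) HOL.refl], rule that)
  have h: "e0 \<in> hom C S E" "b \<in> hom C S E" "c \<in> hom C S E" using e0 b c E by simp_all
  have qs: "q \<cdot> (s' \<cdot> w) = w" "p \<cdot> (s' \<cdot> w) = s \<cdot> (g \<cdot> w)" if "w \<in> hom C S G" for w
    using triangle_comp[OF s'(3), of w] square_comp[OF s'(2), of w] that s'h q p s gh by simp_all
  have gq: "g \<cdot> (q \<cdot> z1) = f \<cdot> (x1 \<cdot> t)" "g \<cdot> (q \<cdot> z2) = f \<cdot> (x2 \<cdot> t)"
    using square_comp[OF g(6), of z1] square_comp[OF g(6), of z2] t f p gh q by simp_all
  have fxt: "f \<cdot> (x1 \<cdot> t) = f \<cdot> (x2 \<cdot> t)" using square_comp[OF fx, of t] f x t by simp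
  have qz: "q \<cdot> z1 \<in> hom C S G" "q \<cdot> z2 \<in> hom C S G" using q t by simp_all
  have a1: "v \<cdot> c = v \<cdot> b" using v_eq[OF h(3,2)] b c qs(2) qz gq fxt by simp
  have a2: "u \<cdot> b = u \<cdot> e0" using u_eq[OF h(2,1)] b e0 qs(1) qz by simp
  obtain S' t' d where d: "cover t' S' S" "d \<in> hom C S' E" "u \<cdot> d = u \<cdot> (c \<cdot> t')" "v \<cdot> d = v \<cdot> (e0 \<cdot> t')"
    by (rule difunctional[OF u(1) v(1) h(3,2,1) a1 a2], rule that)
  have ct: "c \<cdot> t' \<in> hom C S' E" "e0 \<cdot> t' \<in> hom C S' E" using h d by simp_all
  have "d1 \<cdot> (c \<cdot> t') = d2 \<cdot> (c \<cdot> t')"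
    using triangle_comp[OF c(2), of t'] triangle_comp[OF c(3), of t'] c h d E by simp
  then have m1: "q \<cdot> (d1 \<cdot> d) = q \<cdot> (d2 \<cdot> d)" using u_eq[OF d(2) ct(1)] d(3) by simp
  have m2: "\<eta> P \<cdot> (d1 \<cdot> d) = \<eta> P \<cdot> (d2 \<cdot> d)" by (rule square_comp[OF E(4)]) (use E(2,3) d(2) oG in simp_all)
  have dd: "d1 \<cdot> d \<in> hom C S' P" "d2 \<cdot> d \<in> hom C S' P" using E d by simp_all
  have "d1 \<cdot> d = d2 \<cdot> d" by (rule separatedD[OF g(7) q dd m1 m2])
  then have "p \<cdot> (d1 \<cdot> (e0 \<cdot> t')) = p \<cdot> (d2 \<cdot> (e0 \<cdot> t'))" using v_eq[OF d(2) ct(2)] d(4) by metis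
  then have "p \<cdot> (z1 \<cdot> t') = p \<cdot> (z2 \<cdot> t')"
    using triangle_comp[OF e0(2), of t'] triangle_comp[OF e0(3), of t'] h d E by simp
  then have "(x1 \<cdot> t) \<cdot> t' = (x2 \<cdot> t) \<cdot> t'"
    using square_comp[OF t(5), of t'] square_comp[OF t(6), of t'] t d p x by simp
  then have "x1 \<cdot> t = x2 \<cdot> t" using cover_epi[OF d(1), of "x1 \<cdot> t" X "x2 \<cdot> t"] t x by simp
  then show "x1 = x2" using cover_epi[OF t(1) x] by simp
qed

lemma central_subextension:
  assumes c: "central_ext C B f" and f: "f \<in> hom C X Y" and m: "monic C m" "m \<in> hom C N X"
    and fm: "cover (f \<cdot> m) N Y"
  shows "central_ext C B (f \<cdot> m)"
proof -
  obtain G g P p q where g: "cover f X Y" "cover g G Y" "is_pullback C f g p q" "cover p P X" "cover q P G"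
    "f \<cdot> p = g \<cdot> q" "separated q"
    by (rule centralE[OF c f], rule that)
  have gh: "g \<in> hom C G Y" and p: "p \<in> hom C P X" and q: "q \<in> hom C P G" using g by simp_all
  have fmh: "f \<cdot> m \<in> hom C N Y" using f m by simp
  obtain P' p' q' where P': "is_pullback C (f \<cdot> m) g p' q'" "p' \<in> hom C P' N" "q' \<in> hom C P' G" "(f \<cdot> m) \<cdot> p' = g \<cdot> q'"
    by (rule pullback_exists[OF fmh gh], rule that)
  have 1: "m \<cdot> p' \<in> hom C P' X" "f \<cdot> (m \<cdot> p') = g \<cdot> q'" using m P' f by simp_all
  obtain \<phi> where \<phi>: "\<phi> \<in> hom C P' (Dom C p)" "p \<cdot> \<phi> = m \<cdot> p'" "q \<cdot> \<phi> = q'"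
    by (rule pullback_lift[OF g(3) f gh 1(1) P'(3) 1(2)], rule that)
  have \<phi>h: "\<phi> \<in> hom C P' P" using \<phi> p by simp
  have "separated q'"
  proof (rule separatedI[OF P'(3)])
    fix T z1 z2 assume z: "z1 \<in> hom C T P'" "z2 \<in> hom C T P'" "q' \<cdot> z1 = q' \<cdot> z2" "\<eta> P' \<cdot> z1 = \<eta> P' \<cdot> z2"
    have e: "\<eta> P \<cdot> (\<phi> \<cdot> z1) = \<eta> P \<cdot> (\<phi> \<cdot> z2)" by (rule unit_natural_eq[OF \<phi>h z(1,2,4)])
    have s: "q \<cdot> (\<phi> \<cdot> z1) = q \<cdot> (\<phi> \<cdot> z2)"
      using triangle_comp[OF \<phi>(3), of z1] triangle_comp[OF \<phi>(3), of z2] \<phi>h z q by simp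
    have t: "\<phi> \<cdot> z1 \<in> hom C T P" "\<phi> \<cdot> z2 \<in> hom C T P" using \<phi>h z by simp_all
    have "\<phi> \<cdot> z1 = \<phi> \<cdot> z2" by (rule separatedD[OF g(7) q t s e])
    then have "m \<cdot> (p' \<cdot> z1) = m \<cdot> (p' \<cdot> z2)"
      using square_comp[OF \<phi>(2), of z1] square_comp[OF \<phi>(2), of z2] \<phi>h z p P' m by simp
    then have "p' \<cdot> z1 = p' \<cdot> z2" using mono_cancel[OF m, of "p' \<cdot> z1" T "p' \<cdot> z2"] P' z by simp
    then show "z1 = z2" using pullback_mono[OF P'(1), of z1 T z2] z P' by simp
  qed
  then show ?thesis by (rule centralI[OF fm g(2) P'(1)])
qed

text \<open>The unit is epic, so its codomain is zero as soon as the unit itself is zero.\<close>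

lemma perfect_iff:
  "perfect C B X \<longleftrightarrow> X \<in> Obj C \<and> \<eta> X = zero_map X (\<beta> X)"
proof (cases "X \<in> Obj C")
  case X: True
  show ?thesis
  proof
    assume p: "perfect C B X"
    then have i: "Idn C (\<beta> X) = zero_map (\<beta> X) (\<beta> X)"
      using zero_object_idn unfolding perfect_def by blast
    have "\<eta> X = Idn C (\<beta> X) \<cdot> \<eta> X" using X by simp
    then show "X \<in> Obj C \<and> \<eta> X = zero_map X (\<beta> X)" using i X by simp
  next
    assume e: "X \<in> Obj C \<and> \<eta> X = zero_map X (\<beta> X)"
    have "Idn C (\<beta> X) = zero_map (\<beta> X) (\<beta> X)"
      using cover_epi[OF unit_cover[OF X], of "Idn C (\<beta> X)" "\<beta> X" "zero_map (\<beta> X) (\<beta> X)"] e X by simp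
    then show "perfect C B X" using X is_zero_iff[of "\<beta> X"] unfolding perfect_def by simp
  qed
qed (simp add: perfect_def)

lemma perfect_quotient:
  assumes f: "cover f X Y" and X: "perfect C B X"
  shows "perfect C B Y"
proof -
  have fh: "f \<in> hom C X Y" and o: "X \<in> Obj C" "Y \<in> Obj C" using f by auto
  have "\<eta> Y \<cdot> f = zero_map Y (\<beta> Y) \<cdot> f"
    using refl_arr[OF fh] X o f unfolding perfect_iff by simp
  then have "\<eta> Y = zero_map Y (\<beta> Y)" using cover_epi[OF f, of "\<eta> Y" "\<beta> Y" "zero_map Y (\<beta> Y)"] o by simp
  then show ?thesis using o unfolding perfect_iff by simp
qed

lemma perfect_element:
  assumes "perfect C B X" "x \<in> hom C T X"
  shows "\<eta> X \<cdot> x = zero_map T (\<beta> X)"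
proof -
  have "X \<in> Obj C" "\<eta> X = zero_map X (\<beta> X)" using assms(1) unfolding perfect_iff by simp_all
  then show ?thesis using assms(2) by simp
qed

end

section \<open>Weakly universal central extensions\<close>

context birkhoff_cat begin

lemma perfect_lift:
  assumes "cover q X Y" "perfect C B Y" "y \<in> hom C T Y"
  obtains S t x where "cover t S T" "x \<in> hom C S X" "q \<cdot> x = y \<cdot> t" "\<eta> X \<cdot> x = zero_map S (\<beta> X)"
  by (rule lift_unit_kernel[OF assms(1,3) perfect_element[OF assms(2,3)]], rule that)

text \<open>Pull \<open>f\<close> back along \<open>u\<close> to \<open>q : T \<rightarrow> U\<close>, which is split by \<open>\<sigma> = (b, 1)\<close> and hence trivial. As \<open>X\<close> is
  perfect, its generic element lifts to an element \<open>z\<close> of \<open>T\<close> killed by the unit. As \<open>U\<close> is perfect, \<open>\<sigma> \<cdot> (q \<cdot> z)\<close>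
  is killed too, so \<open>z = \<sigma> \<cdot> (q \<cdot> z)\<close> by triviality, and the generic element lies in the image of \<open>b\<close>.\<close>

lemma comparison_cover:
  assumes u: "cover u U A" and pU: "perfect C B U"
    and f: "f \<in> hom C X A" "central_ext C B f" and pX: "perfect C B X"
    and b: "b \<in> hom C U X" "f \<cdot> b = u"
  shows "cover b U X"
proof -
  have uh: "u \<in> hom C U A" and o: "U \<in> Obj C" "X \<in> Obj C" using u f by auto
  obtain T p q where T: "is_pullback C f u p q" "p \<in> hom C T X" "q \<in> hom C T U" "f \<cdot> p = u \<cdot> q"
    by (rule pullback_exists[OF f(1) uh], rule that)
  have 1: "Idn C U \<in> hom C U U" "f \<cdot> b = u \<cdot> Idn C U" using b u o by simp_all
  obtain \<sigma> where \<sigma>: "\<sigma> \<in> hom C U (Dom C p)" "p \<cdot> \<sigma> = b" "q \<cdot> \<sigma> = Idn C U"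
    by (rule pullback_lift[OF T(1) f(1) uh b(1) 1], rule that)
  have \<sigma>h: "\<sigma> \<in> hom C U T" using \<sigma> T by simp
  have s: "separated q" by (rule split_central_separated[OF central_pullback[OF f(2,1) T(1)] T(3) \<sigma>h \<sigma>(3)])
  have p: "cover p T X" using pullback_cover[OF pullback_swap[OF T(1)]] u T by simp
  have iX: "Idn C X \<in> hom C X X" using o by simp
  obtain S t z where t: "cover t S X" "z \<in> hom C S T" "p \<cdot> z = Idn C X \<cdot> t" "\<eta> T \<cdot> z = zero_map S (\<beta> T)"
    by (rule perfect_lift[OF p pX iX], rule that)
  have qz: "q \<cdot> z \<in> hom C S U" using T t by simp
  have 2: "\<eta> T \<cdot> (\<sigma> \<cdot> (q \<cdot> z)) = zero_map S (\<beta> T)"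
    by (rule unit_natural_zero[OF \<sigma>h qz perfect_element[OF pU qz]])
  have 3: "q \<cdot> (\<sigma> \<cdot> (q \<cdot> z)) = q \<cdot> z" using triangle_comp[OF \<sigma>(3), of "q \<cdot> z"] \<sigma>h qz T by simp
  have "\<sigma> \<cdot> (q \<cdot> z) = z"
    by (rule separatedD[OF s T(3) _ t(2) 3]) (use 2 t(4) \<sigma>h qz in simp_all)
  then have "t = p \<cdot> (\<sigma> \<cdot> (q \<cdot> z))" using t by simp
  also have "\<dots> = b \<cdot> (q \<cdot> z)" using triangle_comp[OF \<sigma>(2), of "q \<cdot> z"] \<sigma>h qz T by simp
  finally have "cover (b \<cdot> (q \<cdot> z)) S X" using t(1) by simp
  then show ?thesis by (rule cover_cancel[OF _ b(1) qz])
qed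

text \<open>Centrality of \<open>f \<cdot> g\<close> is tested by pulling back along \<open>u\<close>, to \<open>qV : V \<rightarrow> U\<close>. The object \<open>V\<close> is covered by
  \<open>M\<close>, the pullback of \<open>u\<close> along \<open>T \<rightarrow> U \<rightarrow> A\<close>. Two elements of \<open>V\<close> identified by \<open>qV\<close> and the unit lift to \<open>M\<close>;
  triviality of the kernel pair projection of \<open>u\<close> identifies their components in \<open>U\<close>, and then triviality of
  \<open>T \<rightarrow> U\<close> identifies their components in \<open>T\<close>.\<close>

lemma central_composite:
  assumes u: "u \<in> hom C U A" "central_ext C B u" and pU: "perfect C B U" "projective_wrt_central C B U"
    and f: "f \<in> hom C X A" "central_ext C B f" and pX: "perfect C B X"
    and g: "g \<in> hom C Y X" "central_ext C B g"
  shows "central_ext C B (f \<cdot> g)"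
proof -
  have o: "U \<in> Obj C" "X \<in> Obj C" "Y \<in> Obj C" "A \<in> Obj C" using u f g by auto
  note uc = central_cover[OF u(2,1)] and fc = central_cover[OF f(2,1)] and gc = central_cover[OF g(2,1)]
  have lift: "\<exists>k. k \<in> hom C U M \<and> h \<cdot> k = l"
    if "h \<in> hom C M N" "central_ext C B h" "l \<in> hom C U N" for h M N l
  proof -
    have "Dom C h = M" "Cod C h = N" using that by auto
    then show ?thesis using pU(2) that(2,3) unfolding projective_wrt_central_def by blast
  qed
  obtain b where b: "b \<in> hom C U X" "f \<cdot> b = u" using lift[OF f u(1)] by blast
  obtain c where c: "c \<in> hom C U Y" "g \<cdot> c = b" using lift[OF g b(1)] by blast
  have bc: "cover b U X" by (rule comparison_cover[OF uc pU(1) f pX b])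
  obtain T p q where T: "is_pullback C g b p q" "p \<in> hom C T Y" "q \<in> hom C T U" "g \<cdot> p = b \<cdot> q"
    by (rule pullback_exists[OF g(1) b(1)], rule that)
  have 1: "Idn C U \<in> hom C U U" "g \<cdot> c = b \<cdot> Idn C U" using b c o by simp_all
  obtain \<sigma> where \<sigma>: "\<sigma> \<in> hom C U (Dom C p)" "p \<cdot> \<sigma> = c" "q \<cdot> \<sigma> = Idn C U"
    by (rule pullback_lift[OF T(1) g(1) b(1) c(1) 1], rule that)
  have \<sigma>h: "\<sigma> \<in> hom C U T" using \<sigma> T by simp
  have sq: "separated q" by (rule split_central_separated[OF central_pullback[OF g(2,1) T(1)] T(3) \<sigma>h \<sigma>(3)])
  have pc: "cover p T Y" using pullback_cover[OF pullback_swap[OF T(1)]] bc T by simp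
  obtain K k1 k2 where K: "is_pullback C u u k1 k2" "k1 \<in> hom C K U" "k2 \<in> hom C K U" "u \<cdot> k1 = u \<cdot> k2"
    by (rule pullback_exists[OF u(1) u(1)], rule that)
  obtain \<delta> where \<delta>: "\<delta> \<in> hom C U (Dom C k1)" "k1 \<cdot> \<delta> = Idn C U" "k2 \<cdot> \<delta> = Idn C U"
    by (rule pullback_lift[OF K(1) u(1) u(1) 1(1) 1(1) HOL.refl], rule that)
  have \<delta>h: "\<delta> \<in> hom C U K" using \<delta> K by simp
  have sk: "separated k2" by (rule split_central_separated[OF central_pullback[OF u(2,1) K(1)] K(3) \<delta>h \<delta>(3)])
  have fg: "f \<cdot> g \<in> hom C Y A" using f g by simp
  have fgc: "cover (f \<cdot> g) Y A" by (rule cover_comp[OF gc fc])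
  have fb: "f \<cdot> (b \<cdot> x) = u \<cdot> x" if "x \<in> hom C S U" for S x
    using triangle_comp[OF b(2), of x] b f that by simp
  have gp: "g \<cdot> (p \<cdot> x) = b \<cdot> (q \<cdot> x)" if "x \<in> hom C S T" for S x
    using square_comp[OF T(4), of x] T b g that by simp
  obtain V pV qV where V: "is_pullback C (f \<cdot> g) u pV qV" "pV \<in> hom C V Y" "qV \<in> hom C V U"
      "(f \<cdot> g) \<cdot> pV = u \<cdot> qV"
    by (rule pullback_exists[OF fg u(1)], rule that)
  have uq: "u \<cdot> q \<in> hom C T A" using u T by simp
  obtain M m1 m2 where M: "is_pullback C u (u \<cdot> q) m1 m2" "m1 \<in> hom C M U" "m2 \<in> hom C M T"
      "u \<cdot> m1 = (u \<cdot> q) \<cdot> m2"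
    by (rule pullback_exists[OF u(1) uq], rule that)
  have 2: "p \<cdot> m2 \<in> hom C M Y" "(f \<cdot> g) \<cdot> (p \<cdot> m2) = u \<cdot> m1"
  proof -
    show "p \<cdot> m2 \<in> hom C M Y" using T M by simp
    have "(f \<cdot> g) \<cdot> (p \<cdot> m2) = f \<cdot> (b \<cdot> (q \<cdot> m2))" using gp[OF M(3)] f g T M by simp
    also have "\<dots> = u \<cdot> m1" using fb[of "q \<cdot> m2" M] M T u by simp
    finally show "(f \<cdot> g) \<cdot> (p \<cdot> m2) = u \<cdot> m1" .
  qed
  obtain \<psi> where \<psi>: "\<psi> \<in> hom C M (Dom C pV)" "pV \<cdot> \<psi> = p \<cdot> m2" "qV \<cdot> \<psi> = m1"
    by (rule pullback_lift[OF V(1) fg u(1) 2(1) M(2) 2(2)], rule that)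
  have \<psi>h: "\<psi> \<in> hom C M V" using \<psi> V by simp
  \<comment> \<open>Indeed \<open>\<psi>\<close> is a pullback of the cover \<open>T \<rightarrow> Y\<close>.\<close>
  have \<psi>c: "cover \<psi> M V"
  proof -
    obtain S t z where t: "cover t S V" "z \<in> hom C S T" "p \<cdot> z = pV \<cdot> t"
      by (rule local_lift[OF pc V(2)], rule that)
    have 3: "qV \<cdot> t \<in> hom C S U" using V t by simp
    have "u \<cdot> (qV \<cdot> t) = (f \<cdot> g) \<cdot> (pV \<cdot> t)" using square_comp[OF V(4), of t] V t u fg by simp
    also have "\<dots> = f \<cdot> (g \<cdot> (p \<cdot> z))" using t f g V by simp
    also have "\<dots> = (u \<cdot> q) \<cdot> z" using gp[OF t(2)] fb[of "q \<cdot> z" S] T t u by simp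
    finally have 4: "u \<cdot> (qV \<cdot> t) = (u \<cdot> q) \<cdot> z" .
    obtain m where m: "m \<in> hom C S (Dom C m1)" "m1 \<cdot> m = qV \<cdot> t" "m2 \<cdot> m = z"
      by (rule pullback_lift[OF M(1) u(1) uq 3 t(2) 4], rule that)
    have mh: "m \<in> hom C S M" using m M by simp
    have "\<psi> \<cdot> m = t"
    proof (rule pullback_mono[OF V(1), of _ S])
      show "pV \<cdot> \<psi> \<cdot> m = pV \<cdot> t" using square_comp[OF \<psi>(2), of m] \<psi>h mh m t V T M by simp
      show "qV \<cdot> \<psi> \<cdot> m = qV \<cdot> t" using triangle_comp[OF \<psi>(3), of m] \<psi>h mh m t V by simp
    qed (use \<psi> mh t V in simp_all)
    then have "cover (\<psi> \<cdot> m) S V" using t(1) by simp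
    then show ?thesis by (rule cover_cancel[OF _ \<psi>h mh])
  qed
  have 5: "q \<cdot> m2 \<in> hom C M U" "u \<cdot> (q \<cdot> m2) = u \<cdot> m1" using M T u by simp_all
  obtain \<kappa> where \<kappa>: "\<kappa> \<in> hom C M (Dom C k1)" "k1 \<cdot> \<kappa> = q \<cdot> m2" "k2 \<cdot> \<kappa> = m1"
    by (rule pullback_lift[OF K(1) u(1) u(1) 5(1) M(2) 5(2)], rule that)
  have \<kappa>h: "\<kappa> \<in> hom C M K" using \<kappa> K by simp
  have "separated qV"
  proof (rule separatedI[OF V(3)])
    fix S v1 v2 assume v: "v1 \<in> hom C S V" "v2 \<in> hom C S V" and qv: "qV \<cdot> v1 = qV \<cdot> v2" and ev: "\<eta> V \<cdot> v1 = \<eta> V \<cdot> v2"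
    obtain S' t w1 w2 where t: "cover t S' S" "w1 \<in> hom C S' M" "w2 \<in> hom C S' M"
      "\<eta> M \<cdot> w1 = \<eta> M \<cdot> w2" "\<psi> \<cdot> w1 = v1 \<cdot> t" "\<psi> \<cdot> w2 = v2 \<cdot> t"
      by (rule lift_unit_congruence[OF \<psi>c v ev], rule that)
    have qw: "qV \<cdot> (v1 \<cdot> t) = m1 \<cdot> w1" "qV \<cdot> (v2 \<cdot> t) = m1 \<cdot> w2"
      "pV \<cdot> (v1 \<cdot> t) = p \<cdot> (m2 \<cdot> w1)" "pV \<cdot> (v2 \<cdot> t) = p \<cdot> (m2 \<cdot> w2)"
      using triangle_comp[OF \<psi>(3), of w1] triangle_comp[OF \<psi>(3), of w2] square_comp[OF \<psi>(2), of w1]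
        square_comp[OF \<psi>(2), of w2] t \<psi>h V M T by simp_all
    have qvt: "qV \<cdot> (v1 \<cdot> t) = qV \<cdot> (v2 \<cdot> t)" using square_comp[OF qv, of t] v t V by simp
    have kw: "k2 \<cdot> (\<kappa> \<cdot> w1) = k2 \<cdot> (\<kappa> \<cdot> w2)"
      using qvt qw triangle_comp[OF \<kappa>(3), of w1] triangle_comp[OF \<kappa>(3), of w2] \<kappa>h t K by simp
    have kwh: "\<kappa> \<cdot> w1 \<in> hom C S' K" "\<kappa> \<cdot> w2 \<in> hom C S' K" using \<kappa>h t by simp_all
    have "\<kappa> \<cdot> w1 = \<kappa> \<cdot> w2" by (rule separatedD[OF sk K(3) kwh kw unit_natural_eq[OF \<kappa>h t(2,3,4)]])
    then have qm: "q \<cdot> (m2 \<cdot> w1) = q \<cdot> (m2 \<cdot> w2)"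
      using square_comp[OF \<kappa>(2), of w1] square_comp[OF \<kappa>(2), of w2] \<kappa>h t K T M by simp
    have mw: "m2 \<cdot> w1 \<in> hom C S' T" "m2 \<cdot> w2 \<in> hom C S' T" using M t by simp_all
    have "m2 \<cdot> w1 = m2 \<cdot> w2" by (rule separatedD[OF sq T(3) mw qm unit_natural_eq[OF M(3) t(2,3,4)]])
    then have "pV \<cdot> (v1 \<cdot> t) = pV \<cdot> (v2 \<cdot> t)" using qw by simp
    then have "v1 \<cdot> t = v2 \<cdot> t"
      using pullback_mono[OF V(1), of "v1 \<cdot> t" S' "v2 \<cdot> t"] qvt v t V by simp
    then show "v1 = v2" using cover_epi[OF t(1) v] by simp
  qed
  then show ?thesis by (rule centralI[OF fgc uc V(1)])
qed

text \<open>Let \<open>R\<close> be the kernel pair of a cover \<open>p : P \<rightarrow> A\<close> by a projective object. If \<open>w : W \<rightarrow> A\<close> is to be central and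
  \<open>r : P \<rightarrow> W\<close> lies over \<open>A\<close>, then \<open>r\<close> must identify the second components of any two elements of \<open>R\<close> that have
  the same first component and the same reflection. The quotient by exactly these identifications is central and
  weakly initial. Its elements killed by the unit form the required perfect extension.\<close>

lemma weakly_universal_exists:
  assumes en: "enough_projectives C" and A: "perfect C B A"
  obtains U u where "u \<in> hom C U A" "central_ext C B u" "perfect C B U" "weakly_universal_central_ext C B A u"
proof -
  have oA: "A \<in> Obj C" using A unfolding perfect_def by blast
  obtain P p where P: "projective C P" "p \<in> hom C P A" "regular_epi C p"
    using en oA unfolding enough_projectives_def by blast
  have oP: "P \<in> Obj C" using P by auto
  have iP: "Idn C P \<in> hom C P P" using oP by simp
  have pc: "cover p P A" using P by simp
  obtain R \<pi>1 \<pi>2 where R: "is_pullback C p p \<pi>1 \<pi>2" "\<pi>1 \<in> hom C R P" "\<pi>2 \<in> hom C R P" "p \<cdot> \<pi>1 = p \<cdot> \<pi>2"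
    by (rule pullback_exists[OF P(2) P(2)], rule that)
  have oR: "R \<in> Obj C" using R by auto
  have \<pi>2c: "cover \<pi>2 R P" using pullback_cover[OF R(1) P(3)] R by simp
  obtain Z l l' where Z: "is_product C P (\<beta> R) Z l l'"
    by (rule product_exists[OF oP unit_typing(5)[OF oR]], rule that)
  note ll = product_typing[OF Z]
  have eR: "\<eta> R \<in> hom C R (\<beta> R)" using oR by simp
  obtain e where e: "e \<in> hom C R Z" "l \<cdot> e = \<pi>1" "l' \<cdot> e = \<eta> R" by (rule product_lift[OF Z R(2) eR], rule that)
  have e_eq: "e \<cdot> a = e \<cdot> b \<longleftrightarrow> \<pi>1 \<cdot> a = \<pi>1 \<cdot> b \<and> \<eta> R \<cdot> a = \<eta> R \<cdot> b"
    if ab: "a \<in> hom C S R" "b \<in> hom C S R" for a b S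
  proof -
    have 3: "l \<cdot> (e \<cdot> a) = \<pi>1 \<cdot> a" "l' \<cdot> (e \<cdot> a) = \<eta> R \<cdot> a" "l \<cdot> (e \<cdot> b) = \<pi>1 \<cdot> b" "l' \<cdot> (e \<cdot> b) = \<eta> R \<cdot> b"
      using triangle_comp[OF e(2), of a] triangle_comp[OF e(3), of a] triangle_comp[OF e(2), of b] triangle_comp[OF e(3), of b]
        ab e ll by simp_all
    have "e \<cdot> a \<in> hom C S Z" "e \<cdot> b \<in> hom C S Z" using ab e by simp_all
    from product_mono[OF Z this] show ?thesis using 3 by metis
  qed
  obtain W r where r: "cover r P W"
    "\<And>T x1 x2. x1 \<in> hom C T R \<Longrightarrow> x2 \<in> hom C T R \<Longrightarrow> e \<cdot> x1 = e \<cdot> x2 \<Longrightarrow> r \<cdot> (\<pi>2 \<cdot> x1) = r \<cdot> (\<pi>2 \<cdot> x2)"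
    "\<And>T y1 y2. y1 \<in> hom C T P \<Longrightarrow> y2 \<in> hom C T P \<Longrightarrow> r \<cdot> y1 = r \<cdot> y2 \<Longrightarrow>
       \<exists>S t x1 x2. cover t S T \<and> x1 \<in> hom C S R \<and> x2 \<in> hom C S R \<and> e \<cdot> x1 = e \<cdot> x2 \<and>
         \<pi>2 \<cdot> x1 = y1 \<cdot> t \<and> \<pi>2 \<cdot> x2 = y2 \<cdot> t"
    by (rule quotient_by_image_relation[OF \<pi>2c e(1)], rule that)
  have oW: "W \<in> Obj C" and rh: "r \<in> hom C P W" using r(1) by auto
  \<comment> \<open>\<open>r\<close> is universal among arrows on \<open>P\<close> that make the identifications described above.\<close>
  have factor_r: "\<exists>k. k \<in> hom C W X \<and> k \<cdot> r = h"
    if h: "h \<in> hom C P X"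
      and hx: "\<And>S x1 x2. x1 \<in> hom C S R \<Longrightarrow> x2 \<in> hom C S R \<Longrightarrow> \<pi>1 \<cdot> x1 = \<pi>1 \<cdot> x2 \<Longrightarrow> \<eta> R \<cdot> x1 = \<eta> R \<cdot> x2 \<Longrightarrow>
          h \<cdot> (\<pi>2 \<cdot> x1) = h \<cdot> (\<pi>2 \<cdot> x2)" for h X
  proof (rule cover_factor[OF r(1) h])
    fix S a b assume ab: "a \<in> hom C S P" "b \<in> hom C S P" "r \<cdot> a = r \<cdot> b"
    obtain S' t x1 x2 where t: "cover t S' S" "x1 \<in> hom C S' R" "x2 \<in> hom C S' R" "e \<cdot> x1 = e \<cdot> x2"
      "\<pi>2 \<cdot> x1 = a \<cdot> t" "\<pi>2 \<cdot> x2 = b \<cdot> t" using r(3)[OF ab] by blast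
    have "\<pi>1 \<cdot> x1 = \<pi>1 \<cdot> x2" "\<eta> R \<cdot> x1 = \<eta> R \<cdot> x2" using e_eq[OF t(2,3)] t(4) by blast+
    then have "h \<cdot> (a \<cdot> t) = h \<cdot> (b \<cdot> t)" using hx[OF t(2,3)] t(5,6) by simp
    then show "h \<cdot> a = h \<cdot> b" using cover_epi[OF t(1), of "h \<cdot> a" X "h \<cdot> b"] h ab t(1) by simp
  qed blast
  have p_pi: "p \<cdot> (\<pi>1 \<cdot> x) = p \<cdot> (\<pi>2 \<cdot> x)" if "x \<in> hom C S R" for x S
    using square_comp[OF R(4), of x] R(2,3) P(2) that by simp
  have "\<exists>k. k \<in> hom C W A \<and> k \<cdot> r = p"
  proof (rule factor_r[OF P(2)])
    fix S x1 x2 assume "x1 \<in> hom C S R" "x2 \<in> hom C S R" "\<pi>1 \<cdot> x1 = \<pi>1 \<cdot> x2"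
    then show "p \<cdot> (\<pi>2 \<cdot> x1) = p \<cdot> (\<pi>2 \<cdot> x2)" using p_pi[of x1 S] p_pi[of x2 S] by simp
  qed
  then obtain w where w: "w \<in> hom C W A" "w \<cdot> r = p" by blast
  have wr: "w \<cdot> (r \<cdot> x) = p \<cdot> x" if "x \<in> hom C S P" for x S
    using triangle_comp[OF w(2), of x] w rh that by simp
  have wc: "cover w W A" using cover_cancel[of w r P A W] pc w rh by simp
  \<comment> \<open>Centrality is tested along \<open>p\<close> rather than along \<open>w\<close>: the pullback \<open>Q\<close> is then covered by \<open>R\<close> with the first
    component unchanged, so lifted pairs are directly subject to the defining identifications of \<open>r\<close>.\<close>
  have w_central: "central_ext C B w"
  proof -
    obtain Q a c where Q: "is_pullback C w p a c" "a \<in> hom C Q W" "c \<in> hom C Q P" "w \<cdot> a = p \<cdot> c"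
      by (rule pullback_exists[OF w(1) P(2)], rule that)
    have 1: "r \<cdot> \<pi>2 \<in> hom C R W" "w \<cdot> (r \<cdot> \<pi>2) = p \<cdot> \<pi>1" using rh R wr[OF R(3)] by simp_all
    obtain \<rho> where \<rho>: "\<rho> \<in> hom C R (Dom C a)" "a \<cdot> \<rho> = r \<cdot> \<pi>2" "c \<cdot> \<rho> = \<pi>1"
      by (rule pullback_lift[OF Q(1) w(1) P(2) 1(1) R(2) 1(2)], rule that)
    have \<rho>h: "\<rho> \<in> hom C R Q" using \<rho> Q by simp
    have a\<rho>: "a \<cdot> (\<rho> \<cdot> x) = r \<cdot> (\<pi>2 \<cdot> x)" "c \<cdot> (\<rho> \<cdot> x) = \<pi>1 \<cdot> x" if "x \<in> hom C S R" for x S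
      using square_comp[OF \<rho>(2), of x] triangle_comp[OF \<rho>(3), of x] that \<rho>h Q(2,3) R(2,3) rh by simp_all
    have \<rho>c: "cover \<rho> R Q"
    proof -
      obtain S t x where t: "cover t S Q" "x \<in> hom C S P" "r \<cdot> x = a \<cdot> t"
        by (rule local_lift[OF r(1) Q(2)], rule that)
      have 2: "c \<cdot> t \<in> hom C S P" "p \<cdot> (c \<cdot> t) = p \<cdot> x"
        using Q(2,3) t square_comp[OF Q(4), of t] w(1) P(2) wr[OF t(2)] by simp_all
      obtain z where z: "z \<in> hom C S (Dom C \<pi>1)" "\<pi>1 \<cdot> z = c \<cdot> t" "\<pi>2 \<cdot> z = x"
        by (rule pullback_lift[OF R(1) P(2) P(2) 2(1) t(2) 2(2)], rule that)
      have zh: "z \<in> hom C S R" using z R by simp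
      have "\<rho> \<cdot> z = t"
        by (rule pullback_mono[OF Q(1), of _ S]) (use a\<rho>[OF zh] z zh \<rho>h t Q(2) in simp_all)
      then have "cover (\<rho> \<cdot> z) S Q" using t(1) by simp
      then show ?thesis by (rule cover_cancel[OF _ \<rho>h zh])
    qed
    have "separated c"
    proof (rule separatedI[OF Q(3)])
      fix S z1 z2 assume z: "z1 \<in> hom C S Q" "z2 \<in> hom C S Q" and cz: "c \<cdot> z1 = c \<cdot> z2" and ez: "\<eta> Q \<cdot> z1 = \<eta> Q \<cdot> z2"
      obtain S' t x1 x2 where t: "cover t S' S" "x1 \<in> hom C S' R" "x2 \<in> hom C S' R"
        "\<eta> R \<cdot> x1 = \<eta> R \<cdot> x2" "\<rho> \<cdot> x1 = z1 \<cdot> t" "\<rho> \<cdot> x2 = z2 \<cdot> t"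
        by (rule lift_unit_congruence[OF \<rho>c z ez], rule that)
      have czt: "c \<cdot> (z1 \<cdot> t) = c \<cdot> (z2 \<cdot> t)" using square_comp[OF cz, of t] z t(1) Q(3) by simp
      have "\<pi>1 \<cdot> x1 = \<pi>1 \<cdot> x2" using a\<rho>(2)[OF t(2)] a\<rho>(2)[OF t(3)] t(5,6) czt by simp
      then have "e \<cdot> x1 = e \<cdot> x2" using e_eq[OF t(2,3)] t(4) by blast
      then have "r \<cdot> (\<pi>2 \<cdot> x1) = r \<cdot> (\<pi>2 \<cdot> x2)" by (rule r(2)[OF t(2,3)])
      then have "a \<cdot> (z1 \<cdot> t) = a \<cdot> (z2 \<cdot> t)" using a\<rho>(1)[OF t(2)] a\<rho>(1)[OF t(3)] t(5,6) by simp
      then have "z1 \<cdot> t = z2 \<cdot> t"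
        using pullback_mono[OF Q(1), of "z1 \<cdot> t" S' "z2 \<cdot> t"] czt z t(1) Q(2) by simp
      then show "z1 = z2" using cover_epi[OF t(1) z] by simp
    qed
    then show ?thesis by (rule centralI[OF wc pc Q(1)])
  qed
  have eW: "\<eta> W \<in> hom C W (\<beta> W)" using oW by simp
  obtain F i where "is_kernel C i (\<eta> W)" and i: "i \<in> hom C F W" "\<eta> W \<cdot> i = zero_map F (\<beta> W)" "monic C i"
    and il: "\<And>T x. x \<in> hom C T W \<Longrightarrow> \<eta> W \<cdot> x = zero_map T (\<beta> W) \<Longrightarrow> \<exists>h. h \<in> hom C T F \<and> i \<cdot> h = x"
    by (rule kernel_exists[OF eW], rule that)
  have oF: "F \<in> Obj C" using i by auto
  have wi: "w \<cdot> i \<in> hom C F A" using w i by simp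
  have wic: "cover (w \<cdot> i) F A"
  proof -
    have iA: "Idn C A \<in> hom C A A" using oA by simp
    obtain S t x where t: "cover t S A" "x \<in> hom C S W" "w \<cdot> x = Idn C A \<cdot> t" "\<eta> W \<cdot> x = zero_map S (\<beta> W)"
      by (rule perfect_lift[OF wc A iA], rule that)
    obtain h where h: "h \<in> hom C S F" "i \<cdot> h = x" using il[OF t(2,4)] by blast
    have "(w \<cdot> i) \<cdot> h = t" using h t w(1) i(1) by simp
    then have "cover ((w \<cdot> i) \<cdot> h) S A" using t(1) by simp
    then show ?thesis by (rule cover_cancel[OF _ wi h(1)])
  qed
  have wi_central: "central_ext C B (w \<cdot> i)"
    by (rule central_subextension[OF w_central w(1) i(3,1) wic])
  \<comment> \<open>Pulling \<open>w\<close> back along its restriction to \<open>F\<close> gives a split, hence trivial, extension \<open>p2\<close>. The inclusion \<open>i\<close>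
    lifts locally to an element of \<open>T\<close> killed by the unit, which by triviality must come from the section, so the
    generic element of \<open>F\<close> is killed by the unit of \<open>F\<close>.\<close>
  have F_perfect: "perfect C B F"
  proof -
    obtain T p1 p2 where T: "is_pullback C w (w \<cdot> i) p1 p2" "p1 \<in> hom C T W" "p2 \<in> hom C T F"
      "w \<cdot> p1 = (w \<cdot> i) \<cdot> p2"
      by (rule pullback_exists[OF w(1) wi], rule that)
    have 1: "Idn C F \<in> hom C F F" "w \<cdot> i = (w \<cdot> i) \<cdot> Idn C F" using oF w(1) i(1) by simp_all
    obtain \<sigma> where \<sigma>: "\<sigma> \<in> hom C F (Dom C p1)" "p1 \<cdot> \<sigma> = i" "p2 \<cdot> \<sigma> = Idn C F"
      by (rule pullback_lift[OF T(1) w(1) wi i(1) 1], rule that)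
    have \<sigma>h: "\<sigma> \<in> hom C F T" using \<sigma> T(2) by simp
    have s: "separated p2" by (rule split_central_separated[OF central_pullback[OF w_central w(1) T(1)] T(3) \<sigma>h \<sigma>(3)])
    have p1c: "cover p1 T W" using pullback_cover[OF pullback_swap[OF T(1)]] wic T(2) by simp
    obtain S t z where t: "cover t S F" "z \<in> hom C S T" "p1 \<cdot> z = i \<cdot> t" "\<eta> T \<cdot> z = zero_map S (\<beta> T)"
      by (rule lift_unit_kernel[OF p1c i(1,2)], rule that)
    have p2z: "p2 \<cdot> z \<in> hom C S F" using T(3) t(2) by simp
    have e2: "\<eta> F \<cdot> (p2 \<cdot> z) = zero_map S (\<beta> F)" by (rule unit_natural_zero[OF T(3) t(2,4)])
    have e3: "\<eta> T \<cdot> (\<sigma> \<cdot> (p2 \<cdot> z)) = zero_map S (\<beta> T)" by (rule unit_natural_zero[OF \<sigma>h p2z e2])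
    have e4: "p2 \<cdot> (\<sigma> \<cdot> (p2 \<cdot> z)) = p2 \<cdot> z" using triangle_comp[OF \<sigma>(3), of "p2 \<cdot> z"] \<sigma>h p2z T(3) by simp
    have "\<sigma> \<cdot> (p2 \<cdot> z) = z"
      by (rule separatedD[OF s T(3) _ t(2) e4]) (use e3 t(4) \<sigma>h p2z in simp_all)
    then have "i \<cdot> t = p1 \<cdot> (\<sigma> \<cdot> (p2 \<cdot> z))" using t(3) by simp
    also have "\<dots> = i \<cdot> (p2 \<cdot> z)" using triangle_comp[OF \<sigma>(2), of "p2 \<cdot> z"] \<sigma>h p2z T(2) by simp
    finally have "t = p2 \<cdot> z" using mono_cancel[OF i(3,1), of t S "p2 \<cdot> z"] t(1) p2z by simp
    then have "\<eta> F \<cdot> t = zero_map F (\<beta> F) \<cdot> t" using e2 t(1) oF by simp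
    then have "\<eta> F = zero_map F (\<beta> F)" using cover_epi[OF t(1), of "\<eta> F" "\<beta> F" "zero_map F (\<beta> F)"] oF by simp
    then show ?thesis using oF unfolding perfect_iff by simp
  qed
  have lift: "\<exists>k. k \<in> hom C F X \<and> f \<cdot> k = w \<cdot> i" if f: "f \<in> hom C X A" "central_ext C B f" for f X
  proof -
    have D: "Dom C f = X" "Cod C f = A" using f by auto
    have "regular_epi C f" using central_cover[OF f(2,1)] by simp
    then obtain h where h: "h \<in> hom C P X" "f \<cdot> h = p"
      using P(1,2) D unfolding projective_def by blast
    obtain V v1 v2 where V: "is_pullback C f p v1 v2" "v1 \<in> hom C V X" "v2 \<in> hom C V P" "f \<cdot> v1 = p \<cdot> v2"
      by (rule pullback_exists[OF f(1) P(2)], rule that)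
    have 1: "f \<cdot> h = p \<cdot> Idn C P" using h P(2) oP by simp
    obtain s where s: "s \<in> hom C P (Dom C v1)" "v1 \<cdot> s = h" "v2 \<cdot> s = Idn C P"
      by (rule pullback_lift[OF V(1) f(1) P(2) h(1) iP 1], rule that)
    have sh: "s \<in> hom C P V" using s V(2) by simp
    have sv: "separated v2" by (rule split_central_separated[OF central_pullback[OF f(2,1) V(1)] V(3) sh s(3)])
    have 2: "h \<cdot> \<pi>2 \<in> hom C R X" "f \<cdot> (h \<cdot> \<pi>2) = p \<cdot> \<pi>1"
      using h(1) R(2,3) f(1) triangle_comp[OF h(2), of \<pi>2] R(4) by simp_all
    obtain \<theta> where \<theta>: "\<theta> \<in> hom C R (Dom C v1)" "v1 \<cdot> \<theta> = h \<cdot> \<pi>2" "v2 \<cdot> \<theta> = \<pi>1"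
      by (rule pullback_lift[OF V(1) f(1) P(2) 2(1) R(2) 2(2)], rule that)
    have \<theta>h: "\<theta> \<in> hom C R V" using \<theta> V(2) by simp
    have "\<exists>k. k \<in> hom C W X \<and> k \<cdot> r = h"
    proof (rule factor_r[OF h(1)])
      fix S x1 x2 assume x: "x1 \<in> hom C S R" "x2 \<in> hom C S R" "\<pi>1 \<cdot> x1 = \<pi>1 \<cdot> x2" "\<eta> R \<cdot> x1 = \<eta> R \<cdot> x2"
      have 3: "v2 \<cdot> (\<theta> \<cdot> x1) = v2 \<cdot> (\<theta> \<cdot> x2)"
        using triangle_comp[OF \<theta>(3), of x1] triangle_comp[OF \<theta>(3), of x2] x \<theta>h V(3) by simp
      have 4: "\<theta> \<cdot> x1 \<in> hom C S V" "\<theta> \<cdot> x2 \<in> hom C S V" using \<theta>h x by simp_all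
      have "\<theta> \<cdot> x1 = \<theta> \<cdot> x2" by (rule separatedD[OF sv V(3) 4 3 unit_natural_eq[OF \<theta>h x(1,2,4)]])
      then show "h \<cdot> (\<pi>2 \<cdot> x1) = h \<cdot> (\<pi>2 \<cdot> x2)"
        using square_comp[OF \<theta>(2), of x1] square_comp[OF \<theta>(2), of x2] x \<theta>h V(2) h(1) R(3) by simp
    qed
    then obtain k where k: "k \<in> hom C W X" "k \<cdot> r = h" by blast
    have "(f \<cdot> k) \<cdot> r = w \<cdot> r" using k f(1) rh h w(2) by simp
    then have "f \<cdot> k = w" using cover_epi[OF r(1), of "f \<cdot> k" A w] k(1) f(1) w(1) by simp
    then have "f \<cdot> (k \<cdot> i) = w \<cdot> i" using triangle_comp[of f k w i] k(1) f(1) i(1) by simp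
    then show ?thesis using k(1) i(1) by (intro exI[of _ "k \<cdot> i"]) simp
  qed
  have "weakly_universal_central_ext C B A (w \<cdot> i)"
    unfolding weakly_universal_central_ext_def is_weakly_initial_def
  proof (intro conjI ballI)
    show "w \<cdot> i \<in> Obj (Centr C B A)"
      using wi wi_central unfolding Centr_def full_subcat_def slice_def by simp
    fix f assume "f \<in> Obj (Centr C B A)"
    then have f: "f \<in> hom C (Dom C f) A" "central_ext C B f"
      unfolding Centr_def full_subcat_def slice_def by simp_all
    obtain k where k: "k \<in> hom C F (Dom C f)" "f \<cdot> k = w \<cdot> i" using lift[OF f] by blast
    have "(w \<cdot> i, k, f) \<in> hom (Centr C B A) (w \<cdot> i) f"
      using k f wi wi_central unfolding Centr_def full_subcat_def slice_def Defs.hom_def by simp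
    then show "\<exists>h. h \<in> hom (Centr C B A) (w \<cdot> i) f" by blast
  qed
  then show thesis by (rule that[OF wi wi_central F_perfect])
qed

theorem composite_of_central_extensions:
  assumes en: "enough_projectives C" and eq: "recognition_conditions_equivalent C B"
    and X: "perfect C B X" and f: "f \<in> hom C X A" "central_ext C B f" and g: "g \<in> hom C Y X" "central_ext C B g"
  shows "central_ext C B (f \<cdot> g)"
proof -
  have A: "perfect C B A" by (rule perfect_quotient[OF central_cover[OF f(2,1)] X])
  obtain U u where u: "u \<in> hom C U A" "central_ext C B u" "perfect C B U"
    "weakly_universal_central_ext C B A u"
    by (rule weakly_universal_exists[OF en A], rule that)
  have "perfect C B U \<and> projective_wrt_central C B U"
    using eq u unfolding recognition_conditions_equivalent_def Let_def by blast
  then show ?thesis using central_composite[OF u(1,2) _ _ f X g] by blast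
qed

end

section \<open>Abelian objects\<close>

context semi_abelian_cat begin

text \<open>The first axis is the image of a section of the first projection, whose kernel is the second axis.\<close>

lemma axes_generate:
  assumes P: "is_product C X Y P p q" and n: "monic C n" "n \<in> hom C N P"
    and ax: "\<And>T h. h \<in> hom C T P \<Longrightarrow> p \<cdot> h = zero_map T X \<or> q \<cdot> h = zero_map T Y \<Longrightarrow> \<exists>k. k \<in> hom C T N \<and> n \<cdot> k = h"
    and h: "h \<in> hom C T P"
  shows "\<exists>k. k \<in> hom C T N \<and> n \<cdot> k = h"
proof -
  note pq = product_typing[OF P]
  have o: "X \<in> Obj C" "Y \<in> Obj C" using pq by auto
  have 1: "Idn C X \<in> hom C X X" "zero_map X Y \<in> hom C X Y" using o by simp_all
  obtain s where s: "s \<in> hom C X P" "p \<cdot> s = Idn C X" "q \<cdot> s = zero_map X Y" by (rule product_lift[OF P 1], rule that)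
  obtain s' where s': "s' \<in> hom C X N" "n \<cdot> s' = s" using ax[OF s(1)] s(3) by blast
  have ps: "p \<cdot> (n \<cdot> s') = Idn C X" using s s' by simp
  show ?thesis
    by (rule subobject_with_kernel_and_section[OF n pq(1) s'(1) ps _ h]) (use ax in blast)
qed

lemma equaliser_exists:
  assumes u: "u \<in> hom C X Z" and v: "v \<in> hom C X Z"
  obtains N n where "n \<in> hom C N X" "monic C n" "u \<cdot> n = v \<cdot> n"
    "\<And>T x. x \<in> hom C T X \<Longrightarrow> u \<cdot> x = v \<cdot> x \<Longrightarrow> \<exists>h. h \<in> hom C T N \<and> n \<cdot> h = x"
proof -
  have o: "Z \<in> Obj C" using u by auto
  obtain ZZ l r where W: "is_product C Z Z ZZ l r" by (rule product_exists[OF o o], rule that)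
  note lr = product_typing[OF W]
  have iZ: "Idn C Z \<in> hom C Z Z" using o by simp
  obtain d where d: "d \<in> hom C Z ZZ" "l \<cdot> d = Idn C Z" "r \<cdot> d = Idn C Z" by (rule product_lift[OF W iZ iZ], rule that)
  obtain f where f: "f \<in> hom C X ZZ" "l \<cdot> f = u" "r \<cdot> f = v" by (rule product_lift[OF W u v], rule that)
  obtain N n k where N: "is_pullback C f d n k" "n \<in> hom C N X" "k \<in> hom C N Z" "f \<cdot> n = d \<cdot> k"
    by (rule pullback_exists[OF f(1) d(1)], rule that)
  have lf: "l \<cdot> (f \<cdot> x) = u \<cdot> x" "r \<cdot> (f \<cdot> x) = v \<cdot> x" if "x \<in> hom C T X" for x T
    using triangle_comp[OF f(2), of x] triangle_comp[OF f(3), of x] that f(1) lr by simp_all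
  have ld: "l \<cdot> (d \<cdot> x) = x" "r \<cdot> (d \<cdot> x) = x" if "x \<in> hom C T Z" for x T
    using triangle_comp[OF d(2), of x] triangle_comp[OF d(3), of x] that d(1) lr by simp_all
  have un: "u \<cdot> n = v \<cdot> n" using lf[OF N(2)] N(4) ld[OF N(3)] by metis
  have m: "monic C n"
    unfolding monic_def
  proof (intro conjI allI ballI impI)
    fix T g h assume "g \<in> hom C T (Dom C n)" "h \<in> hom C T (Dom C n)" and e: "n \<cdot> g = n \<cdot> h"
    then have gh: "g \<in> hom C T N" "h \<in> hom C T N" using N(2) by simp_all
    have kg: "k \<cdot> g \<in> hom C T Z" "k \<cdot> h \<in> hom C T Z" using gh N(3) by simp_all
    have dk: "d \<cdot> (k \<cdot> g) = d \<cdot> (k \<cdot> h)"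
      using square_comp[OF N(4), of g] square_comp[OF N(4), of h] e gh N(2,3) f(1) d(1) by simp
    have "k \<cdot> g = k \<cdot> h" using ld(1)[OF kg(1)] ld(1)[OF kg(2)] dk by argo
    then show "g = h" using pullback_mono[OF N(1), of g T h] e gh N(2) by simp
  qed (use N(2) in simp)
  show thesis
  proof (rule that[OF N(2) m un])
    fix T x assume x: "x \<in> hom C T X" "u \<cdot> x = v \<cdot> x"
    have ux: "u \<cdot> x \<in> hom C T Z" using u x(1) by simp
    have fd: "f \<cdot> x \<in> hom C T ZZ" "d \<cdot> (u \<cdot> x) \<in> hom C T ZZ" using f(1) d(1) x(1) ux by simp_all
    have "f \<cdot> x = d \<cdot> (u \<cdot> x)"
      by (rule product_mono[OF W fd]) (use lf[OF x(1)] ld[OF ux] x(2) in argo)+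
    then obtain h where "h \<in> hom C T (Dom C n)" "n \<cdot> h = x"
      using pullback_lift[OF N(1) f(1) d(1) x(1) ux] by blast
    then show "\<exists>h. h \<in> hom C T N \<and> n \<cdot> h = x" using N(2) by auto
  qed
qed

lemma axes_epic:
  assumes P: "is_product C X Y P p q" and u: "u \<in> hom C P Z" and v: "v \<in> hom C P Z"
    and ax: "\<And>T h. h \<in> hom C T P \<Longrightarrow> p \<cdot> h = zero_map T X \<or> q \<cdot> h = zero_map T Y \<Longrightarrow> u \<cdot> h = v \<cdot> h"
  shows "u = v"
proof -
  have o: "P \<in> Obj C" using u by auto
  have iP: "Idn C P \<in> hom C P P" using o by simp
  obtain N n where N: "n \<in> hom C N P" "monic C n" "u \<cdot> n = v \<cdot> n"
    "\<And>T x. x \<in> hom C T P \<Longrightarrow> u \<cdot> x = v \<cdot> x \<Longrightarrow> \<exists>h. h \<in> hom C T N \<and> n \<cdot> h = x"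
    by (rule equaliser_exists[OF u v], rule that)
  have "\<exists>k. k \<in> hom C P N \<and> n \<cdot> k = Idn C P"
    by (rule axes_generate[OF P N(2,1) _ iP]) (use N(4) ax in blast)
  then obtain k where k: "k \<in> hom C P N" "n \<cdot> k = Idn C P" by blast
  have "u \<cdot> (n \<cdot> k) = v \<cdot> (n \<cdot> k)" using square_comp[OF N(3), of k] N(1) k(1) u v by simp
  then show ?thesis using k(2) u v by simp
qed

text \<open>The neutral element is expressed without pairings: the product of an element of the square with one component
  zero is its other component. All other axioms of an abelian group follow.\<close>

definition unital_mult :: "'o \<Rightarrow> 'o \<Rightarrow> 'm \<Rightarrow> 'm \<Rightarrow> 'm \<Rightarrow> bool" where
  "unital_mult X P p q m \<longleftrightarrow> is_product C X X P p q \<and> m \<in> hom C P X \<and>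
     (\<forall>T h. h \<in> hom C T P \<longrightarrow> (q \<cdot> h = zero_map T X \<longrightarrow> m \<cdot> h = p \<cdot> h) \<and> (p \<cdot> h = zero_map T X \<longrightarrow> m \<cdot> h = q \<cdot> h))"

lemma unital_multD:
  assumes "unital_mult X P p q m"
  shows "is_product C X X P p q" "m \<in> hom C P X"
    "h \<in> hom C T P \<Longrightarrow> q \<cdot> h = zero_map T X \<Longrightarrow> m \<cdot> h = p \<cdot> h"
    "h \<in> hom C T P \<Longrightarrow> p \<cdot> h = zero_map T X \<Longrightarrow> m \<cdot> h = q \<cdot> h"
  using assms unfolding unital_mult_def by blast+

lemma pairing_props:
  assumes P: "is_product C X Y P p q" and x: "x \<in> hom C T X" and y: "y \<in> hom C T Y"
  shows "pairing C p q x y \<in> hom C T P" "p \<cdot> pairing C p q x y = x" "q \<cdot> pairing C p q x y = y"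
proof -
  note pq = product_typing[OF P]
  have D: "Dom C x = T" "Dom C p = P" using x pq by auto
  obtain h where h: "h \<in> hom C T P" "p \<cdot> h = x" "q \<cdot> h = y" by (rule product_lift[OF P x y], rule that)
  have "pairing C p q x y = h"
    unfolding pairing_def D
  proof (rule the_equality)
    fix k assume k: "k \<in> hom C T P \<and> p \<cdot> k = x \<and> q \<cdot> k = y"
    then show "k = h" using product_mono[OF P, of k T h] h by simp
  qed (use h in blast)
  then show "pairing C p q x y \<in> hom C T P" "p \<cdot> pairing C p q x y = x" "q \<cdot> pairing C p q x y = y"
    using h by simp_all
qed

lemma pairing_comp:
  assumes P: "is_product C X Y P p q" and x: "x \<in> hom C T X" and y: "y \<in> hom C T Y" and t: "t \<in> hom C S T"
  shows "pairing C p q x y \<cdot> t = pairing C p q (x \<cdot> t) (y \<cdot> t)"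
proof -
  note pq = product_typing[OF P] and a = pairing_props[OF P x y]
  have xt: "x \<cdot> t \<in> hom C S X" "y \<cdot> t \<in> hom C S Y" using x y t by simp_all
  note b = pairing_props[OF P xt]
  show ?thesis
    by (rule product_mono[OF P, of _ S])
      (use a b t pq triangle_comp[OF a(2), of t] triangle_comp[OF a(3), of t] in simp_all)
qed

lemma pairing_eta:
  assumes P: "is_product C X Y P p q" and h: "h \<in> hom C T P"
  shows "pairing C p q (p \<cdot> h) (q \<cdot> h) = h"
proof -
  note pq = product_typing[OF P]
  have 1: "p \<cdot> h \<in> hom C T X" "q \<cdot> h \<in> hom C T Y" using pq h by simp_all
  note b = pairing_props[OF P 1]
  show ?thesis by (rule product_mono[OF P b(1) h b(2,3)])
qed

text \<open>The Eckmann-Hilton argument in its unital form: both sides of commutativity and of associativity agree on the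
  axes. For inverses, the span of the first projection and the multiplication contains \<open>(1, 1)\<close>, \<open>(0, 1)\<close> and
  \<open>(0, 0)\<close>, hence \<open>(1, 0)\<close> locally; local inverses are unique by associativity and therefore glue.\<close>

lemma unital_mult_in_Ab:
  assumes U: "unital_mult X P p q m"
  shows "X \<in> Ab C"
proof -
  note P = unital_multD(1)[OF U] and m = unital_multD(2)[OF U] and right = unital_multD(3)[OF U] and left = unital_multD(4)[OF U]
  note pq = product_typing[OF P]
  have o: "X \<in> Obj C" "P \<in> Obj C" using pq by auto
  note pr = pairing_props[OF P]
  define \<mu> where "\<mu> x y = m \<cdot> pairing C p q x y" for x y
  have \<mu>h: "\<mu> x y \<in> hom C T X" if "x \<in> hom C T X" "y \<in> hom C T X" for x y T
    using pr(1)[OF that] m unfolding \<mu>_def by simp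
  have \<mu>r: "\<mu> x (zero_map T X) = x" if x: "x \<in> hom C T X" for x T
  proof -
    have z: "zero_map T X \<in> hom C T X" using x o by auto
    show ?thesis using right[OF pr(1)[OF x z] pr(3)[OF x z]] pr(2)[OF x z] unfolding \<mu>_def by simp
  qed
  have \<mu>l: "\<mu> (zero_map T X) x = x" if x: "x \<in> hom C T X" for x T
  proof -
    have z: "zero_map T X \<in> hom C T X" using x o by auto
    show ?thesis using left[OF pr(1)[OF z x] pr(2)[OF z x]] pr(3)[OF z x] unfolding \<mu>_def by simp
  qed
  have \<mu>c: "\<mu> x y \<cdot> t = \<mu> (x \<cdot> t) (y \<cdot> t)" if "x \<in> hom C T X" "y \<in> hom C T X" "t \<in> hom C S T" for x y t S T
    using pairing_comp[OF P that] pr(1)[OF that(1,2)] that(3) m unfolding \<mu>_def by simp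
  have comm: "m \<cdot> pairing C p q q p = m"
  proof (rule axes_epic[OF P _ m])
    show "m \<cdot> pairing C p q q p \<in> hom C P X" using \<mu>h[OF pq(2,1)] unfolding \<mu>_def .
    fix T h assume h: "h \<in> hom C T P" and z: "p \<cdot> h = zero_map T X \<or> q \<cdot> h = zero_map T X"
    have ph: "p \<cdot> h \<in> hom C T X" "q \<cdot> h \<in> hom C T X" using pq h by simp_all
    have 1: "(m \<cdot> pairing C p q q p) \<cdot> h = \<mu> (q \<cdot> h) (p \<cdot> h)" using \<mu>c[OF pq(2,1) h] unfolding \<mu>_def .
    have "m \<cdot> h = \<mu> (p \<cdot> h) (q \<cdot> h)" using pairing_eta[OF P h] unfolding \<mu>_def by simp
    then show "(m \<cdot> pairing C p q q p) \<cdot> h = m \<cdot> h"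
      using z 1 \<mu>l[OF ph(1)] \<mu>r[OF ph(1)] \<mu>l[OF ph(2)] \<mu>r[OF ph(2)] by metis
  qed
  have assoc: "m \<cdot> pairing C p q (m \<cdot> a) z = m \<cdot> pairing C p q (p \<cdot> a) (m \<cdot> pairing C p q (q \<cdot> a) z)"
    if Q: "is_product C P X Q a z" for Q a z
  proof -
    note az = product_typing[OF Q]
    have ma: "m \<cdot> a \<in> hom C Q X" "p \<cdot> a \<in> hom C Q X" "q \<cdot> a \<in> hom C Q X" using m az pq by simp_all
    have i: "\<mu> (q \<cdot> a) z \<in> hom C Q X" by (rule \<mu>h[OF ma(3) az(2)])
    have "\<mu> (m \<cdot> a) z = \<mu> (p \<cdot> a) (\<mu> (q \<cdot> a) z)"
    proof (rule axes_epic[OF Q \<mu>h[OF ma(1) az(2)] \<mu>h[OF ma(2) i]])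
      fix T h assume h: "h \<in> hom C T Q" and ax: "a \<cdot> h = zero_map T P \<or> z \<cdot> h = zero_map T X"
      have oT: "T \<in> Obj C" using h by auto
      have ah: "a \<cdot> h \<in> hom C T P" "z \<cdot> h \<in> hom C T X" using az h by simp_all
      have pah: "p \<cdot> (a \<cdot> h) \<in> hom C T X" "q \<cdot> (a \<cdot> h) \<in> hom C T X" "m \<cdot> (a \<cdot> h) \<in> hom C T X"
        using ah pq m by simp_all
      have L: "\<mu> (m \<cdot> a) z \<cdot> h = \<mu> (m \<cdot> (a \<cdot> h)) (z \<cdot> h)" using \<mu>c[OF ma(1) az(2) h] m az h by simp
      have "\<mu> (q \<cdot> a) z \<cdot> h = \<mu> (q \<cdot> (a \<cdot> h)) (z \<cdot> h)" using \<mu>c[OF ma(3) az(2) h] pq az h by simp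
      then have R: "\<mu> (p \<cdot> a) (\<mu> (q \<cdot> a) z) \<cdot> h = \<mu> (p \<cdot> (a \<cdot> h)) (\<mu> (q \<cdot> (a \<cdot> h)) (z \<cdot> h))"
        using \<mu>c[OF ma(2) i h] pq az h by simp
      from ax show "\<mu> (m \<cdot> a) z \<cdot> h = \<mu> (p \<cdot> a) (\<mu> (q \<cdot> a) z) \<cdot> h"
      proof
        assume "a \<cdot> h = zero_map T P"
        then have "p \<cdot> (a \<cdot> h) = zero_map T X" "q \<cdot> (a \<cdot> h) = zero_map T X" "m \<cdot> (a \<cdot> h) = zero_map T X"
          using pq m oT by simp_all
        then show ?thesis using L R \<mu>l[OF ah(2)] by simp
      next
        assume "z \<cdot> h = zero_map T X"
        moreover have "m \<cdot> (a \<cdot> h) = \<mu> (p \<cdot> (a \<cdot> h)) (q \<cdot> (a \<cdot> h))"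
          using pairing_eta[OF P ah(1)] unfolding \<mu>_def by simp
        ultimately show ?thesis using L R \<mu>r[OF pah(3)] \<mu>r[OF pah(2)] by simp
      qed
    qed
    then show ?thesis unfolding \<mu>_def .
  qed
  have \<mu>_comm: "\<mu> x y = \<mu> y x" if xy: "x \<in> hom C T X" "y \<in> hom C T X" for x y T
  proof -
    have "m \<cdot> (pairing C p q q p \<cdot> pairing C p q x y) = m \<cdot> pairing C p q x y"
      using triangle_comp[OF comm, of "pairing C p q x y"] pr(1)[OF xy] pr(1)[OF pq(2,1)] m by simp
    then show ?thesis using pairing_comp[OF P pq(2,1) pr(1)[OF xy]] pr(2,3)[OF xy] unfolding \<mu>_def by simp
  qed
  have \<mu>_assoc: "\<mu> (\<mu> x y) z = \<mu> x (\<mu> y z)"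
    if xyz: "x \<in> hom C T X" "y \<in> hom C T X" "z \<in> hom C T X" for x y z T
  proof -
    obtain Q a b where Q: "is_product C P X Q a b" by (rule product_exists[OF o(2,1)], rule that)
    note ab = product_typing[OF Q]
    obtain h where h: "h \<in> hom C T Q" "a \<cdot> h = pairing C p q x y" "b \<cdot> h = z"
      by (rule product_lift[OF Q pr(1)[OF xyz(1,2)] xyz(3)], rule that)
    have ma: "m \<cdot> a \<in> hom C Q X" "p \<cdot> a \<in> hom C Q X" "q \<cdot> a \<in> hom C Q X" using m ab pq by simp_all
    have i: "\<mu> (q \<cdot> a) b \<in> hom C Q X" by (rule \<mu>h[OF ma(3) ab(2)])
    have *: "(m \<cdot> a) \<cdot> h = \<mu> x y" "(p \<cdot> a) \<cdot> h = x" "(q \<cdot> a) \<cdot> h = y"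
      using h ab pq m pr(2,3)[OF xyz(1,2)] unfolding \<mu>_def by simp_all
    have "\<mu> (m \<cdot> a) b \<cdot> h = \<mu> (p \<cdot> a) (\<mu> (q \<cdot> a) b) \<cdot> h" using assoc[OF Q] unfolding \<mu>_def by simp
    then show ?thesis
      using \<mu>c[OF ma(1) ab(2) h(1)] \<mu>c[OF ma(2) i h(1)] \<mu>c[OF ma(3) ab(2) h(1)] * h(3) by simp
  qed
  have iX: "Idn C X \<in> hom C X X" and zX: "zero_map X X \<in> hom C X X" using o by simp_all
  have "\<exists>i. i \<in> hom C X X \<and> \<mu> (Idn C X) i = zero_map X X"
  proof -
    note A = pr[OF iX zX] and B = pr[OF zX iX] and Z = pr[OF zX zX]
    have 1: "m \<cdot> pairing C p q (Idn C X) (zero_map X X) = m \<cdot> pairing C p q (zero_map X X) (Idn C X)"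
      using \<mu>l[OF iX] \<mu>r[OF iX] unfolding \<mu>_def by simp
    have 2: "p \<cdot> pairing C p q (zero_map X X) (Idn C X) = p \<cdot> pairing C p q (zero_map X X) (zero_map X X)"
      using B Z by simp
    obtain S t d where d: "cover t S X" "d \<in> hom C S P" "p \<cdot> d = p \<cdot> (pairing C p q (Idn C X) (zero_map X X) \<cdot> t)"
      "m \<cdot> d = m \<cdot> (pairing C p q (zero_map X X) (zero_map X X) \<cdot> t)"
      by (rule difunctional[OF pq(1) m A(1) B(1) Z(1) 1 2], rule that)
    have th: "t \<in> hom C S X" using d by simp
    have oS: "S \<in> Obj C" using th by auto
    have pd: "p \<cdot> d = t" using d(3) triangle_comp[OF A(2), of t] A(1) th pq by simp
    have "\<mu> (zero_map X X) (zero_map X X) \<cdot> t = zero_map S X" using \<mu>r[OF zX] th o by simp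
    then have md: "m \<cdot> d = zero_map S X" using d(4) Z(1) th m unfolding \<mu>_def by simp
    define y where "y = q \<cdot> d"
    have y: "y \<in> hom C S X" using pq d(2) unfolding y_def by simp
    have ty: "\<mu> t y = zero_map S X" using pairing_eta[OF P d(2)] pd md unfolding \<mu>_def y_def by simp
    have ya: "y \<cdot> a = y \<cdot> b" if ab: "a \<in> hom C R S" "b \<in> hom C R S" "t \<cdot> a = t \<cdot> b" for R a b
    proof -
      have oR: "R \<in> Obj C" using ab by auto
      have h: "t \<cdot> a \<in> hom C R X" "y \<cdot> a \<in> hom C R X" "y \<cdot> b \<in> hom C R X" using th y ab by simp_all
      have z: "\<mu> (t \<cdot> a) (y \<cdot> a) = zero_map R X" "\<mu> (t \<cdot> a) (y \<cdot> b) = zero_map R X"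
        using \<mu>c[OF th y ab(1)] \<mu>c[OF th y ab(2)] ty ab o by simp_all
      have "y \<cdot> a = \<mu> (y \<cdot> a) (\<mu> (t \<cdot> a) (y \<cdot> b))" using z \<mu>r[OF h(2)] by simp
      also have "\<dots> = \<mu> (\<mu> (t \<cdot> a) (y \<cdot> a)) (y \<cdot> b)"
        using \<mu>_assoc[OF h(2,1,3)] \<mu>_comm[OF h(2,1)] by simp
      also have "\<dots> = y \<cdot> b" using z \<mu>l[OF h(3)] by simp
      finally show ?thesis .
    qed
    have "\<exists>i. i \<in> hom C X X \<and> i \<cdot> t = y"
      by (rule cover_factor[OF d(1) y]) (use ya in \<open>blast+\<close>)
    then obtain i where i: "i \<in> hom C X X" "i \<cdot> t = y" by blast
    have "\<mu> (Idn C X) i \<cdot> t = zero_map X X \<cdot> t" using \<mu>c[OF iX i(1) th] i th ty o by simp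
    then have "\<mu> (Idn C X) i = zero_map X X" using cover_epi[OF d(1) \<mu>h[OF iX i(1)] zX] by blast
    then show ?thesis using i by blast
  qed
  then obtain i where i: "i \<in> hom C X X" "\<mu> (Idn C X) i = zero_map X X" by blast
  have "internal_abelian_group C X P p q zero_obj m (zero_map zero_obj X) i"
    unfolding internal_abelian_group_def
  proof (intro conjI allI ballI impI)
    show "is_terminal C zero_obj" using zero_obj unfolding is_zero_def by blast
    show "zero_map zero_obj X \<in> hom C zero_obj X" using o by simp
    fix t assume "t \<in> hom C X zero_obj"
    then have t: "zero_map zero_obj X \<cdot> t = zero_map X X" using o by simp
    show "m \<cdot> pairing C p q (Idn C X) (zero_map zero_obj X \<cdot> t) = Idn C X" using \<mu>r[OF iX] t unfolding \<mu>_def by simp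
    show "m \<cdot> pairing C p q (Idn C X) i = zero_map zero_obj X \<cdot> t" using i(2) t unfolding \<mu>_def by simp
  qed (fact P m i(1) comm assoc)+
  then show ?thesis using o unfolding Ab_def by blast
qed

text \<open>The unit of an internal group is the zero map, since its domain is a terminal and thus a zero object.\<close>

lemma Ab_unital_mult:
  assumes "X \<in> Ab C"
  obtains P p q m where "unital_mult X P p q m"
proof -
  obtain P p q Z m e i where A: "internal_abelian_group C X P p q Z m e i" and oX: "X \<in> Obj C"
    using assms unfolding Ab_def by blast
  have P: "is_product C X X P p q" and Z: "is_terminal C Z" and m: "m \<in> hom C P X" and e: "e \<in> hom C Z X"
    and comm: "m \<cdot> pairing C p q q p = m"
    and un: "\<And>t. t \<in> hom C X Z \<Longrightarrow> m \<cdot> pairing C p q (Idn C X) (e \<cdot> t) = Idn C X"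
    using A unfolding internal_abelian_group_def by blast+
  note pq = product_typing[OF P]
  have oZ: "Z \<in> Obj C" using e by auto
  have iX: "Idn C X \<in> hom C X X" and zX: "zero_map X X \<in> hom C X X" using oX by simp_all
  obtain t where t: "t \<in> hom C X Z" using Z oX unfolding is_terminal_def by blast
  have "Idn C Z = zero_map Z Z"
  proof -
    have "Idn C Z \<in> hom C Z Z" "zero_map Z Z \<in> hom C Z Z" using oZ by simp_all
    then show ?thesis using Z oZ unfolding is_terminal_def by blast
  qed
  then have "e = zero_map Z X" using idn_laws(1)[of e Z] e oZ by simp
  then have "e \<cdot> t = zero_map X X" using t oX by simp
  then have un': "m \<cdot> pairing C p q (Idn C X) (zero_map X X) = Idn C X" using un[OF t] by simp
  note pi = pairing_props[OF P iX zX] and sw = pairing_props[OF P pq(2,1)]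
  have r: "m \<cdot> h = p \<cdot> h" if h: "h \<in> hom C T P" "q \<cdot> h = zero_map T X" for T h
  proof -
    have ph: "p \<cdot> h \<in> hom C T X" using h pq by simp
    have "h = pairing C p q (Idn C X) (zero_map X X) \<cdot> (p \<cdot> h)"
      by (rule product_mono[OF P, of _ T])
        (use h ph pi pq oX triangle_comp[OF pi(2), of "p \<cdot> h"] triangle_comp[OF pi(3), of "p \<cdot> h"] in simp_all)
    then have "m \<cdot> h = m \<cdot> (pairing C p q (Idn C X) (zero_map X X) \<cdot> (p \<cdot> h))" by simp
    also have "\<dots> = p \<cdot> h" using triangle_comp[OF un', of "p \<cdot> h"] pi(1) m ph by simp
    finally show ?thesis .
  qed
  have l: "m \<cdot> h = q \<cdot> h" if h: "h \<in> hom C T P" "p \<cdot> h = zero_map T X" for T h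
  proof -
    have sh: "pairing C p q q p \<cdot> h \<in> hom C T P" using h sw(1) by simp
    have "p \<cdot> (pairing C p q q p \<cdot> h) = q \<cdot> h" "q \<cdot> (pairing C p q q p \<cdot> h) = p \<cdot> h"
      using triangle_comp[OF sw(2), of h] triangle_comp[OF sw(3), of h] sw(1) h(1) pq by simp_all
    then have "m \<cdot> (pairing C p q q p \<cdot> h) = q \<cdot> h" using r[OF sh] h(2) by simp
    then show ?thesis using triangle_comp[OF comm, of h] sw(1) h(1) m by simp
  qed
  have "unital_mult X P p q m" unfolding unital_mult_def using P m r l by blast
  then show thesis by (rule that)
qed

end

context semi_abelian_cat begin

text \<open>This form covers both quotients of abelian objects, where \<open>w\<close> is the multiplication followed by \<open>q\<close>, and the
  reflection, where \<open>X\<close> itself carries no multiplication. The map \<open>w\<close> is compatible with the kernel pair of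
  \<open>q \<times> q\<close>: the two maps on \<open>E \<times> E\<close> to be compared, with \<open>E\<close> the kernel pair of \<open>q\<close>, agree on the axes.\<close>

lemma quotient_in_Ab:
  assumes q: "cover q X Y" and P: "is_product C X X P p1 p2" and w: "w \<in> hom C P Y"
    and w1: "\<And>T h. h \<in> hom C T P \<Longrightarrow> p2 \<cdot> h = zero_map T X \<Longrightarrow> w \<cdot> h = q \<cdot> (p1 \<cdot> h)"
    and w2: "\<And>T h. h \<in> hom C T P \<Longrightarrow> p1 \<cdot> h = zero_map T X \<Longrightarrow> w \<cdot> h = q \<cdot> (p2 \<cdot> h)"
  shows "Y \<in> Ab C"
proof -
  note pp = product_typing[OF P]
  have qh: "q \<in> hom C X Y" and o: "X \<in> Obj C" "Y \<in> Obj C" using q by auto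
  obtain Q r1 r2 where Q: "is_product C Y Y Q r1 r2" by (rule product_exists[OF o(2,2)], rule that)
  note rr = product_typing[OF Q]
  have oQ: "Q \<in> Obj C" using rr by auto
  have 1: "q \<cdot> p1 \<in> hom C P Y" "q \<cdot> p2 \<in> hom C P Y" using pp qh by simp_all
  obtain s where s: "s \<in> hom C P Q" "r1 \<cdot> s = q \<cdot> p1" "r2 \<cdot> s = q \<cdot> p2" by (rule product_lift[OF Q 1], rule that)
  have rs: "r1 \<cdot> (s \<cdot> h) = q \<cdot> (p1 \<cdot> h)" "r2 \<cdot> (s \<cdot> h) = q \<cdot> (p2 \<cdot> h)" if "h \<in> hom C T P" for h T
    using square_comp[OF s(2), of h] square_comp[OF s(3), of h] that s(1) rr pp qh by simp_all
  have sc: "cover s P Q"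
  proof -
    obtain S t x where t: "cover t S Q" "x \<in> hom C S X" "q \<cdot> x = r1 \<cdot> t" by (rule local_lift[OF q rr(1)], rule that)
    have r2t: "r2 \<cdot> t \<in> hom C S Y" using rr t(1) by simp
    obtain S' t' y where t': "cover t' S' S" "y \<in> hom C S' X" "q \<cdot> y = (r2 \<cdot> t) \<cdot> t'"
      by (rule local_lift[OF q r2t], rule that)
    have xt: "x \<cdot> t' \<in> hom C S' X" using t(2) t'(1) by simp
    obtain z where z: "z \<in> hom C S' P" "p1 \<cdot> z = x \<cdot> t'" "p2 \<cdot> z = y" by (rule product_lift[OF P xt t'(2)], rule that)
    have tt: "cover (t \<cdot> t') S' Q" by (rule cover_comp[OF t'(1) t(1)])
    have sz: "s \<cdot> z \<in> hom C S' Q" using s(1) z(1) by simp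
    have tth: "t \<cdot> t' \<in> hom C S' Q" using tt by simp
    have "s \<cdot> z = t \<cdot> t'"
    proof (rule product_mono[OF Q sz tth])
      show "r1 \<cdot> s \<cdot> z = r1 \<cdot> t \<cdot> t'" using rs(1)[OF z(1)] z(2) square_comp[OF t(3), of t'] t(1,2) t'(1) qh rr by simp
      show "r2 \<cdot> s \<cdot> z = r2 \<cdot> t \<cdot> t'" using rs(2)[OF z(1)] z(3) t'(1,3) t(1) rr by simp
    qed
    then have "cover (s \<cdot> z) S' Q" using tt by simp
    then show ?thesis by (rule cover_cancel[OF _ s(1) z(1)])
  qed
  obtain E d1 d2 where E: "is_pullback C q q d1 d2" "d1 \<in> hom C E X" "d2 \<in> hom C E X" "q \<cdot> d1 = q \<cdot> d2"
    by (rule pullback_exists[OF qh qh], rule that)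
  have oE: "E \<in> Obj C" using E by auto
  obtain F e1 e2 where F: "is_product C E E F e1 e2" by (rule product_exists[OF oE oE], rule that)
  note ee = product_typing[OF F]
  have de: "d1 \<cdot> e1 \<in> hom C F X" "d1 \<cdot> e2 \<in> hom C F X" "d2 \<cdot> e1 \<in> hom C F X" "d2 \<cdot> e2 \<in> hom C F X"
    using E ee by simp_all
  obtain f where f: "f \<in> hom C F P" "p1 \<cdot> f = d1 \<cdot> e1" "p2 \<cdot> f = d1 \<cdot> e2" by (rule product_lift[OF P de(1,2)], rule that)
  obtain g where g: "g \<in> hom C F P" "p1 \<cdot> g = d2 \<cdot> e1" "p2 \<cdot> g = d2 \<cdot> e2" by (rule product_lift[OF P de(3,4)], rule that)
  have pf: "p1 \<cdot> (f \<cdot> h) = d1 \<cdot> (e1 \<cdot> h)" "p2 \<cdot> (f \<cdot> h) = d1 \<cdot> (e2 \<cdot> h)"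
      "p1 \<cdot> (g \<cdot> h) = d2 \<cdot> (e1 \<cdot> h)" "p2 \<cdot> (g \<cdot> h) = d2 \<cdot> (e2 \<cdot> h)" if "h \<in> hom C T F" for h T
    using square_comp[OF f(2), of h] square_comp[OF f(3), of h] square_comp[OF g(2), of h] square_comp[OF g(3), of h]
      that f(1) g(1) pp E(2,3) ee by simp_all
  have qd: "q \<cdot> (d1 \<cdot> h) = q \<cdot> (d2 \<cdot> h)" if "h \<in> hom C T E" for h T
    using square_comp[OF E(4), of h] that E(2,3) qh by simp
  have wfh: "w \<cdot> f \<in> hom C F Y" "w \<cdot> g \<in> hom C F Y" using w f(1) g(1) by simp_all
  have wfg: "w \<cdot> f = w \<cdot> g"
  proof (rule axes_epic[OF F wfh])
    fix T h assume h: "h \<in> hom C T F" and ax: "e1 \<cdot> h = zero_map T E \<or> e2 \<cdot> h = zero_map T E"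
    have oT: "T \<in> Obj C" using h by auto
    have fh: "f \<cdot> h \<in> hom C T P" "g \<cdot> h \<in> hom C T P" and eh: "e1 \<cdot> h \<in> hom C T E" "e2 \<cdot> h \<in> hom C T E"
      using f(1) g(1) h ee by simp_all
    have dz: "d1 \<cdot> zero_map T E = zero_map T X" "d2 \<cdot> zero_map T E = zero_map T X" using E(2,3) oT by simp_all
    have "w \<cdot> (f \<cdot> h) = w \<cdot> (g \<cdot> h)"
      using ax
    proof
      assume "e1 \<cdot> h = zero_map T E"
      then have "p1 \<cdot> (f \<cdot> h) = zero_map T X" "p1 \<cdot> (g \<cdot> h) = zero_map T X" using pf[OF h] dz by simp_all
      then show ?thesis using w2[OF fh(1)] w2[OF fh(2)] pf[OF h] qd[OF eh(2)] by simp
    next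
      assume "e2 \<cdot> h = zero_map T E"
      then have "p2 \<cdot> (f \<cdot> h) = zero_map T X" "p2 \<cdot> (g \<cdot> h) = zero_map T X" using pf[OF h] dz by simp_all
      then show ?thesis using w1[OF fh(1)] w1[OF fh(2)] pf[OF h] qd[OF eh(1)] by simp
    qed
    then show "(w \<cdot> f) \<cdot> h = (w \<cdot> g) \<cdot> h" using w f(1) g(1) h by simp
  qed
  have wab: "w \<cdot> a = w \<cdot> b" if a: "a \<in> hom C S P" and b: "b \<in> hom C S P" and ab: "s \<cdot> a = s \<cdot> b" for S a b
  proof -
    have 2: "p1 \<cdot> a \<in> hom C S X" "p1 \<cdot> b \<in> hom C S X" "p2 \<cdot> a \<in> hom C S X" "p2 \<cdot> b \<in> hom C S X"
      using pp a b by simp_all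
    have 3: "q \<cdot> (p1 \<cdot> a) = q \<cdot> (p1 \<cdot> b)" "q \<cdot> (p2 \<cdot> a) = q \<cdot> (p2 \<cdot> b)"
      using rs[OF a] rs[OF b] ab by simp_all
    obtain k1 where k1: "k1 \<in> hom C S (Dom C d1)" "d1 \<cdot> k1 = p1 \<cdot> a" "d2 \<cdot> k1 = p1 \<cdot> b"
      by (rule pullback_lift[OF E(1) qh qh 2(1,2) 3(1)], rule that)
    obtain k2 where k2: "k2 \<in> hom C S (Dom C d1)" "d1 \<cdot> k2 = p2 \<cdot> a" "d2 \<cdot> k2 = p2 \<cdot> b"
      by (rule pullback_lift[OF E(1) qh qh 2(3,4) 3(2)], rule that)
    have kh: "k1 \<in> hom C S E" "k2 \<in> hom C S E" using k1(1) k2(1) E(2) by simp_all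
    obtain k where k: "k \<in> hom C S F" "e1 \<cdot> k = k1" "e2 \<cdot> k = k2" by (rule product_lift[OF F kh], rule that)
    have fk: "f \<cdot> k \<in> hom C S P" "g \<cdot> k \<in> hom C S P" using f(1) g(1) k(1) by simp_all
    have "f \<cdot> k = a" by (rule product_mono[OF P fk(1) a]) (use pf[OF k(1)] k k1 k2 in simp_all)
    moreover have "g \<cdot> k = b" by (rule product_mono[OF P fk(2) b]) (use pf[OF k(1)] k k1 k2 in simp_all)
    ultimately show ?thesis using square_comp[OF wfg, of k] w f(1) g(1) k(1) by simp
  qed
  have "\<exists>m. m \<in> hom C Q Y \<and> m \<cdot> s = w"
    by (rule cover_factor[OF sc w]) (use wab in \<open>blast+\<close>)
  then obtain m where m: "m \<in> hom C Q Y" "m \<cdot> s = w" by blast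
  have ms: "m \<cdot> (s \<cdot> k) = w \<cdot> k" if "k \<in> hom C S P" for k S
    using triangle_comp[OF m(2), of k] m(1) s(1) that by simp
  have m1: "m \<cdot> h = r1 \<cdot> h" if h: "h \<in> hom C T Q" and z: "r2 \<cdot> h = zero_map T Y" for h T
  proof -
    have rh: "r1 \<cdot> h \<in> hom C T Y" "m \<cdot> h \<in> hom C T Y" and oT: "T \<in> Obj C" using rr h m(1) by auto
    obtain S t x where t: "cover t S T" "x \<in> hom C S X" "q \<cdot> x = (r1 \<cdot> h) \<cdot> t" by (rule local_lift[OF q rh(1)], rule that)
    have oS: "S \<in> Obj C" using t(2) by auto
    have zx: "zero_map S X \<in> hom C S X" using oS o by simp
    obtain k where k: "k \<in> hom C S P" "p1 \<cdot> k = x" "p2 \<cdot> k = zero_map S X" by (rule product_lift[OF P t(2) zx], rule that)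
    have th: "t \<in> hom C S T" using t(1) by simp
    have sk: "s \<cdot> k \<in> hom C S Q" "h \<cdot> t \<in> hom C S Q" using s(1) k(1) h th by simp_all
    have "s \<cdot> k = h \<cdot> t"
    proof (rule product_mono[OF Q sk])
      show "r1 \<cdot> s \<cdot> k = r1 \<cdot> h \<cdot> t" using rs(1)[OF k(1)] k(2) t(3) rr h th by simp
      show "r2 \<cdot> s \<cdot> k = r2 \<cdot> h \<cdot> t"
        using rs(2)[OF k(1)] k(3) triangle_comp[OF z, of t] rr h th qh oS o by simp
    qed
    then have "m \<cdot> (h \<cdot> t) = q \<cdot> x" using ms[OF k(1)] w1[OF k(1,3)] k(2) by simp
    then have "(m \<cdot> h) \<cdot> t = (r1 \<cdot> h) \<cdot> t" using t(3) m(1) h th by simp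
    then show ?thesis by (rule cover_epi[OF t(1) rh(2,1)])
  qed
  have m2: "m \<cdot> h = r2 \<cdot> h" if h: "h \<in> hom C T Q" and z: "r1 \<cdot> h = zero_map T Y" for h T
  proof -
    have rh: "r2 \<cdot> h \<in> hom C T Y" "m \<cdot> h \<in> hom C T Y" and oT: "T \<in> Obj C" using rr h m(1) by auto
    obtain S t x where t: "cover t S T" "x \<in> hom C S X" "q \<cdot> x = (r2 \<cdot> h) \<cdot> t" by (rule local_lift[OF q rh(1)], rule that)
    have oS: "S \<in> Obj C" using t(2) by auto
    have zx: "zero_map S X \<in> hom C S X" using oS o by simp
    obtain k where k: "k \<in> hom C S P" "p1 \<cdot> k = zero_map S X" "p2 \<cdot> k = x" by (rule product_lift[OF P zx t(2)], rule that)
    have th: "t \<in> hom C S T" using t(1) by simp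
    have sk: "s \<cdot> k \<in> hom C S Q" "h \<cdot> t \<in> hom C S Q" using s(1) k(1) h th by simp_all
    have "s \<cdot> k = h \<cdot> t"
    proof (rule product_mono[OF Q sk])
      show "r2 \<cdot> s \<cdot> k = r2 \<cdot> h \<cdot> t" using rs(2)[OF k(1)] k(3) t(3) rr h th by simp
      show "r1 \<cdot> s \<cdot> k = r1 \<cdot> h \<cdot> t"
        using rs(1)[OF k(1)] k(2) triangle_comp[OF z, of t] rr h th qh oS o by simp
    qed
    then have "m \<cdot> (h \<cdot> t) = q \<cdot> x" using ms[OF k(1)] w2[OF k(1,2)] k(3) by simp
    then have "(m \<cdot> h) \<cdot> t = (r2 \<cdot> h) \<cdot> t" using t(3) m(1) h th by simp
    then show ?thesis by (rule cover_epi[OF t(1) rh(2,1)])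
  qed
  have "unital_mult Y Q r1 r2 m" unfolding unital_mult_def using Q m(1) m1 m2 by blast
  then show ?thesis by (rule unital_mult_in_Ab)
qed

lemma Ab_quotient:
  assumes q: "cover q X Y" and X: "X \<in> Ab C"
  shows "Y \<in> Ab C"
proof -
  obtain P p1 p2 m where U: "unital_mult X P p1 p2 m" by (rule Ab_unital_mult[OF X], rule that)
  note P = unital_multD(1)[OF U] and m = unital_multD(2)[OF U] and D = unital_multD(3,4)[OF U]
  note pp = product_typing[OF P]
  have qm: "q \<cdot> m \<in> hom C P Y" using q m by simp
  show ?thesis
  proof (rule quotient_in_Ab[OF q P qm])
    fix T h assume h: "h \<in> hom C T P"
    have 1: "(q \<cdot> m) \<cdot> h = q \<cdot> (m \<cdot> h)" using q m h by simp
    show "(q \<cdot> m) \<cdot> h = q \<cdot> (p1 \<cdot> h)" if "p2 \<cdot> h = zero_map T X" using D(1)[OF h that] 1 by simp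
    show "(q \<cdot> m) \<cdot> h = q \<cdot> (p2 \<cdot> h)" if "p1 \<cdot> h = zero_map T X" using D(2)[OF h that] 1 by simp
  qed
qed

text \<open>The pairs of elements of \<open>X\<close> whose product lies in \<open>X\<close> form a subobject of the square that contains both
  axes.\<close>

lemma Ab_subobject:
  assumes s: "monic C s" "s \<in> hom C X Y" and Y: "Y \<in> Ab C"
  shows "X \<in> Ab C"
proof -
  obtain Q r1 r2 m where U: "unital_mult Y Q r1 r2 m" by (rule Ab_unital_mult[OF Y], rule that)
  note Q = unital_multD(1)[OF U] and m = unital_multD(2)[OF U] and D = unital_multD(3,4)[OF U]
  note rr = product_typing[OF Q]
  have o: "X \<in> Obj C" "Y \<in> Obj C" using s by auto
  obtain P p1 p2 where P: "is_product C X X P p1 p2" by (rule product_exists[OF o(1,1)], rule that)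
  note pp = product_typing[OF P]
  have 1: "s \<cdot> p1 \<in> hom C P Y" "s \<cdot> p2 \<in> hom C P Y" using pp s(2) by simp_all
  obtain ss where ss: "ss \<in> hom C P Q" "r1 \<cdot> ss = s \<cdot> p1" "r2 \<cdot> ss = s \<cdot> p2" by (rule product_lift[OF Q 1], rule that)
  have rs: "r1 \<cdot> (ss \<cdot> h) = s \<cdot> (p1 \<cdot> h)" "r2 \<cdot> (ss \<cdot> h) = s \<cdot> (p2 \<cdot> h)" if "h \<in> hom C T P" for h T
    using square_comp[OF ss(2), of h] square_comp[OF ss(3), of h] that ss(1) rr pp s(2) by simp_all
  have axis: "m \<cdot> (ss \<cdot> h) = s \<cdot> (p1 \<cdot> h)" if "h \<in> hom C T P" "p2 \<cdot> h = zero_map T X" for T h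
  proof -
    have "ss \<cdot> h \<in> hom C T Q" "r2 \<cdot> (ss \<cdot> h) = zero_map T Y" using ss(1) rs[OF that(1)] that s(2) o by auto
    then show ?thesis using D(1) rs[OF that(1)] by metis
  qed
  have axis': "m \<cdot> (ss \<cdot> h) = s \<cdot> (p2 \<cdot> h)" if "h \<in> hom C T P" "p1 \<cdot> h = zero_map T X" for T h
  proof -
    have "ss \<cdot> h \<in> hom C T Q" "r1 \<cdot> (ss \<cdot> h) = zero_map T Y" using ss(1) rs[OF that(1)] that s(2) o by auto
    then show ?thesis using D(2) rs[OF that(1)] by metis
  qed
  have f: "m \<cdot> ss \<in> hom C P Y" using m ss(1) by simp
  obtain N n k where N: "is_pullback C (m \<cdot> ss) s n k" "n \<in> hom C N P" "k \<in> hom C N X" "(m \<cdot> ss) \<cdot> n = s \<cdot> k"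
    by (rule pullback_exists[OF f s(2)], rule that)
  have nm: "monic C n"
    unfolding monic_def
  proof (intro conjI allI ballI impI)
    fix T g h assume "g \<in> hom C T (Dom C n)" "h \<in> hom C T (Dom C n)" and e: "n \<cdot> g = n \<cdot> h"
    then have gh: "g \<in> hom C T N" "h \<in> hom C T N" using N(2) by simp_all
    have kg: "k \<cdot> g \<in> hom C T X" "k \<cdot> h \<in> hom C T X" using gh N(3) by simp_all
    have "s \<cdot> (k \<cdot> g) = (m \<cdot> ss) \<cdot> (n \<cdot> g)" "s \<cdot> (k \<cdot> h) = (m \<cdot> ss) \<cdot> (n \<cdot> h)"
      using square_comp[OF N(4), of g] square_comp[OF N(4), of h] gh N(2,3) f s(2) by simp_all
    then have "k \<cdot> g = k \<cdot> h" using mono_cancel[OF s kg] e by simp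
    then show "g = h" using pullback_mono[OF N(1), of g T h] e gh N(2) by simp
  qed (use N(2) in simp)
  have fac: "\<exists>k. k \<in> hom C T N \<and> n \<cdot> k = h" if h: "h \<in> hom C T P" and z: "p1 \<cdot> h = zero_map T X \<or> p2 \<cdot> h = zero_map T X" for T h
  proof -
    have ph: "p1 \<cdot> h \<in> hom C T X" "p2 \<cdot> h \<in> hom C T X" using pp h by simp_all
    have 2: "(m \<cdot> ss) \<cdot> h = m \<cdot> (ss \<cdot> h)" using m ss(1) h by simp
    have "\<exists>x. x \<in> hom C T X \<and> (m \<cdot> ss) \<cdot> h = s \<cdot> x" using z axis[OF h] axis'[OF h] ph 2 by metis
    then obtain x where x: "x \<in> hom C T X" "(m \<cdot> ss) \<cdot> h = s \<cdot> x" by blast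
    obtain l where l: "l \<in> hom C T (Dom C n)" "n \<cdot> l = h" "k \<cdot> l = x"
      by (rule pullback_lift[OF N(1) f s(2) h x], rule that)
    then show ?thesis using N(2) by auto
  qed
  have iP: "Idn C P \<in> hom C P P" using pp by auto
  have "\<exists>k. k \<in> hom C P N \<and> n \<cdot> k = Idn C P"
    by (rule axes_generate[OF P nm N(2) _ iP]) (use fac in blast)
  then obtain j where j: "j \<in> hom C P N" "n \<cdot> j = Idn C P" by blast
  define m' where "m' = k \<cdot> j"
  have m'h: "m' \<in> hom C P X" using j N(3) unfolding m'_def by simp
  have "(m \<cdot> ss) \<cdot> (n \<cdot> j) = s \<cdot> (k \<cdot> j)" using square_comp[OF N(4), of j] j(1) N(2,3) f s(2) by simp
  then have sm: "s \<cdot> m' = m \<cdot> ss" using j(2) f unfolding m'_def by simp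
  have smh: "s \<cdot> (m' \<cdot> h) = m \<cdot> (ss \<cdot> h)" if "h \<in> hom C T P" for h T
    using square_comp[OF sm, of h] m'h s(2) m ss(1) that by simp
  have "unital_mult X P p1 p2 m'"
    unfolding unital_mult_def
  proof (intro conjI allI impI)
    fix T h assume h: "h \<in> hom C T P"
    have 3: "m' \<cdot> h \<in> hom C T X" "p1 \<cdot> h \<in> hom C T X" "p2 \<cdot> h \<in> hom C T X" using m'h h pp by simp_all
    show "m' \<cdot> h = p1 \<cdot> h" if "p2 \<cdot> h = zero_map T X"
      using mono_cancel[OF s 3(1,2)] smh[OF h] axis[OF h that] by simp
    show "m' \<cdot> h = p2 \<cdot> h" if "p1 \<cdot> h = zero_map T X"
      using mono_cancel[OF s 3(1,3)] smh[OF h] axis'[OF h that] by simp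
  qed (fact P m'h)+
  then show ?thesis by (rule unital_mult_in_Ab)
qed

text \<open>The reflection \<open>r : X \<rightarrow> Q\<close> is the pushout of \<open>\<epsilon> : X + X \<rightarrow> X \<times> X\<close>, the inclusion of the axes, along the
  codiagonal \<open>\<delta>\<close>. The opposite side \<open>w : X \<times> X \<rightarrow> Q\<close> of the pushout square restricts to \<open>r\<close> on both axes, so it
  induces a multiplication on \<open>Q\<close>. An arrow \<open>f\<close> to an abelian object \<open>Y\<close> and the induced map from \<open>X \<times> X\<close>
  to \<open>Y\<close> agree on \<open>X + X\<close>, so \<open>f\<close> factors through the pushout.\<close>

lemma Ab_reflection:
  assumes X: "X \<in> Obj C"
  shows "\<exists>r. is_reflection C (Ab C) X r"
proof -
  obtain P p1 p2 where P: "is_product C X X P p1 p2" by (rule product_exists[OF X X], rule that)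
  note pp = product_typing[OF P]
  have oP: "P \<in> Obj C" using pp by auto
  have iX: "Idn C X \<in> hom C X X" and zX: "zero_map X X \<in> hom C X X" and iP: "Idn C P \<in> hom C P P" using X oP by simp_all
  obtain S i j where S: "is_coproduct C X X S i j"
    using sa X unfolding semi_abelian_def has_binary_coproducts_def by blast
  have ij: "i \<in> hom C X S" "j \<in> hom C X S" using S unfolding is_coproduct_def by blast+
  have cop: "\<exists>!h. h \<in> hom C S T \<and> h \<cdot> i = x \<and> h \<cdot> j = y" if "x \<in> hom C X T" "y \<in> hom C X T" for x y T
    using S that unfolding is_coproduct_def by blast
  obtain \<delta> where N: "\<delta> \<in> hom C S X" "\<delta> \<cdot> i = Idn C X" "\<delta> \<cdot> j = Idn C X" using cop[OF iX iX] by blast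
  obtain a where a: "a \<in> hom C X P" "p1 \<cdot> a = Idn C X" "p2 \<cdot> a = zero_map X X" by (rule product_lift[OF P iX zX], rule that)
  obtain b where b: "b \<in> hom C X P" "p1 \<cdot> b = zero_map X X" "p2 \<cdot> b = Idn C X" by (rule product_lift[OF P zX iX], rule that)
  obtain \<epsilon> where E: "\<epsilon> \<in> hom C S P" "\<epsilon> \<cdot> i = a" "\<epsilon> \<cdot> j = b" using cop[OF a(1) b(1)] by blast
  have Nc: "cover \<delta> S X" by (rule split_epi_cover[OF N(1) ij(1) N(2)])
  have Nx: "\<delta> \<cdot> (i \<cdot> x) = x" "\<delta> \<cdot> (j \<cdot> x) = x" "\<epsilon> \<cdot> (i \<cdot> x) = a \<cdot> x" "\<epsilon> \<cdot> (j \<cdot> x) = b \<cdot> x"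
    if "x \<in> hom C T X" for x T
    using triangle_comp[OF N(2), of x] triangle_comp[OF N(3), of x] triangle_comp[OF E(2), of x] triangle_comp[OF E(3), of x]
      that N(1) E(1) ij by simp_all
  have ax1: "\<epsilon> \<cdot> (i \<cdot> (p1 \<cdot> h)) = h" if h: "h \<in> hom C T P" "p2 \<cdot> h = zero_map T X" for h T
  proof -
    have ph: "p1 \<cdot> h \<in> hom C T X" using pp h by simp
    have "a \<cdot> (p1 \<cdot> h) = h"
      by (rule product_mono[OF P, of _ T])
        (use ph h a(1) pp X triangle_comp[OF a(2), of "p1 \<cdot> h"] triangle_comp[OF a(3), of "p1 \<cdot> h"] in simp_all)
    then show ?thesis using Nx(3)[OF ph] by simp
  qed
  have ax2: "\<epsilon> \<cdot> (j \<cdot> (p2 \<cdot> h)) = h" if h: "h \<in> hom C T P" "p1 \<cdot> h = zero_map T X" for h T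
  proof -
    have ph: "p2 \<cdot> h \<in> hom C T X" using pp h by simp
    have "b \<cdot> (p2 \<cdot> h) = h"
      by (rule product_mono[OF P, of _ T])
        (use ph h b(1) pp X triangle_comp[OF b(2), of "p2 \<cdot> h"] triangle_comp[OF b(3), of "p2 \<cdot> h"] in simp_all)
    then show ?thesis using Nx(4)[OF ph] by simp
  qed
  have Ec: "cover \<epsilon> S P"
  proof -
    obtain I c n where I: "cover c S I" "n \<in> hom C I P" "monic C n" "n \<cdot> c = \<epsilon>" by (rule image_exists[OF E(1)], rule that)
    have fac: "\<exists>k. k \<in> hom C T I \<and> n \<cdot> k = h" if h: "h \<in> hom C T P" and z: "p1 \<cdot> h = zero_map T X \<or> p2 \<cdot> h = zero_map T X" for T h
    proof -
      have ph: "i \<cdot> (p1 \<cdot> h) \<in> hom C T S" "j \<cdot> (p2 \<cdot> h) \<in> hom C T S" using pp h ij by simp_all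
      obtain x where x: "x \<in> hom C T S" "\<epsilon> \<cdot> x = h" using z ax1[OF h] ax2[OF h] ph by blast
      have "n \<cdot> (c \<cdot> x) = h" using triangle_comp[OF I(4), of x] x I(1,2) by simp
      then show ?thesis using x(1) I(1) by (intro exI[of _ "c \<cdot> x"]) simp
    qed
    have "\<exists>k. k \<in> hom C P I \<and> n \<cdot> k = Idn C P"
      by (rule axes_generate[OF P I(3,2) _ iP]) (use fac in blast)
    then obtain k where k: "k \<in> hom C P I" "n \<cdot> k = Idn C P" by blast
    show ?thesis using cover_comp[OF I(1) split_epi_cover[OF I(2) k]] I(4) by simp
  qed
  obtain Q r where r: "cover r X Q"
    "\<And>T x1 x2. x1 \<in> hom C T S \<Longrightarrow> x2 \<in> hom C T S \<Longrightarrow> \<epsilon> \<cdot> x1 = \<epsilon> \<cdot> x2 \<Longrightarrow> r \<cdot> (\<delta> \<cdot> x1) = r \<cdot> (\<delta> \<cdot> x2)"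
    "\<And>T y1 y2. y1 \<in> hom C T X \<Longrightarrow> y2 \<in> hom C T X \<Longrightarrow> r \<cdot> y1 = r \<cdot> y2 \<Longrightarrow>
       \<exists>V t x1 x2. cover t V T \<and> x1 \<in> hom C V S \<and> x2 \<in> hom C V S \<and> \<epsilon> \<cdot> x1 = \<epsilon> \<cdot> x2 \<and>
         \<delta> \<cdot> x1 = y1 \<cdot> t \<and> \<delta> \<cdot> x2 = y2 \<cdot> t"
    by (rule quotient_by_image_relation[OF Nc E(1)], rule that)
  have rh: "r \<in> hom C X Q" using r(1) by simp
  have rN: "r \<cdot> \<delta> \<in> hom C S Q" using rh N(1) by simp
  have "\<exists>w. w \<in> hom C P Q \<and> w \<cdot> \<epsilon> = r \<cdot> \<delta>"
  proof (rule cover_factor[OF Ec rN])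
    fix T x1 x2 assume x: "x1 \<in> hom C T S" "x2 \<in> hom C T S" "\<epsilon> \<cdot> x1 = \<epsilon> \<cdot> x2"
    show "(r \<cdot> \<delta>) \<cdot> x1 = (r \<cdot> \<delta>) \<cdot> x2" using r(2)[OF x] x(1,2) rh N(1) by simp
  qed blast
  then obtain w where w: "w \<in> hom C P Q" "w \<cdot> \<epsilon> = r \<cdot> \<delta>" by blast
  have wE: "w \<cdot> (\<epsilon> \<cdot> x) = r \<cdot> (\<delta> \<cdot> x)" if "x \<in> hom C T S" for x T
    using square_comp[OF w(2), of x] w(1) E(1) rh N(1) that by simp
  have Q: "Q \<in> Ab C"
  proof (rule quotient_in_Ab[OF r(1) P w(1)])
    fix T h assume h: "h \<in> hom C T P"
    have ph: "p1 \<cdot> h \<in> hom C T X" "p2 \<cdot> h \<in> hom C T X" using pp h by simp_all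
    have iph: "i \<cdot> (p1 \<cdot> h) \<in> hom C T S" "j \<cdot> (p2 \<cdot> h) \<in> hom C T S" using ph ij by simp_all
    show "w \<cdot> h = r \<cdot> (p1 \<cdot> h)" if "p2 \<cdot> h = zero_map T X"
      using wE[OF iph(1)] ax1[OF h that] Nx(1)[OF ph(1)] by simp
    show "w \<cdot> h = r \<cdot> (p2 \<cdot> h)" if "p1 \<cdot> h = zero_map T X"
      using wE[OF iph(2)] ax2[OF h that] Nx(2)[OF ph(2)] by simp
  qed
  have univ: "\<exists>!g. g \<in> hom C Q Y \<and> g \<cdot> r = f" if Y: "Y \<in> Ab C" and f: "f \<in> hom C X Y" for Y f
  proof -
    obtain R r1 r2 m where U: "unital_mult Y R r1 r2 m" by (rule Ab_unital_mult[OF Y], rule that)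
    note R = unital_multD(1)[OF U] and m = unital_multD(2)[OF U] and D = unital_multD(3,4)[OF U]
    note rr = product_typing[OF R]
    have oY: "Y \<in> Obj C" using f by auto
    have 1: "f \<cdot> p1 \<in> hom C P Y" "f \<cdot> p2 \<in> hom C P Y" using f pp by simp_all
    obtain ff where ff: "ff \<in> hom C P R" "r1 \<cdot> ff = f \<cdot> p1" "r2 \<cdot> ff = f \<cdot> p2" by (rule product_lift[OF R 1], rule that)
    have rf: "r1 \<cdot> (ff \<cdot> x) = f \<cdot> (p1 \<cdot> x)" "r2 \<cdot> (ff \<cdot> x) = f \<cdot> (p2 \<cdot> x)" if "x \<in> hom C T P" for x T
      using square_comp[OF ff(2), of x] square_comp[OF ff(3), of x] that ff(1) rr f pp by simp_all
    have ffa: "ff \<cdot> a \<in> hom C X R" "ff \<cdot> b \<in> hom C X R" using ff(1) a(1) b(1) by simp_all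
    have 2: "m \<cdot> (ff \<cdot> a) = f" using D(1)[OF ffa(1)] rf[OF a(1)] a(2,3) f X by simp
    have 3: "m \<cdot> (ff \<cdot> b) = f" using D(2)[OF ffa(2)] rf[OF b(1)] b(2,3) f X by simp
    have 4: "m \<cdot> (ff \<cdot> \<epsilon>) \<in> hom C S Y" "f \<cdot> \<delta> \<in> hom C S Y" using m ff(1) E(1) f N(1) by simp_all
    have 5: "(m \<cdot> (ff \<cdot> \<epsilon>)) \<cdot> i = f" "(m \<cdot> (ff \<cdot> \<epsilon>)) \<cdot> j = f" "(f \<cdot> \<delta>) \<cdot> i = f" "(f \<cdot> \<delta>) \<cdot> j = f"
      using 2 3 m ff(1) E ij f N by simp_all
    have mf: "m \<cdot> (ff \<cdot> \<epsilon>) = f \<cdot> \<delta>" using cop[OF f f] 4 5 by blast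
    have mfx: "f \<cdot> (\<delta> \<cdot> x) = m \<cdot> (ff \<cdot> (\<epsilon> \<cdot> x))" if "x \<in> hom C T S" for x T
    proof -
      have "(m \<cdot> (ff \<cdot> \<epsilon>)) \<cdot> x = (f \<cdot> \<delta>) \<cdot> x" using mf by simp
      then show ?thesis using m ff(1) E(1) f N(1) that by simp
    qed
    have "\<exists>g. g \<in> hom C Q Y \<and> g \<cdot> r = f"
    proof (rule cover_factor[OF r(1) f])
      fix T y1 y2 assume y: "y1 \<in> hom C T X" "y2 \<in> hom C T X" "r \<cdot> y1 = r \<cdot> y2"
      obtain V t x1 x2 where t: "cover t V T" "x1 \<in> hom C V S" "x2 \<in> hom C V S" "\<epsilon> \<cdot> x1 = \<epsilon> \<cdot> x2"
         "\<delta> \<cdot> x1 = y1 \<cdot> t" "\<delta> \<cdot> x2 = y2 \<cdot> t" using r(3)[OF y] by blast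
      have fy: "f \<cdot> y1 \<in> hom C T Y" "f \<cdot> y2 \<in> hom C T Y" using f y(1,2) by simp_all
      have "f \<cdot> (y1 \<cdot> t) = f \<cdot> (y2 \<cdot> t)" using mfx[OF t(2)] mfx[OF t(3)] t(4,5,6) by simp
      then have "(f \<cdot> y1) \<cdot> t = (f \<cdot> y2) \<cdot> t" using f y(1,2) t(1) by simp
      then show "f \<cdot> y1 = f \<cdot> y2" by (rule cover_epi[OF t(1) fy])
    qed blast
    then obtain g where g: "g \<in> hom C Q Y" "g \<cdot> r = f" by blast
    show ?thesis
    proof (rule ex1I[of _ g])
      fix k assume k: "k \<in> hom C Q Y \<and> k \<cdot> r = f"
      then show "k = g" using cover_epi[OF r(1), of k Y g] g by simp
    qed (use g in blast)
  qed
  have Dr: "r \<in> Arr C" "Dom C r = X" "Cod C r = Q" using rh by simp_all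
  have "is_reflection C (Ab C) X r" unfolding is_reflection_def Dr using Q univ Dr(1) by blast
  then show ?thesis by blast
qed

theorem Ab_birkhoff: "birkhoff C (Ab C)"
  unfolding birkhoff_def reflective_def
proof (intro conjI allI ballI impI)
  show "Ab C \<subseteq> Obj C" unfolding Ab_def by blast
next
  fix X assume "X \<in> Obj C" then show "\<exists>e. is_reflection C (Ab C) X e" by (rule Ab_reflection)
next
  fix m assume m: "monic C m \<and> Cod C m \<in> Ab C"
  then have "m \<in> hom C (Dom C m) (Cod C m)" unfolding monic_def by simp
  then show "Dom C m \<in> Ab C" using Ab_subobject m by blast
next
  fix q assume q: "regular_epi C q \<and> Dom C q \<in> Ab C"
  then have "cover q (Dom C q) (Cod C q)" using regular_epi_arr by simp
  then show "Cod C q \<in> Ab C" using Ab_quotient q by blast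
qed

end

section \<open>Composites of central extensions\<close>

theorem proposition4p6:
  fixes C :: "('o, 'm) cat"
  assumes "semi_abelian C" and "enough_projectives C"
  shows "(\<forall>B. birkhoff C B \<and> Ab C \<subseteq> B \<and> recognition_conditions_equivalent C B \<longrightarrow>
            (\<forall>X A Y f g. perfect C B X \<and> f \<in> hom C X A \<and> g \<in> hom C Y X \<and>
               central_ext C B f \<and> central_ext C B g \<longrightarrow> central_ext C B (f \<cdot>\<^bsub>C\<^esub> g)))
         \<and> (recognition_conditions_equivalent C (Ab C) \<longrightarrow> UCE C)"
proof -
  interpret semi_abelian_cat C
    using assms(1) by (simp add: semi_abelian_cat_def semi_abelian_cat_axioms_def semi_abelian_def)
  have composite: "central_ext C B (f \<cdot>\<^bsub>C\<^esub> g)"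
    if "birkhoff C B" "recognition_conditions_equivalent C B" "perfect C B X"
      "f \<in> hom C X A" "central_ext C B f" "g \<in> hom C Y X" "central_ext C B g" for B X A Y f g
  proof -
    interpret birkhoff_cat C B by unfold_locales (rule that(1))
    show ?thesis by (rule composite_of_central_extensions[OF assms(2) that(2-7)])
  qed
  have "UCE C" if "recognition_conditions_equivalent C (Ab C)"
    unfolding UCE_def using composite[OF Ab_birkhoff that] by blast
  then show ?thesis using composite by blast
qed

end
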